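(* Let $D\subset\mathbb C$ be a domain, and let $\{\mu_\eta\}$ be the collection of all discrete measures on $\mathcal H_D$ corresponding to random colorings of trivalent tilings (of the plane or of a subdomain containing $D$). Then $\{\mu_\eta\}$ is precompact in the topology of weak-$*$ convergence on the space $\operatorname{Prob}(\mathcal H_D)$ of Borel probability measures on $(\mathcal H_D,\mathcal T_D)$.
   Context: Random colorings. A trivalent tiling $H$ of the plane (or of a subdomain) is a locally finite tiling by topologically closed polygonal tiles such that at most three tiles meet at every vertex (so any two tiles are disjoint or share edges). A random coloring is a probability measure on $\prod_{P\in H}\{\text{open},\text{closed}\}$ with the product $\sigma$-field (no independence is required). Open clusters are connected components of the union of open tiles; a quad $Q$ is crossed by the coloring $\omega$ if, for $\omega$ restricted to $[Q]$, some open cluster meets both $\partial_0Q$ and $\partial_2Q$. Each coloring $\omega$ gives the element $S_\omega\in\mathcal H_D$ consisting of all quads in $D$ crossed by $\omega$; the law of $S_\omega$ is the discrete measure $\mu_\eta$ on $\mathcal H_D$ ($\eta$ indexes the random colorings). Configuration space. A quad in $D$ is a homeomorphism $Q:[0,1]^2\to Q([0,1]^2)\subset D$; $\mathcal Q_D$ is the set of all quads in $D$ with the uniform metric $d(Q_1,Q_2)=\sup_{z\in[0,1]^2}|Q_1(z)-Q_2(z)|$. Write $[Q]:=Q([0,1]^2)$, $\partial_0Q:=Q(\{0\}\times[0,1])$, $\partial_2Q:=Q(\{1\}\times[0,1])$. A crossing of $Q$ is a connected compact subset of $[Q]$ intersecting both $\partial_0Q$ and $\partial_2Q$. Write $Q_1\le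 Q_2$ if every crossing of $Q_2$ contains a crossing of $Q_1$; write $Q_1<Q_2$ if there are open neighborhoods $U_1\ni Q_1$, $U_2\ni Q_2$ in $\mathcal Q_D$ with $Q\le Q'$ for all $Q\in U_1$, $Q'\in U_2$. $S\subset\mathcal Q_D$ is a lower set if $Q\in S$, $Q'\in\mathcal Q_D$, $Q'<Q$ imply $Q'\in S$. $\mathcal H_D$ is the collection of all topologically closed lower subsets of $\mathcal Q_D$, and $\mathcal T_D$ is the minimal topology on it containing all $V_U:=\{S: S\cap U\ne\varnothing\}$ ($U\subset\mathcal Q_D$ open) and $V^Q:=\{S: Q\notin S\}$ ($Q\in\mathcal Q_D$). *)

theory Defs
  imports "HOL-Probability.Probability"
begin

definition plane_domain :: "complex set \<Rightarrow> bool" where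
  "plane_domain D \<longleftrightarrow> open D \<and> connected D \<and> D \<noteq> {}"


section \<open>Quads\<close>

type_synonym quad = "real \<times> real \<Rightarrow> complex"

definition unit_square :: "(real \<times> real) set" where
  "unit_square = {0..1} \<times> {0..1}"

definition quad_image :: "quad \<Rightarrow> complex set" where
  "quad_image Q = Q ` unit_square"

definition quad_side0 :: "quad \<Rightarrow> complex set" where
  "quad_side0 Q = Q ` ({0} \<times> {0..1})"

definition quad_side2 :: "quad \<Rightarrow> complex set" where
  "quad_side2 Q = Q ` ({1} \<times> {0..1})"

text \<open>HOL functions are total, so a quad is represented by its extension by \<^const>\<open>undefined\<close>
  outside the unit square; two quads are then equal iff they agree on the square.\<close>

definition quads :: "complex set \<Rightarrow> quad set" where
  "quads D = {Q \<in> extensional unit_square.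
     (\<exists>R. homeomorphism unit_square (quad_image Q) Q R) \<and> quad_image Q \<subseteq> D}"

definition quad_metric :: "complex set \<Rightarrow> quad metric" where
  "quad_metric D = submetric (funspace unit_square euclidean_metric) (quads D)"

abbreviation quad_topology :: "complex set \<Rightarrow> quad topology" where
  "quad_topology D \<equiv> mtopology_of (quad_metric D)"

lemma compact_unit_square: "compact unit_square"
  unfolding unit_square_def by (intro compact_Times compact_Icc)

lemma quads_subset_funspace: "quads D \<subseteq> mspace (funspace unit_square euclidean_metric)"
proof
  fix Q assume Q: "Q \<in> quads D"
  then have "continuous_on unit_square Q" and ext: "Q \<in> extensional unit_square"
    by (auto simp: quads_def homeomorphism_def)
  then have "bounded (Q ` unit_square)"
    using compact_unit_square compact_continuous_image compact_imp_bounded by blast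
  with ext show "Q \<in> mspace (funspace unit_square euclidean_metric)"
    by (simp add: Met_TC.fspace_def)
qed

lemma mspace_quad_metric: "mspace (quad_metric D) = quads D"
  using quads_subset_funspace by (auto simp: quad_metric_def)

lemma mdist_quad_metric:
  assumes "Q1 \<in> quads D" "Q2 \<in> quads D"
  shows "mdist (quad_metric D) Q1 Q2 = (SUP z\<in>unit_square. cmod (Q1 z - Q2 z))"
proof -
  have "Q1 \<in> mspace (funspace unit_square euclidean_metric)"
    "Q2 \<in> mspace (funspace unit_square euclidean_metric)" "unit_square \<noteq> {}"
    using assms quads_subset_funspace by (auto simp: unit_square_def)
  then show ?thesis
    by (simp add: quad_metric_def Met_TC.fdist_def dist_norm)
qed

definition crossing :: "quad \<Rightarrow> complex set \<Rightarrow> bool" where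
  "crossing Q K \<longleftrightarrow> connected K \<and> compact K \<and> K \<subseteq> quad_image Q \<and>
     K \<inter> quad_side0 Q \<noteq> {} \<and> K \<inter> quad_side2 Q \<noteq> {}"

definition quad_le :: "quad \<Rightarrow> quad \<Rightarrow> bool" where
  "quad_le Q1 Q2 \<longleftrightarrow> (\<forall>K. crossing Q2 K \<longrightarrow> (\<exists>K'\<subseteq>K. crossing Q1 K'))"

definition quad_less :: "complex set \<Rightarrow> quad \<Rightarrow> quad \<Rightarrow> bool" where
  "quad_less D Q1 Q2 \<longleftrightarrow>
     (\<exists>U1 U2. openin (quad_topology D) U1 \<and> openin (quad_topology D) U2 \<and> Q1 \<in> U1 \<and> Q2 \<in> U2 \<and>
        (\<forall>Q\<in>U1. \<forall>Q'\<in>U2. quad_le Q Q'))"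


section \<open>The configuration space\<close>

definition lower_set :: "complex set \<Rightarrow> quad set \<Rightarrow> bool" where
  "lower_set D S \<longleftrightarrow> S \<subseteq> quads D \<and>
     (\<forall>Q\<in>S. \<forall>Q'\<in>quads D. quad_less D Q' Q \<longrightarrow> Q' \<in> S)"

definition config_space :: "complex set \<Rightarrow> quad set set" where
  "config_space D = {S. lower_set D S \<and> closedin (quad_topology D) S}"

text \<open>The whole space is added to the subbase only so that the result is a topology on
  \<^term>\<open>config_space D\<close> even for empty \<^term>\<open>D\<close>; for a domain it is already the union of the
  other subbasic sets.\<close>

definition config_topology :: "complex set \<Rightarrow> quad set topology" where
  "config_topology D = topology_generated_by
     (insert (config_space D)
       ({{S \<in> config_space D. S \<inter> U \<noteq> {}} | U. openin (quad_topology D) U} \<union>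
        {{S \<in> config_space D. Q \<notin> S} | Q. Q \<in> quads D}))"

lemma topspace_config_topology: "topspace (config_topology D) = config_space D"
  unfolding config_topology_def topology_generated_by_topspace by auto


section \<open>Weak-* convergence of probability measures\<close>

definition borel_of :: "'a topology \<Rightarrow> 'a measure" where
  "borel_of X = sigma (topspace X) {U. openin X U}"

definition prob_measures :: "'a topology \<Rightarrow> 'a measure set" where
  "prob_measures X = {\<mu>. prob_space \<mu> \<and> sets \<mu> = sets (borel_of X)}"

text \<open>The coarsest topology making \<open>\<mu> \<mapsto> \<integral> f d\<mu>\<close> continuous for every bounded continuous
  real function \<open>f\<close> on \<open>X\<close> (boundedness is automatic when \<open>X\<close> is compact).\<close>

definition weak_star_topology :: "'a topology \<Rightarrow> 'a measure topology" where
  "weak_star_topology X = topology_generated_by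
     {{\<mu> \<in> prob_measures X. (\<integral>x. f x \<partial>\<mu>) \<in> V} | f V.
        continuous_map X euclideanreal f \<and> bounded (f ` topspace X) \<and> open V}"

lemma topspace_weak_star_topology: "topspace (weak_star_topology X) = prob_measures X"
proof
  show "topspace (weak_star_topology X) \<subseteq> prob_measures X"
    unfolding weak_star_topology_def topology_generated_by_topspace by auto
  have "bounded ((\<lambda>_. 0::real) ` topspace X)"
    by (auto intro: finite_imp_bounded finite_subset[of _ "{0}"])
  then have "{\<mu> \<in> prob_measures X. (\<integral>x. 0 \<partial>\<mu>) \<in> (UNIV :: real set)} \<in>
      {{\<mu> \<in> prob_measures X. (\<integral>x. f x \<partial>\<mu>) \<in> V} | f V.
        continuous_map X euclideanreal f \<and> bounded (f ` topspace X) \<and> open V}"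
    by (intro CollectI exI[of _ "\<lambda>_. 0"] exI[of _ UNIV]) auto
  then show "prob_measures X \<subseteq> topspace (weak_star_topology X)"
    unfolding weak_star_topology_def topology_generated_by_topspace by blast
qed

text \<open>The inclusion is not redundant, since \<^const>\<open>closure_of\<close> silently discards points outside
  the space.\<close>

definition precompact_in :: "'a topology \<Rightarrow> 'a set \<Rightarrow> bool" where
  "precompact_in X A \<longleftrightarrow> A \<subseteq> topspace X \<and> compactin X (X closure_of A)"


section \<open>Random colorings of trivalent tilings\<close>

fun polygonal_path :: "complex list \<Rightarrow> real \<Rightarrow> complex" where
  "polygonal_path [] = linepath 0 0"
| "polygonal_path [a] = linepath a a"
| "polygonal_path [a, b] = linepath a b"
| "polygonal_path (a # b # c # vs) = linepath a b +++ polygonal_path (b # c # vs)"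

text \<open>\<open>P\<close> is the closed region bounded by the simple closed polygon with consecutive vertices
  \<open>vs\<close>. Angles of 180 degrees are allowed at the vertices, so that a point at which a corner of
  one tile lies on a side of another is covered as well.\<close>

definition polygon_with_vertices :: "complex list \<Rightarrow> complex set \<Rightarrow> bool" where
  "polygon_with_vertices vs P \<longleftrightarrow> 3 \<le> length vs \<and>
     (let \<gamma> = polygonal_path (vs @ [hd vs])
      in simple_path \<gamma> \<and> P = path_image \<gamma> \<union> inside (path_image \<gamma>))"

definition polygonal_tile :: "complex set \<Rightarrow> bool" where
  "polygonal_tile P \<longleftrightarrow> (\<exists>vs. polygon_with_vertices vs P)"

definition tile_vertex :: "complex set \<Rightarrow> complex \<Rightarrow> bool" where
  "tile_vertex P v \<longleftrightarrow> (\<exists>vs. polygon_with_vertices vs P \<and> v \<in> set vs)"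

text \<open>The tiles have disjoint interiors contained in \<open>E\<close> and cover \<open>E\<close>. Since tiles are closed
  and \<open>E\<close> is open, tiles are allowed to touch the boundary of \<open>E\<close>, so that a finite patch of
  tiles is a tiling of its interior; for \<open>E = UNIV\<close> these are the tilings of the plane.\<close>

definition tiling :: "complex set \<Rightarrow> complex set set \<Rightarrow> bool" where
  "tiling E H \<longleftrightarrow>
     (\<forall>P\<in>H. polygonal_tile P \<and> interior P \<subseteq> E) \<and>
     E \<subseteq> \<Union>H \<and>
     (\<forall>P\<in>H. \<forall>P'\<in>H. P \<noteq> P' \<longrightarrow> interior P \<inter> interior P' = {}) \<and>
     (\<forall>x\<in>E. \<exists>e>0. finite {P \<in> H. P \<inter> ball x e \<noteq> {}})"

definition trivalent_tiling :: "complex set \<Rightarrow> complex set set \<Rightarrow> bool" where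
  "trivalent_tiling E H \<longleftrightarrow> tiling E H \<and>
     (\<forall>P\<in>H. \<forall>v. tile_vertex P v \<longrightarrow> finite {P' \<in> H. v \<in> P'} \<and> card {P' \<in> H. v \<in> P'} \<le> 3)"

text \<open>A coloring is a function \<open>\<omega>\<close> on the tiles, with \<open>\<omega> P\<close> meaning that \<open>P\<close> is open.\<close>

definition random_coloring :: "complex set set \<Rightarrow> (complex set \<Rightarrow> bool) measure \<Rightarrow> bool" where
  "random_coloring H M \<longleftrightarrow>
     prob_space M \<and> sets M = sets (\<Pi>\<^sub>M P\<in>H. count_space (UNIV :: bool set))"

definition open_region :: "complex set set \<Rightarrow> (complex set \<Rightarrow> bool) \<Rightarrow> complex set" where
  "open_region H \<omega> = \<Union>{P \<in> H. \<omega> P}"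

definition crossed_by :: "complex set set \<Rightarrow> (complex set \<Rightarrow> bool) \<Rightarrow> quad \<Rightarrow> bool" where
  "crossed_by H \<omega> Q \<longleftrightarrow> (\<exists>C \<in> components (quad_image Q \<inter> open_region H \<omega>).
     C \<inter> quad_side0 Q \<noteq> {} \<and> C \<inter> quad_side2 Q \<noteq> {})"

definition crossed_quads :: "complex set \<Rightarrow> complex set set \<Rightarrow> (complex set \<Rightarrow> bool) \<Rightarrow> quad set" where
  "crossed_quads D H \<omega> = {Q \<in> quads D. crossed_by H \<omega> Q}"

definition discrete_measure ::
    "complex set \<Rightarrow> complex set set \<Rightarrow> (complex set \<Rightarrow> bool) measure \<Rightarrow> quad set measure" where
  "discrete_measure D H M = distr M (borel_of (config_topology D)) (crossed_quads D H)"

definition discrete_measures :: "complex set \<Rightarrow> quad set measure set" where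
  "discrete_measures D = {discrete_measure D H M | E H M.
     plane_domain E \<and> D \<subseteq> E \<and> trivalent_tiling E H \<and> random_coloring H M}"

end

theory Submission
  imports Defs "HOL-Complex_Analysis.Complex_Analysis" "HOL-Homology.Invariance_of_Domain"
begin

text \<open>Prob of a compact metrizable space is compact, so the theorem reduces to two facts.

  First, the configuration space is compact, Hausdorff and second countable. Compactness is
  Alexander's subbase theorem applied to the closed lower set generated by the quads of the sets
  \<open>V\<^sup>Q\<close> in a cover. The other two properties need that every quad \<open>Q\<close> is a limit of quads \<open>Q' < Q\<close>.
  To get \<open>Q'\<close>, extend \<open>Q\<close> to an embedding of a larger square, and precompose it with an affine map
  that makes the square narrower in the crossing direction and taller in the other one. The extension
  comes from Caratheodory's theorem for the exterior of \<open>Q\<close>, inverted to a bounded domain.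

  Second, a coloring induces a point of the configuration space, continuously for the product
  topology, hence measurably, because each crossing event depends on finitely many tiles.\<close>

section \<open>Caratheodory's extension theorem\<close>

text \<open>The obstacle is that \<open>quad_less\<close> must survive small perturbations of both
  quads. A quad inside \<open>[Q]\<close> is no candidate for \<open>Q' < Q\<close>: a crossing of
  \<open>Q\<close> may run along one of its two lateral sides and miss a slightly shrunk
  \<open>Q'\<close>. So \<open>Q'\<close> has to overhang \<open>[Q]\<close> beyond these sides,
  which is why \<open>Q\<close> must first be extended past the square although its boundary may be
  arbitrarily wild. The same stability pays off afterwards: \<open>quad_less\<close> is open in its
  larger argument. Hence the quads above a given one form an open set and closures of lower sets are
  lower. If \<open>Q\<close> lies in \<open>S\<close> but not in \<open>S'\<close>, a quad
  \<open>Q' < Q\<close> outside \<open>S'\<close> separates the two configurations: \<open>S\<close>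
  meets the open set of quads above \<open>Q'\<close>, while \<open>S'\<close> misses
  \<open>Q'\<close>. For the compactness of Prob, a measure is recorded by its masses on a binary
  tree of Borel cells. The admissible mass functions form a compact set, and each is turned back
  into a measure as the image of Lebesgue measure on [0,1) under a map that follows nested
  cells.\<close>

lemma closed_exp_loop_encloses_0:
  fixes \<Lambda> :: "real \<Rightarrow> complex"
  assumes \<Lambda>: "path \<Lambda>" and ne: "\<Lambda> 1 \<noteq> \<Lambda> 0" and loop: "exp (\<Lambda> 1) = exp (\<Lambda> 0)"
  shows "0 \<in> inside (path_image (exp \<circ> \<Lambda>))"
proof (rule ccontr)
  assume no: "0 \<notin> inside (path_image (exp \<circ> \<Lambda>))"
  have p: "path (exp \<circ> \<Lambda>)"
    using \<Lambda> by (intro path_continuous_image) (auto intro: holomorphic_on_imp_continuous_on[OF holomorphic_on_exp])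
  have z: "0 \<notin> path_image (exp \<circ> \<Lambda>)" by (auto simp: path_image_def)
  then have out: "0 \<in> outside (path_image (exp \<circ> \<Lambda>))"
    using no inside_Un_outside[of "path_image (exp \<circ> \<Lambda>)"] by blast
  \<comment> \<open>Winding number 0 means that the loop has a continuous logarithm \<open>q\<close>
    that closes up. It differs from the logarithm \<open>\<Lambda>\<close> by a continuous function
    with values in the discrete set of multiples of 2 \<pi> \<i>, hence by a constant, so
    \<open>\<Lambda>\<close> would close up too.\<close>
  have "winding_number (exp \<circ> \<Lambda>) 0 = 0"
    by (rule winding_number_zero_in_outside[OF p _ out])
      (simp add: pathfinish_def pathstart_def loop)
  moreover obtain q where q: "path q"
    "pathfinish q - pathstart q = 2 * of_real pi * \<i> * winding_number (exp \<circ> \<Lambda>) 0"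
    "\<And>t. t \<in> {0..1} \<Longrightarrow> (exp \<circ> \<Lambda>) t = 0 + exp(q t)"
    using winding_number_as_continuous_log[OF p z] by blast
  ultimately have qq: "q 1 = q 0" by (simp add: pathfinish_def pathstart_def)
  have cont: "continuous_on {0..1} (\<lambda>t. \<Lambda> t - q t)"
    using \<Lambda> q(1) by (intro continuous_intros) (auto simp: path_def)
  have ev: "\<exists>n::int. \<Lambda> t - q t = of_int (2*n) * pi * \<i>" if "t \<in> {0..1}" for t
    using q(3)[OF that] by (auto simp: exp_eq algebra_simps)
  have "(\<lambda>t. \<Lambda> t - q t) constant_on {0..1}"
  proof (rule continuous_discrete_range_constant[OF _ cont])
    fix x :: real assume x: "x \<in> {0..1}"
    show "\<exists>e>0. \<forall>y. y \<in> {0..1} \<and> \<Lambda> y - q y \<noteq> \<Lambda> x - q x \<longrightarrow> e \<le> cmod (\<Lambda> y - q y - (\<Lambda> x - q x))"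
    proof (intro exI[of _ 1] conjI allI impI)
      fix y assume y: "y \<in> {0..1} \<and> \<Lambda> y - q y \<noteq> \<Lambda> x - q x"
      obtain m n :: int where mn: "\<Lambda> y - q y = of_int (2*m) * pi * \<i>" "\<Lambda> x - q x = of_int (2*n) * pi * \<i>"
        using ev x y by meson
      then have "m \<noteq> n" using y by auto
      have "\<Lambda> y - q y - (\<Lambda> x - q x) = of_real (2 * (of_int m - of_int n) * pi) * \<i>"
        by (simp add: mn algebra_simps)
      then have "cmod (\<Lambda> y - q y - (\<Lambda> x - q x)) = \<bar>2 * (of_int m - of_int n) * pi\<bar>"
        by (simp only: norm_mult norm_of_real norm_ii)
      moreover have "\<bar>(of_int m - of_int n)\<bar> \<ge> (1::real)" using \<open>m \<noteq> n\<close> by linarith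
      moreover have "pi \<ge> 2" using pi_ge_two .
      ultimately show "1 \<le> cmod (\<Lambda> y - q y - (\<Lambda> x - q x))"
        by (simp add: abs_mult) (smt (verit, best) mult_le_cancel_right1)
    qed simp
  qed auto
  then have "\<Lambda> 1 - q 1 = \<Lambda> 0 - q 0"
    unfolding constant_on_def by (metis atLeastAtMost_iff order_refl zero_le_one)
  then show False using qq ne by simp
qed

text \<open>The path \<open>exp \<circ> q\<close> turns by at least \<open>\<pi> / N\<close>. Its images under the dihedral group of
  order \<open>2 N\<close> together enclose \<open>0\<close>, and the product of the corresponding copies of \<open>h\<close> is bounded by
  \<open>\<epsilon>\<close> there.\<close>

lemma koebe_lemma:
  fixes h :: "complex \<Rightarrow> complex" and q :: "real \<Rightarrow> complex" and N :: nat
  assumes holh: "h holomorphic_on ball 0 1" and h1: "\<And>z. norm z < 1 \<Longrightarrow> norm (h z) \<le> 1"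
    and q: "path q" and qneg: "\<And>t. t \<in> {0..1} \<Longrightarrow> Re (q t) < 0"
    and eps: "\<And>t. t \<in> {0..1} \<Longrightarrow> norm (h (exp (q t))) \<le> \<epsilon>"
    and N: "0 < N" and ang: "pi / N \<le> \<bar>Im (q 1) - Im (q 0)\<bar>"
  shows "norm (h 0) ^ (2 * N) \<le> \<epsilon>"
proof -
  have cq: "continuous_on {0..1} q" using q by (simp add: path_def)
  \<comment> \<open>Cutting \<open>q\<close> off at \<open>s\<close> makes its turn exactly
    \<open>pi / N\<close>. The rotations in \<open>l\<close> and \<open>h'\<close> below let the
    curve \<open>exp \<circ> l\<close> start on the positive real axis.\<close>
  obtain s where s: "0 \<le> s" "s \<le> 1" "\<bar>Im (q s) - Im (q 0)\<bar> = pi / N"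
    using IVT'[of "\<lambda>t. \<bar>Im (q t) - Im (q 0)\<bar>" 0 "pi / N" 1] ang cq
    by (force intro!: continuous_intros)
  define \<theta> where "\<theta> = Im (q 0)"
  define l where "l t = q (s * t) - \<i> * \<theta>" for t
  have st: "s * t \<in> {0..1}" if "t \<in> {0..1}" for t
    using s that by (auto simp: mult_le_one)
  have cl: "continuous_on {0..1} l"
    unfolding l_def using st s
    by (intro continuous_intros continuous_on_compose2[OF cq]) auto
  have l0: "Im (l 0) = 0" by (simp add: l_def \<theta>_def)
  have l1: "\<bar>Im (l 1)\<bar> = pi / N" using s by (simp add: l_def \<theta>_def)
  have lneg: "Re (l t) < 0" if "t \<in> {0..1}" for t
    using qneg[OF st[OF that]] by (simp add: l_def)
  define h' where "h' z = h (exp (\<i> * \<theta>) * z)" for z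
  have h'eps: "norm (h' (exp (l t))) \<le> \<epsilon>" if "t \<in> {0..1}" for t
    using eps[OF st[OF that]] by (simp add: h'_def l_def flip: exp_add)
  have h'1: "norm (h' z) \<le> 1" if "norm z < 1" for z
    unfolding h'_def by (rule h1) (simp add: norm_mult that)
  have holh': "h' holomorphic_on ball 0 1"
    unfolding h'_def
    by (rule holomorphic_on_compose_gen[OF _ holh, unfolded o_def])
      (auto intro!: holomorphic_intros simp: norm_mult)
  \<comment> \<open>\<open>exp \<circ> \<Lambda>\<close> is the \<open>N\<close>-th power of the
    curve \<open>exp \<circ> l\<close>, followed by its mirror image run backwards. The power turns
    by exactly \<pi>, from the positive to the negative real axis, so the mirror image closes it up.
    The shift, equal to 2 \<pi> \<i> up to sign, joins the two logarithms and keeps the total turn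
    nonzero.\<close>
  define \<Lambda> where "\<Lambda> = (\<lambda>t. N * l t) +++ (\<lambda>t. cnj (N * l (1 - t)) + 2 * \<i> * N * Im (l 1))"
  have p\<Lambda>: "path \<Lambda>"
    unfolding \<Lambda>_def
  proof (rule path_join_imp)
    show "path (\<lambda>t. N * l t)" unfolding path_def by (intro continuous_intros cl)
    show "path (\<lambda>t. cnj (N * l (1 - t)) + 2 * \<i> * N * Im (l 1))"
      unfolding path_def
      by (intro continuous_intros continuous_on_compose2[OF cl]) auto
    show "pathfinish (\<lambda>t. of_nat N * l t) = pathstart (\<lambda>t. cnj (of_nat N * l (1 - t)) + 2 * \<i> * N * Im (l 1))"
      by (simp add: pathfinish_def pathstart_def complex_eq_iff)
  qed
  have e1: "exp (2 * \<i> * N * Im (l 1)) = 1"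
  proof -
    have "Im (l 1) = pi / N \<or> Im (l 1) = - pi / N" using l1 by linarith
    moreover have "exp (2 * \<i> * N * complex_of_real (pi / N)) = 1" using N by (simp add: exp_eq_1)
    moreover have "exp (2 * \<i> * N * complex_of_real (- pi / N)) = 1" using N by (auto simp: exp_eq_1 intro!: exI[of _ "-1"])
    ultimately show ?thesis by metis
  qed
  have \<Lambda>1: "\<Lambda> 1 = cnj (N * l 0) + 2 * \<i> * N * Im (l 1)"
    by (simp add: \<Lambda>_def joinpaths_def)
  have \<Lambda>0: "\<Lambda> 0 = N * l 0" by (simp add: \<Lambda>_def joinpaths_def)
  have cl0: "cnj (of_nat N * l 0) = of_nat N * l 0" using l0 by (simp add: complex_eq_iff)
  have "Im (l 1) \<noteq> 0" using l1 N by auto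
  then have ne: "\<Lambda> 1 \<noteq> \<Lambda> 0" unfolding \<Lambda>1 \<Lambda>0 cl0 using N by simp
  have loop: "exp (\<Lambda> 1) = exp (\<Lambda> 0)" unfolding \<Lambda>1 \<Lambda>0 cl0 by (simp add: exp_add e1)
  define L where "L = path_image (exp \<circ> \<Lambda>)"
  have L0: "0 \<in> inside L" unfolding L_def
    by (rule closed_exp_loop_encloses_0[OF p\<Lambda> ne loop])
  have Lform: "\<exists>t\<in>{0..1}. u = exp (l t) ^ N \<or> u = cnj (exp (l t)) ^ N" if "u \<in> L" for u
  proof -
    have "path_image \<Lambda> = path_image (\<lambda>t. N * l t) \<union> path_image (\<lambda>t. cnj (N * l (1 - t)) + 2 * \<i> * N * Im (l 1))"
      unfolding \<Lambda>_def by (rule path_image_join) (simp add: pathfinish_def pathstart_def complex_eq_iff)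
    then have "u \<in> exp ` path_image (\<lambda>t. N * l t) \<or> u \<in> exp ` path_image (\<lambda>t. cnj (N * l (1 - t)) + 2 * \<i> * N * Im (l 1))"
      using that unfolding L_def path_image_compose by auto
    then show ?thesis
    proof
      assume "u \<in> exp ` path_image (\<lambda>t. N * l t)"
      then show ?thesis by (auto simp: path_image_def exp_of_nat_mult)
    next
      assume "u \<in> exp ` path_image (\<lambda>t. cnj (N * l (1 - t)) + 2 * \<i> * N * Im (l 1))"
      then obtain t where t: "t \<in> {0..1}" "u = exp (cnj (N * l (1 - t)) + 2 * \<i> * N * Im (l 1))"
        by (auto simp: path_image_def)
      have "u = exp (of_nat N * cnj (l (1 - t)))" using t by (simp add: exp_add e1)
      then have "u = cnj (exp (l (1 - t))) ^ N" by (simp only: exp_of_nat_mult exp_cnj)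
      then show ?thesis using t(1) by (intro bexI[of _ "1 - t"]) auto
    qed
  qed
  have Lball: "L \<subseteq> ball 0 1"
  proof
    fix u assume "u \<in> L"
    then obtain t where t: "t \<in> {0..1}" "u = exp (l t) ^ N \<or> u = cnj (exp (l t)) ^ N" using Lform by blast
    have "norm (exp (l t)) < 1" using lneg[OF t(1)] by simp
    then have "norm (exp (l t)) ^ N < 1" using N by (intro power_less_one_iff[THEN iffD2]) auto
    then show "u \<in> ball 0 1" using t by (auto simp: norm_power)
  qed
  have inL: "inside L \<subseteq> ball 0 1" using outside_mono[OF Lball] convex_in_outside[of "ball (0::complex) 1"] inside_Int_outside[of L] by blast
  \<comment> \<open>Pulling \<open>L\<close> back under the \<open>N\<close>-th power produces all
    rotated and reflected copies of \<open>exp \<circ> l\<close> at once; \<open>V\<close> is the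
    region that they enclose.\<close>
  define V where "V = (\<lambda>z::complex. z ^ N) -` inside L"
  have cL: "closed L" unfolding L_def
    using p\<Lambda> by (intro closed_path_image path_continuous_image) (auto intro: holomorphic_on_imp_continuous_on[OF holomorphic_on_exp])
  have oV: "open V" unfolding V_def
    by (intro open_vimage open_inside cL continuous_intros)
  have pb: "z \<in> ball 0 1" if "z ^ N \<in> ball 0 (1::real)" for z :: complex
    using that N by (auto simp: norm_power power_less_one_iff)
  have Vb: "V \<subseteq> ball 0 1" unfolding V_def using inL pb by auto
  have clV: "closure V \<subseteq> {z. z ^ N \<in> L \<union> inside L}"
  proof (rule closure_minimal)
    show "V \<subseteq> {z. z ^ N \<in> L \<union> inside L}" by (auto simp: V_def)
    have "closed ((\<lambda>z::complex. z ^ N) -` (L \<union> inside L))"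
      using p\<Lambda> unfolding L_def
      by (intro closed_vimage closed_path_image_Un_inside path_continuous_image
          holomorphic_on_imp_continuous_on[OF holomorphic_on_exp] continuous_intros)
    then show "closed {z. z ^ N \<in> L \<union> inside L}" by (simp add: vimage_def)
  qed
  have clVb: "closure V \<subseteq> ball 0 1" using clV Lball inL pb by blast
  define \<omega> where "\<omega> = exp (2 * of_real pi * \<i> / N)"
  have n\<omega>: "norm \<omega> = 1" unfolding \<omega>_def by simp
  \<comment> \<open>One factor for each element of the dihedral group; the outer \<open>cnj\<close>
    keeps the reflected factors holomorphic. Every factor has norm at most 1, each has norm
    \<open>norm (h 0)\<close> at 0, and on the frontier of \<open>V\<close> at least one has norm at
    most \<open>\<epsilon>\<close>.\<close>
  define H where "H z = (\<Prod>k<N. h' (\<omega>^k * z) * cnj (h' (cnj (\<omega>^k * z))))" for z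
  have holc: "(\<lambda>z. cnj (h' (cnj z))) holomorphic_on ball 0 1"
  proof -
    have "(cnj \<circ> h' \<circ> cnj) field_differentiable at z" if "z \<in> ball 0 1" for z
    proof -
      have "h' field_differentiable at (cnj z)"
        using holh' that holomorphic_on_imp_differentiable_at[of h' "ball 0 1" "cnj z"] by auto
      then have "(h' has_field_derivative deriv h' (cnj z)) (at (cnj z))"
        by (rule field_differentiable_derivI)
      then have "(cnj \<circ> h' \<circ> cnj has_field_derivative cnj (deriv h' (cnj z))) (at z)"
        by (rule has_field_derivative_cnj_cnj)
      then show ?thesis by (auto simp: field_differentiable_def)
    qed
    then have "(cnj \<circ> h' \<circ> cnj) holomorphic_on ball 0 1"
      by (simp add: field_differentiable_at_within holomorphic_on_def)
    then show ?thesis by (simp add: o_def)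
  qed
  have holH: "H holomorphic_on ball 0 1"
    unfolding H_def
  proof (intro holomorphic_intros)
    fix k
    show "(\<lambda>z. h' (\<omega>^k * z)) holomorphic_on ball 0 1"
      by (rule holomorphic_on_compose_gen[OF _ holh', unfolded o_def])
        (auto intro!: holomorphic_intros simp: norm_mult norm_power n\<omega>)
    show "(\<lambda>z. cnj (h' (cnj (\<omega>^k * z)))) holomorphic_on ball 0 1"
      by (rule holomorphic_on_compose_gen[OF _ holc, unfolded o_def])
        (auto intro!: holomorphic_intros simp: norm_mult norm_power n\<omega>)
  qed
  have nH: "norm (H z) = (\<Prod>k<N. norm (h' (\<omega>^k * z)) * norm (h' (cnj (\<omega>^k * z))))" for z
    by (simp add: H_def norm_mult flip: prod_norm)
  have bd: "norm (H z) \<le> \<epsilon>" if z: "z ^ N \<in> L" for z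
  proof -
    obtain t where t: "t \<in> {0..1}" "z ^ N = exp (l t) ^ N \<or> z ^ N = cnj (exp (l t)) ^ N" using Lform[OF z] by blast
    have zb: "norm z < 1" using pb[of z] z Lball by auto
    have z1: "norm (\<omega>^k * z) < 1" for k using zb by (simp add: norm_mult norm_power n\<omega>)
    have z2: "norm (cnj (\<omega>^k * z)) < 1" for k using z1[of k] by (simp only: complex_mod_cnj)
    have root: "\<exists>k<N. \<omega>^k * z = w" if "z ^ N = w ^ N" for w
    proof (cases "z = 0")
      case True
      then show ?thesis using that N by (auto intro!: exI[of _ 0] simp: power_0_left)
    next
      case False
      then have "(w / z) ^ N = 1" by (simp add: power_divide flip: that)
      then obtain j where j: "j < N" "w / z = exp (2 * of_real pi * \<i> * of_nat j / of_nat N)"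
        using complex_roots_unity[of N] N by auto
      have "exp (2 * of_real pi * \<i> * of_nat j / of_nat N) = \<omega> ^ j"
        unfolding \<omega>_def by (simp add: mult_ac flip: exp_of_nat_mult)
      then show ?thesis using j False by (auto simp: field_simps)
    qed
    have "\<exists>k<N. norm (h' (\<omega>^k * z)) * norm (h' (cnj (\<omega>^k * z))) \<le> \<epsilon>"
    proof (cases "z ^ N = exp (l t) ^ N")
      case True
      then obtain k where k: "k < N" "\<omega>^k * z = exp (l t)" using root by blast
      have "norm (h' (\<omega>^k * z)) * norm (h' (cnj (\<omega>^k * z))) \<le> norm (h' (\<omega>^k * z)) * 1"
        by (intro mult_left_mono h'1 z2) simp
      then show ?thesis using k h'eps[OF t(1)] by (metis mult.right_neutral order_trans)
    next
      case False
      then obtain k where k: "k < N" "\<omega>^k * z = cnj (exp (l t))" using root t by blast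
      then have k2: "cnj (\<omega>^k * z) = exp (l t)" by (metis complex_cnj_cnj)
      have "norm (h' (\<omega>^k * z)) * norm (h' (cnj (\<omega>^k * z))) \<le> 1 * norm (h' (cnj (\<omega>^k * z)))"
        by (intro mult_right_mono h'1 z1) simp
      then show ?thesis using k(1) k2 h'eps[OF t(1)] by (metis mult.left_neutral order_trans)
    qed
    then obtain k where k: "k < N" "norm (h' (\<omega>^k * z)) * norm (h' (cnj (\<omega>^k * z))) \<le> \<epsilon>" by blast
    have "norm (H z) = norm (h' (\<omega>^k * z)) * norm (h' (cnj (\<omega>^k * z))) *
        (\<Prod>k\<in>{..<N}-{k}. norm (h' (\<omega>^k * z)) * norm (h' (cnj (\<omega>^k * z))))"
      unfolding nH using k(1) by (subst prod.remove[of _ k]) auto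
    also have "\<dots> \<le> norm (h' (\<omega>^k * z)) * norm (h' (cnj (\<omega>^k * z))) * 1"
      by (intro mult_left_mono prod_le_1 conjI mult_le_one h'1 z1 z2 mult_nonneg_nonneg norm_ge_zero)
    finally show ?thesis using k(2) by simp
  qed
  have "norm (H 0) \<le> \<epsilon>"
  proof (rule maximum_modulus_frontier[of H V])
    show "H holomorphic_on interior V" using holH Vb oV by (auto simp: interior_open intro: holomorphic_on_subset)
    show "continuous_on (closure V) H" using holH clVb holomorphic_on_imp_continuous_on continuous_on_subset by blast
    show "bounded V" using Vb bounded_subset bounded_ball by blast
    show "norm (H z) \<le> \<epsilon>" if "z \<in> frontier V" for z
    proof (rule bd)
      have "z \<in> closure V" "z \<notin> V" using that by (auto simp: frontier_def interior_open[OF oV])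
      then show "z ^ N \<in> L" using clV by (auto simp: V_def)
    qed
    show "0 \<in> V" using L0 N by (simp add: V_def power_0_left)
  qed
  also have "norm (H 0) = (norm (h 0) * norm (h 0)) ^ N"
    unfolding nH by (simp add: h'_def)
  also have "\<dots> = norm (h 0) ^ (2 * N)"
    by (simp add: power_mult power2_eq_square)
  finally show ?thesis .
qed

text \<open>Janiszewski's theorem does the work. The loop meets \<open>B\<close>, the outside of the
  \<open>\<eta>\<close>-ball together with the far part \<open>J2\<close> of the loop, exactly in
  the connected set \<open>J2\<close>. So two points that are joined off the loop (by
  \<open>\<Omega>\<close>) and off \<open>B\<close> (by a small ball about \<open>p\<close>) are
  joined off both.\<close>

lemma simple_loop_locally_connected_complement:
  fixes \<gamma> :: "real \<Rightarrow> complex"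
  assumes \<gamma>: "simple_path \<gamma>" "pathfinish \<gamma> = pathstart \<gamma>" and p: "p \<in> path_image \<gamma>"
    and \<Omega>: "connected \<Omega>" "\<Omega> \<inter> path_image \<gamma> = {}" "frontier \<Omega> \<subseteq> path_image \<gamma>" and \<eta>: "\<eta> > 0"
  shows "\<exists>\<delta>>0. \<forall>w\<in>\<Omega> \<inter> ball p \<delta>. \<forall>w'\<in>\<Omega> \<inter> ball p \<delta>.
           \<exists>c. path c \<and> path_image c \<subseteq> \<Omega> \<inter> ball p \<eta> \<and> pathstart c = w \<and> pathfinish c = w'"
proof -
  obtain a where a: "a \<in> {0..1}" "p = \<gamma> a" using p by (auto simp: path_image_def)
  \<comment> \<open>Rebasing the loop at \<open>p\<close> makes the part away from \<open>p\<close>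
    the image of the single interval \<open>{d..1-d}\<close>, hence connected.\<close>
  define \<beta> where "\<beta> = shiftpath a \<gamma>"
  have \<beta>: "simple_path \<beta>" "pathfinish \<beta> = pathstart \<beta>" "path_image \<beta> = path_image \<gamma>"
    using \<gamma> a by (auto simp: \<beta>_def simple_path_shiftpath path_image_shiftpath closed_shiftpath)
  have \<beta>0: "\<beta> 0 = p" "\<beta> 1 = p"
    using \<beta>(2) a by (auto simp: \<beta>_def shiftpath_def pathfinish_def pathstart_def)
  have cont: "continuous_on {0..1} \<beta>" using \<beta>(1) by (simp add: simple_path_def path_def)
  obtain d0 where d0: "d0 > 0" "\<And>t. t \<in> {0..1} \<Longrightarrow> dist t 0 < d0 \<Longrightarrow> dist (\<beta> t) (\<beta> 0) < \<eta>"
    using cont[unfolded continuous_on_iff, rule_format, of 0 \<eta>] \<eta> by auto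
  obtain d1 where d1: "d1 > 0" "\<And>t. t \<in> {0..1} \<Longrightarrow> dist t 1 < d1 \<Longrightarrow> dist (\<beta> t) (\<beta> 1) < \<eta>"
    using cont[unfolded continuous_on_iff, rule_format, of 1 \<eta>] \<eta> by auto
  define d where "d = Min {d0, d1, 1/2}"
  have d: "0 < d" "d \<le> 1/2" "d \<le> d0" "d \<le> d1" using d0 d1 by (auto simp: d_def)
  define J where "J = path_image \<gamma>"
  define J2 where "J2 = \<beta> ` {d..1-d}"
  have J\<beta>: "J = \<beta> ` {0..1}" using \<beta>(3) by (simp add: J_def path_image_def)
  have near: "\<beta> t \<in> ball p \<eta>" if "t \<in> {0..1}" "t \<notin> {d..1-d}" for t
  proof (cases "t < d")
    case True
    then have "dist t 0 < d0" using that(1) d by (simp add: dist_real_def)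
    then show ?thesis using d0(2)[OF that(1)] by (simp add: \<beta>0 dist_commute)
  next
    case False
    then have "dist t 1 < d1" using that d by (auto simp: dist_real_def)
    then show ?thesis using d1(2)[OF that(1)] by (simp add: \<beta>0 dist_commute)
  qed
  have J2J: "J2 \<subseteq> J" using d by (auto simp: J2_def J\<beta>)
  have conJ2: "connected J2" unfolding J2_def
    by (intro connected_continuous_image continuous_on_subset[OF cont]) (use d in auto)
  have comJ2: "compact J2" unfolding J2_def
    by (intro compact_continuous_image continuous_on_subset[OF cont]) (use d in auto)
  have pJ2: "p \<notin> J2"
  proof
    assume "p \<in> J2"
    then obtain t where t: "t \<in> {d..1-d}" "\<beta> t = \<beta> 0" using \<beta>0 by (auto simp: J2_def)
    moreover have "t \<in> {0..1}" "(0::real) \<in> {0..1}" using t d by auto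
    ultimately have "t = 0 \<or> t = 1"
      using \<beta>(1) unfolding simple_path_def loop_free_def by blast
    then show False using t d by auto
  qed
  then obtain \<delta>0 where \<delta>0: "\<delta>0 > 0" "ball p \<delta>0 \<inter> J2 = {}"
    using open_Compl[OF compact_imp_closed[OF comJ2]] unfolding open_contains_ball by blast
  define \<delta> where "\<delta> = min \<delta>0 \<eta>"
  have \<delta>: "\<delta> > 0" "ball p \<delta> \<inter> J2 = {}" "ball p \<delta> \<subseteq> ball p \<eta>"
    using \<delta>0 \<eta> by (auto simp: \<delta>_def)
  define B where "B = - ball p \<eta> \<union> J2"
  have clB: "closed B" unfolding B_def using compact_imp_closed[OF comJ2] by (intro closed_Un) auto
  have comJ: "compact J" using \<gamma> by (simp add: J_def compact_simple_path_image)
  have JB: "J \<inter> B = J2"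
  proof
    show "J \<inter> B \<subseteq> J2"
    proof
      fix x assume x: "x \<in> J \<inter> B"
      then obtain t where t: "t \<in> {0..1}" "x = \<beta> t" by (auto simp: J\<beta>)
      show "x \<in> J2"
      proof (rule ccontr)
        assume "x \<notin> J2"
        then have "t \<notin> {d..1-d}" "x \<in> - ball p \<eta>" using t x by (auto simp: J2_def B_def)
        then show False using near[OF t(1)] t(2) by blast
      qed
    qed
    show "J2 \<subseteq> J \<inter> B" using J2J by (auto simp: B_def)
  qed
  show ?thesis
  proof (intro exI[of _ \<delta>] conjI ballI \<delta>(1))
    fix w w' assume w: "w \<in> \<Omega> \<inter> ball p \<delta>" and w': "w' \<in> \<Omega> \<inter> ball p \<delta>"
    have "connected_component (- (J \<union> B)) w w'"
    proof (rule Janiszewski[OF comJ clB])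
      show "connected (J \<inter> B)" using conJ2 JB by simp
      show "connected_component (- J) w w'"
        unfolding connected_component_def
        using \<Omega> w w' by (intro exI[of _ \<Omega>]) (auto simp: J_def)
      show "connected_component (- B) w w'"
        unfolding connected_component_def
        using w w' \<delta> by (intro exI[of _ "ball p \<delta>"]) (auto simp: B_def)
    qed
    then have "path_component (- (J \<union> B)) w w'"
      using comJ clB by (subst open_path_connected_component) (auto simp: open_Compl compact_imp_closed closed_Un)
    then obtain c where c: "path c" "path_image c \<subseteq> - (J \<union> B)" "pathstart c = w" "pathfinish c = w'"
      by (auto simp: path_component_def)
    have "path_image c \<subseteq> \<Omega>"
    proof (rule ccontr)
      assume "\<not> path_image c \<subseteq> \<Omega>"
      then have "path_image c \<inter> frontier \<Omega> \<noteq> {}"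
        using c w pathstart_in_path_image[of c]
        by (intro connected_Int_frontier connected_path_image) auto
      then show False using \<Omega>(3) c(2) by (auto simp: J_def)
    qed
    moreover have "path_image c \<subseteq> ball p \<eta>" using c(2) by (auto simp: B_def)
    ultimately show "\<exists>c. path c \<and> path_image c \<subseteq> \<Omega> \<inter> ball p \<eta> \<and> pathstart c = w \<and> pathfinish c = w'"
      using c by blast
  qed
qed

section \<open>Continuity of the Riemann map up to the boundary\<close>

lemma norm_exp_diff_le:
  assumes "Re u \<le> 0" "Re v \<le> 0"
  shows "norm (exp u - exp v) \<le> \<bar>exp (Re u) - exp (Re v)\<bar> + \<bar>Im u - Im v\<bar>"
proof -
  have *: "norm (exp (\<i> * of_real s) - exp (\<i> * of_real t)) \<le> \<bar>s - t\<bar>" for s t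
  proof -
    have "exp (\<i> * of_real s) - exp (\<i> * of_real t) = exp (\<i> * of_real t) * (exp (\<i> * of_real (s - t)) - 1)"
      by (simp add: algebra_simps flip: exp_add)
    then have "norm (exp (\<i> * of_real s) - exp (\<i> * of_real t)) = 2 * \<bar>sin ((s - t) / 2)\<bar>"
      by (simp only: norm_mult norm_exp_i_times dist_exp_i_1)
    also have "\<dots> \<le> 2 * \<bar>(s - t) / 2\<bar>" by (intro mult_left_mono abs_sin_x_le_abs_x) simp
    finally show ?thesis by simp
  qed
  have e: "exp z = exp (Re z) * exp (\<i> * of_real (Im z))" for z :: complex
    by (metis complex_eq exp_add exp_of_real)
  have "exp u - exp v = of_real (exp (Re u) - exp (Re v)) * exp (\<i> * of_real (Im u)) +
      of_real (exp (Re v)) * (exp (\<i> * of_real (Im u)) - exp (\<i> * of_real (Im v)))"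
    unfolding e[of u] e[of v] by (simp add: algebra_simps)
  also have "norm \<dots> \<le> norm (of_real (exp (Re u) - exp (Re v)) * exp (\<i> * of_real (Im u))) +
      norm (of_real (exp (Re v)) * (exp (\<i> * of_real (Im u)) - exp (\<i> * of_real (Im v))))"
    by (rule norm_triangle_ineq)
  also have "\<dots> \<le> \<bar>exp (Re u) - exp (Re v)\<bar> + 1 * \<bar>Im u - Im v\<bar>"
    unfolding norm_mult norm_of_real norm_exp_i_times
    using assms by (intro add_mono mult_mono *) auto
  finally show ?thesis by simp
qed

text \<open>If \<open>g\<close> sent a short curve near \<open>p\<close> to one of diameter at least \<open>d\<close>, then \<open>\<phi> - p\<close> would be small
  on the latter, contrary to Koebe's lemma.\<close>

lemma riemann_map_oscillation_at_boundary:
  fixes \<phi> g :: "complex \<Rightarrow> complex"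
  assumes bd: "bounded \<Omega>" and cg: "continuous_on \<Omega> g" and hol: "\<phi> holomorphic_on ball 0 1"
    and g: "\<And>w. w \<in> \<Omega> \<Longrightarrow> g w \<in> ball 0 1 \<and> \<phi> (g w) = w"
    and \<phi>: "\<And>z. z \<in> ball 0 1 \<Longrightarrow> \<phi> z \<in> \<Omega>"
    and p: "p \<in> closure \<Omega>" "p \<notin> \<Omega>"
    and lc: "\<And>\<eta>. \<eta> > 0 \<Longrightarrow> \<exists>\<delta>>0. \<forall>w\<in>\<Omega> \<inter> ball p \<delta>. \<forall>w'\<in>\<Omega> \<inter> ball p \<delta>.
           \<exists>c. path c \<and> path_image c \<subseteq> \<Omega> \<inter> ball p \<eta> \<and> pathstart c = w \<and> pathfinish c = w'"
    and d0: "d > 0"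
  shows "\<exists>\<delta>>0. \<forall>w\<in>\<Omega> \<inter> ball p \<delta>. \<forall>w'\<in>\<Omega> \<inter> ball p \<delta>. norm (g w - g w') < d"
proof -
  \<comment> \<open>The cap 1 keeps the radius \<open>1 - d' / 4\<close> positive. The bound
    \<open>d\<close> will be split into an angular part below \<open>d' / 2\<close>, through the
    choice of \<open>N\<close>, and a radial part below \<open>d' / 4\<close>.\<close>
  define d' where "d' = min d 1"
  have d': "0 < d'" "d' \<le> 1" "d' \<le> d" using d0 by (auto simp: d'_def)
  obtain N :: nat where N: "N > 0" "pi / N < d' / 2"
  proof -
    obtain n :: nat where "pi / (d' / 2) < n" using reals_Archimedean2 by blast
    moreover from this have "n > 0" using d' by (cases n) (auto simp: field_simps not_less)
    ultimately show ?thesis using d' that[of n] by (simp add: field_simps)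
  qed
  obtain B where B: "B > 0" "\<And>w. w \<in> \<Omega> \<Longrightarrow> norm w \<le> B" using bd bounded_pos by metis
  have "norm p \<le> B"
  proof -
    have "closure \<Omega> \<subseteq> cball 0 B" using B by (intro closure_minimal) auto
    then show ?thesis using p by auto
  qed
  define M where "M = 2 * B"
  have M: "M > 0" using B by (simp add: M_def)
  have \<phi>M: "norm (\<phi> z - p) \<le> M" if "norm z < 1" for z
    using norm_triangle_ineq4[of "\<phi> z" p] B(2)[OF \<phi>, of z] \<open>norm p \<le> B\<close> that by (auto simp: M_def)
  have c0: "norm (\<phi> 0 - p) > 0" using \<phi>[of 0] p by auto
  define h where "h z = (\<phi> z - p) / M" for z
  have h0: "norm (h 0) > 0" using c0 M by (simp add: h_def norm_divide)
  \<comment> \<open>The image of this smaller disc is compact and misses \<open>p\<close>. Hence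
    \<open>g\<close> sends points of \<open>\<Omega>\<close> near \<open>p\<close> into the thin
    ring outside the smaller disc, which controls the radial part.\<close>
  have "compact (\<phi> ` cball 0 (1 - d' / 4))"
    using d' hol by (intro compact_continuous_image holomorphic_on_imp_continuous_on holomorphic_on_subset[OF hol]) auto
  moreover have "p \<notin> \<phi> ` cball 0 (1 - d' / 4)" using \<phi> p d' by force
  ultimately obtain \<eta>1 where \<eta>1: "\<eta>1 > 0" "ball p \<eta>1 \<inter> \<phi> ` cball 0 (1 - d' / 4) = {}"
    using open_Compl[OF compact_imp_closed, of "\<phi> ` cball 0 (1 - d' / 4)"]
    unfolding open_contains_ball by blast
  \<comment> \<open>The second bound prepares the contradiction: a turn by \<open>pi / N\<close>
    would give \<open>norm (h 0) ^ (2 * N) \<le> \<eta> / M\<close>. The factor 1/2 makes the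
    opposite inequality strict.\<close>
  define \<eta> where "\<eta> = min \<eta>1 (M * norm (h 0) ^ (2 * N) / 2)"
  have \<eta>: "\<eta> > 0" "\<eta> \<le> \<eta>1" "\<eta> / M < norm (h 0) ^ (2 * N)"
  proof -
    show "\<eta> > 0" using \<eta>1 M h0 by (simp add: \<eta>_def)
    show "\<eta> \<le> \<eta>1" by (simp add: \<eta>_def)
    have "\<eta> \<le> M * norm (h 0) ^ (2 * N) / 2" by (simp add: \<eta>_def)
    also have "\<dots> < M * norm (h 0) ^ (2 * N)" using M h0 by simp
    finally show "\<eta> / M < norm (h 0) ^ (2 * N)" using M by (simp add: field_simps)
  qed
  obtain \<delta> where \<delta>: "\<delta> > 0" and join: "\<And>w w'. w\<in>\<Omega> \<inter> ball p \<delta> \<Longrightarrow> w'\<in>\<Omega> \<inter> ball p \<delta> \<Longrightarrow>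
           \<exists>c. path c \<and> path_image c \<subseteq> \<Omega> \<inter> ball p \<eta> \<and> pathstart c = w \<and> pathfinish c = w'"
    using lc[OF \<eta>(1)] by blast
  show ?thesis
  proof (intro exI[of _ \<delta>] conjI ballI \<delta>)
    fix w w' assume w: "w \<in> \<Omega> \<inter> ball p \<delta>" and w': "w' \<in> \<Omega> \<inter> ball p \<delta>"
    obtain c where c: "path c" "path_image c \<subseteq> \<Omega> \<inter> ball p \<eta>" "pathstart c = w" "pathfinish c = w'"
      using join[OF w w'] by blast
    have pc: "path (g \<circ> c)"
      using c(2) by (intro path_continuous_image[OF c(1)] continuous_on_subset[OF cg]) auto
    have gc: "norm (g u) < 1" "1 - d' / 4 < norm (g u)" "norm (h (g u)) \<le> \<eta> / M" if "u \<in> path_image c" for u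
    proof -
      have u: "u \<in> \<Omega>" "u \<in> ball p \<eta>" using c(2) that by auto
      show "norm (g u) < 1" using g u by auto
      show "1 - d' / 4 < norm (g u)"
      proof (rule ccontr)
        assume "\<not> 1 - d' / 4 < norm (g u)"
        then have "\<phi> (g u) \<in> \<phi> ` cball 0 (1 - d' / 4)" by auto
        then have "u \<in> \<phi> ` cball 0 (1 - d' / 4)" using u g by metis
        moreover have "u \<in> ball p \<eta>1" using u \<eta>(2) by auto
        ultimately show False using \<eta>1(2) by blast
      qed
      show "norm (h (g u)) \<le> \<eta> / M"
        using g u M by (auto simp: h_def norm_divide dist_norm norm_minus_commute intro!: divide_right_mono)
    qed
    have "0 \<notin> path_image (g \<circ> c)"
      using gc(2) d' by (force simp: path_image_compose)
    then obtain q where q: "path q" "\<And>t. t \<in> {0..1} \<Longrightarrow> (g \<circ> c) t = 0 + exp (q t)"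
      using winding_number_as_continuous_log[OF pc] by blast
    have ct: "c t \<in> path_image c" if "t \<in> {0..1}" for t using that by (auto simp: path_image_def)
    have eq: "g (c t) = exp (q t)" if "t \<in> {0..1}" for t using q(2)[OF that] by simp
    have neg: "Re (q t) < 0" if "t \<in> {0..1}" for t
      using gc(1)[OF ct[OF that]] eq[OF that] by simp
    have gt: "1 - d' / 4 < exp (Re (q t))" if "t \<in> {0..1}" for t
      using gc(2)[OF ct[OF that]] eq[OF that] by simp
    have lt: "exp (Re (q t)) < 1" if "t \<in> {0..1}" for t using neg[OF that] by simp
    have "\<not> pi / N \<le> \<bar>Im (q 1) - Im (q 0)\<bar>"
    proof
      assume ang: "pi / N \<le> \<bar>Im (q 1) - Im (q 0)\<bar>"
      have "norm (h 0) ^ (2 * N) \<le> \<eta> / M"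
      proof (rule koebe_lemma[OF _ _ q(1) neg _ N(1) ang])
        show "h holomorphic_on ball 0 1" unfolding h_def using M by (intro holomorphic_intros hol) auto
        show "norm (h z) \<le> 1" if "norm z < 1" for z
          using \<phi>M[OF that] M by (simp add: h_def norm_divide)
        show "norm (h (exp (q t))) \<le> \<eta> / M" if "t \<in> {0..1}" for t
          using gc(3)[OF ct[OF that]] eq[OF that] by simp
      qed
      then show False using \<eta>(3) by simp
    qed
    then have "\<bar>Im (q 0) - Im (q 1)\<bar> < d' / 2" using N by linarith
    moreover have "\<bar>exp (Re (q 0)) - exp (Re (q 1))\<bar> < d' / 4"
    proof -
      have "(0::real) \<in> {0..1}" "(1::real) \<in> {0..1}" by auto
      then show ?thesis using gt[of 0] gt[of 1] lt[of 0] lt[of 1] by linarith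
    qed
    moreover have "norm (exp (q 0) - exp (q 1)) \<le> \<bar>exp (Re (q 0)) - exp (Re (q 1))\<bar> + \<bar>Im (q 0) - Im (q 1)\<bar>"
      by (rule norm_exp_diff_le) (use neg[of 0] neg[of 1] in auto)
    ultimately have "norm (g (c 0) - g (c 1)) < d"
      using eq[of 0] eq[of 1] d' by simp
    then show "norm (g w - g w') < d" using c by (simp add: pathstart_def pathfinish_def)
  qed
qed

text \<open>The oscillation bound is a Cauchy criterion, so completeness provides a limit at each
  new point; regularity of the target turns these pointwise limits into a continuous
  extension.\<close>

lemma continuous_extension_closure_of_small_oscillation:
  fixes f :: "'a::metric_space \<Rightarrow> 'b::complete_space"
  assumes f: "continuous_on S f"
    and osc: "\<And>p d. p \<in> closure S \<Longrightarrow> p \<notin> S \<Longrightarrow> d > 0 \<Longrightarrow>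
      \<exists>\<delta>>0. \<forall>w\<in>S \<inter> ball p \<delta>. \<forall>w'\<in>S \<inter> ball p \<delta>. dist (f w) (f w') < d"
  obtains g where "continuous_on (closure S) g" "\<And>x. x \<in> S \<Longrightarrow> g x = f x"
proof -
  have lim: "\<exists>l. (f \<longlongrightarrow> l) (at t within S)" if t: "t \<in> closure S - S" for t
  proof -
    obtain w where w: "\<And>n. w n \<in> S" "w \<longlonglongrightarrow> t" using t by (auto simp: closure_sequential)
    have "Cauchy (\<lambda>n. f (w n))"
    proof (rule metric_CauchyI)
      fix e :: real assume "e > 0"
      then obtain \<delta> where \<delta>: "\<delta> > 0" "\<forall>u\<in>S \<inter> ball t \<delta>. \<forall>v\<in>S \<inter> ball t \<delta>. dist (f u) (f v) < e"
        using osc[of t e] t by blast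
      obtain M where "\<And>n. n \<ge> M \<Longrightarrow> dist (w n) t < \<delta>"
        using w(2) \<delta>(1) unfolding lim_sequentially by blast
      then show "\<exists>M. \<forall>m\<ge>M. \<forall>n\<ge>M. dist (f (w m)) (f (w n)) < e"
        using \<delta>(2) w(1) by (metis IntI dist_commute mem_ball)
    qed
    then obtain l where l: "(\<lambda>n. f (w n)) \<longlonglongrightarrow> l"
      using Cauchy_convergent convergent_def by blast
    have "(f \<longlongrightarrow> l) (at t within S)"
      unfolding tendsto_iff eventually_at
    proof (intro allI impI)
      fix e :: real assume "e > 0"
      then obtain \<delta> where \<delta>: "\<delta> > 0" "\<forall>u\<in>S \<inter> ball t \<delta>. \<forall>v\<in>S \<inter> ball t \<delta>. dist (f u) (f v) < e / 2"
        using osc[of t "e / 2"] t by auto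
      obtain M where M: "\<And>n. n \<ge> M \<Longrightarrow> dist (w n) t < \<delta>"
        using w(2) \<delta>(1) unfolding lim_sequentially by blast
      obtain M' where M': "\<And>n. n \<ge> M' \<Longrightarrow> dist (f (w n)) l < e / 2"
        using l \<open>e > 0\<close> unfolding lim_sequentially by (meson half_gt_zero)
      define n where "n = max M M'"
      have n: "dist (w n) t < \<delta>" "dist (f (w n)) l < e / 2" using M M' by (auto simp: n_def)
      have "dist (f x) l < e" if "x \<in> S" "dist x t < \<delta>" for x
      proof -
        have "dist (f x) (f (w n)) < e / 2"
          using \<delta>(2) w(1)[of n] that n(1) by (metis IntI dist_commute mem_ball)
        then show ?thesis using n(2) by (metis dist_triangle_lt dist_commute field_sum_of_halves dist_triangle_half_l)
      qed
      then show "\<exists>d>0. \<forall>x\<in>S. x \<noteq> t \<and> dist x t < d \<longrightarrow> dist (f x) l < e" using \<delta>(1) by blast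
    qed
    then show ?thesis by blast
  qed
  obtain g where "continuous_map (subtopology euclidean (closure S)) euclidean g" "\<And>x. x \<in> S \<Longrightarrow> g x = f x"
  proof (rule continuous_map_extension_pointwise_alt[of euclidean S "closure S" euclidean f])
    show "regular_space (euclidean :: 'b topology)"
      by (metis Met_TC.regular_space_mtopology mtopology_is_euclidean)
    show "continuous_map (top_of_set S) euclidean f" using f by simp
    show "\<exists>l. limitin euclidean f l (atin_within euclidean t S)" if "t \<in> closure S - S" for t
    proof -
      have "atin_within euclidean t S = at t within S"
        by (simp add: filter_eq_iff eventually_atin_within eventually_at_topological) blast
      then show ?thesis using lim[OF that] by simp
    qed
  qed (auto simp: closure_subset)
  then show ?thesis using that by simp
qed

text \<open>The points \<open>p\<close> and \<open>p'\<close> cut the loop into two arcs. If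
  \<open>F\<close> omitted a point of each, these two points would separate \<open>p\<close> from
  \<open>p'\<close> in \<open>F\<close>. So \<open>F\<close> contains a whole arc, and around an
  inner point of that arc the loop stays in \<open>F\<close>.\<close>

lemma connected_in_simple_loop_contains_arc:
  fixes \<gamma> :: "real \<Rightarrow> 'a::euclidean_space"
  assumes \<gamma>: "simple_path \<gamma>" "pathfinish \<gamma> = pathstart \<gamma>"
    and F: "F \<subseteq> path_image \<gamma>" "connected F" "p \<in> F" "p' \<in> F" "p \<noteq> p'"
  shows "\<exists>p0\<in>path_image \<gamma>. \<exists>r>0. ball p0 r \<inter> path_image \<gamma> \<subseteq> F"
proof -
  obtain a where a: "a \<in> {0..1}" "p = \<gamma> a" using F by (auto simp: path_image_def)
  define \<beta> where "\<beta> = shiftpath a \<gamma>"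
  have \<beta>: "simple_path \<beta>" "path_image \<beta> = path_image \<gamma>" and \<beta>l: "pathfinish \<beta> = pathstart \<beta>"
    using \<gamma> a by (auto simp: \<beta>_def simple_path_shiftpath path_image_shiftpath closed_shiftpath)
  have \<beta>0: "\<beta> 0 = p" "\<beta> 1 = p"
    using \<beta>l a by (auto simp: \<beta>_def shiftpath_def pathfinish_def pathstart_def)
  have inj: "t = u \<or> t = 0 \<and> u = 1 \<or> t = 1 \<and> u = 0" if "\<beta> t = \<beta> u" "t \<in> {0..1}" "u \<in> {0..1}" for t u
    using \<beta>(1) that unfolding simple_path_def loop_free_def by blast
  have cont: "continuous_on {0..1} \<beta>" using \<beta>(1) by (simp add: simple_path_def path_def)
  have J: "path_image \<gamma> = \<beta> ` {0..1}" using \<beta>(2) by (simp add: path_image_def)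
  obtain s where s: "s \<in> {0..1}" "\<beta> s = p'" using F J by auto
  have s01: "0 < s" "s < 1" using s \<beta>0 F(5) by (cases "s = 0"; cases "s = 1"; force)+
  have clo: "closed (\<beta> ` {u..v})" if "0 \<le> u" "v \<le> 1" for u v
    by (intro compact_imp_closed compact_continuous_image continuous_on_subset[OF cont]) (use that in auto)
  have or: "\<beta> ` {0..s} \<subseteq> F \<or> \<beta> ` {s..1} \<subseteq> F"
  proof (rule ccontr)
    assume "\<not> ?thesis"
    then obtain u v where u: "u \<in> {0..s}" "\<beta> u \<notin> F" and v: "v \<in> {s..1}" "\<beta> v \<notin> F" by blast
    have u': "0 < u" "u < s" using u s \<beta>0 F by (cases "u = 0"; cases "u = s"; force)+
    have v': "s < v" "v < 1" using v s \<beta>0 F by (cases "v = 1"; cases "v = s"; force)+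
    define A where "A = \<beta> ` {u..v}"
    define B where "B = \<beta> ` {0..u} \<union> \<beta> ` {v..1}"
    have "closed A" "closed B" unfolding A_def B_def using u' v' by (auto intro!: clo)
    moreover have "F \<subseteq> A \<union> B"
    proof
      fix x assume "x \<in> F"
      then obtain t where "t \<in> {0..1}" "x = \<beta> t" using F(1) J by auto
      then show "x \<in> A \<union> B" unfolding A_def B_def by (cases "t < u"; cases "t > v") auto
    qed
    moreover have "A \<inter> B \<inter> F = {}"
    proof -
      have False if "x \<in> A" "x \<in> B" "x \<in> F" for x
      proof -
        obtain t where t: "t \<in> {u..v}" "x = \<beta> t" using \<open>x \<in> A\<close> by (auto simp: A_def)
        obtain t' where t': "t' \<in> {0..u} \<union> {v..1}" "x = \<beta> t'" using \<open>x \<in> B\<close> unfolding B_def image_Un[symmetric] by blast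
        have "t = t'" using inj[of t t'] t t' u' v' s01 by auto
        then have "t = u \<or> t = v" using t t' by auto
        then show False using t u v \<open>x \<in> F\<close> by auto
      qed
      then show ?thesis by blast
    qed
    moreover have "p' \<in> A \<inter> F" using s F u' v' by (auto simp: A_def)
    moreover have "p \<in> B \<inter> F" using \<beta>0(1) F u' by (force simp: B_def)
    ultimately show False using F(2) unfolding connected_closed by blast
  qed
  \<comment> \<open>\<open>C\<close> will be the other arc: as it is closed and omits
    \<open>\<beta> t\<close>, a ball about \<open>\<beta> t\<close> avoids it, and the rest of the
    loop lies in \<open>F\<close>.\<close>
  have key: "\<exists>p0\<in>path_image \<gamma>. \<exists>r>0. ball p0 r \<inter> path_image \<gamma> \<subseteq> F"
    if cl: "closed C" and t: "t \<in> {0..1}" "\<beta> t \<notin> C" and sub: "path_image \<gamma> - C \<subseteq> F" for C t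
  proof -
    obtain r where r: "r > 0" "ball (\<beta> t) r \<subseteq> - C"
      using open_Compl[OF cl] t unfolding open_contains_ball by blast
    then show ?thesis using t sub J by (intro bexI[of _ "\<beta> t"] exI[of _ r]) auto
  qed
  from or show ?thesis
  proof
    assume 1: "\<beta> ` {0..s} \<subseteq> F"
    show ?thesis
    proof (rule key[of "\<beta> ` {s..1}" "s / 2"])
      show "\<beta> (s / 2) \<notin> \<beta> ` {s..1}" using inj[of "s / 2"] s01 by force
      show "path_image \<gamma> - \<beta> ` {s..1} \<subseteq> F"
      proof
        fix x assume "x \<in> path_image \<gamma> - \<beta> ` {s..1}"
        then obtain t where t: "t \<in> {0..1}" "x = \<beta> t" "x \<notin> \<beta> ` {s..1}" using J by blast
        then have "t \<in> {0..s}" by auto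
        then show "x \<in> F" using 1 t by blast
      qed
    qed (use s01 clo in auto)
  next
    assume 2: "\<beta> ` {s..1} \<subseteq> F"
    show ?thesis
    proof (rule key[of "\<beta> ` {0..s}" "(s + 1) / 2"])
      show "\<beta> ((s + 1) / 2) \<notin> \<beta> ` {0..s}" using inj[of "(s + 1) / 2"] s01 by force
      show "path_image \<gamma> - \<beta> ` {0..s} \<subseteq> F"
      proof
        fix x assume "x \<in> path_image \<gamma> - \<beta> ` {0..s}"
        then obtain t where t: "t \<in> {0..1}" "x = \<beta> t" "x \<notin> \<beta> ` {0..s}" using J by blast
        then have "t \<in> {s..1}" by auto
        then show "x \<in> F" using 2 t by blast
      qed
    qed (use s01 clo in auto)
  qed
qed

text \<open>Maximum principle for \<open>(G - \<zeta>) / (w - c)\<^sup>N\<close> with large \<open>N\<close>.\<close>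

lemma holomorphic_eq_const_near_exterior_boundary_arc:
  fixes G :: "complex \<Rightarrow> complex"
  assumes \<Omega>: "open \<Omega>" and hol: "G holomorphic_on \<Omega>" and cont: "continuous_on (closure \<Omega>) G"
    and bound: "\<And>w. w \<in> closure \<Omega> \<Longrightarrow> norm (G w - \<zeta>) \<le> M"
    and c: "c \<notin> closure \<Omega>" and F: "\<And>w. w \<in> frontier \<Omega> \<Longrightarrow> w \<in> cball c R \<Longrightarrow> G w = \<zeta>"
    and w0: "w0 \<in> \<Omega>" "w0 \<in> ball c R"
  shows "G w0 = \<zeta>"
proof -
  have R: "R > 0" using w0(2) by (smt (verit) mem_ball zero_le_dist)
  have M: "M \<ge> 0" using bound[of w0] w0(1) closure_subset[of \<Omega>] norm_ge_zero[of "G w0 - \<zeta>"] by (smt (verit) subsetD)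
  define S where "S = \<Omega> \<inter> ball c R"
  have oS: "open S" using \<Omega> by (simp add: S_def open_Int)
  have clS: "closure S \<subseteq> closure \<Omega>" "closure S \<subseteq> cball c R"
  proof -
    show "closure S \<subseteq> closure \<Omega>" by (intro closure_mono) (auto simp: S_def)
    show "closure S \<subseteq> cball c R" by (intro closure_minimal) (auto simp: S_def)
  qed
  have ne: "w - c \<noteq> 0" if "w \<in> closure S" for w using clS(1) c that by auto
  have est: "norm (G w0 - \<zeta>) \<le> M * (norm (w0 - c) / R) ^ n" for n :: nat
  proof -
    \<comment> \<open>There is no pole, because \<open>c\<close> is outside
      \<open>closure \<Omega>\<close>. On the frontier of \<open>S\<close> either the numerator
      vanishes or \<open>w\<close> is at distance \<open>R\<close> from \<open>c\<close>. Since
      \<open>w0\<close> is strictly closer to \<open>c\<close>, comparing the two gives a geometric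
      factor.\<close>
    define k where "k w = (G w - \<zeta>) / (w - c) ^ n" for w
    have "norm (k w0) \<le> M / R ^ n"
    proof (rule maximum_modulus_frontier[of k S])
      have "k holomorphic_on S" unfolding k_def
        using ne closure_subset[of S] c closure_subset[of \<Omega>] by (intro holomorphic_intros holomorphic_on_subset[OF hol]) (auto simp: S_def)
      then show "k holomorphic_on interior S" using oS by (simp add: interior_open)
      show "continuous_on (closure S) k" unfolding k_def
        using ne by (intro continuous_intros continuous_on_subset[OF cont clS(1)]) auto
      show "bounded S" by (simp add: S_def bounded_Int)
      show "w0 \<in> S" using w0 by (simp add: S_def)
      fix w assume w: "w \<in> frontier S"
      then have wS: "w \<in> closure S" "w \<notin> S" using oS by (auto simp: frontier_def interior_open)
      show "norm (k w) \<le> M / R ^ n"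
      proof (cases "w \<in> \<Omega>")
        case True
        then have "dist c w = R" using wS clS(2) by (force simp: S_def)
        then have "norm (w - c) = R" by (simp add: dist_norm norm_minus_commute)
        then show ?thesis
          using bound[of w] wS clS R by (auto simp: k_def norm_divide norm_power intro!: divide_right_mono)
      next
        case False
        then have "w \<in> frontier \<Omega>" using wS clS \<Omega> by (auto simp: frontier_def interior_open)
        then have "G w = \<zeta>" using F wS clS by auto
        then show ?thesis using M R by (simp add: k_def)
      qed
    qed
    moreover have "norm (k w0) = norm (G w0 - \<zeta>) / norm (w0 - c) ^ n" by (simp add: k_def norm_divide norm_power)
    moreover have "norm (w0 - c) > 0" using c w0 closure_subset[of \<Omega>] by auto
    ultimately show ?thesis using R by (simp add: field_simps power_divide)
  qed
  have "norm (w0 - c) / R < 1" using w0 R by (simp add: dist_norm norm_minus_commute)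
  then have "(\<lambda>n. M * (norm (w0 - c) / R) ^ n) \<longlonglongrightarrow> M * 0"
    using R by (intro tendsto_intros LIMSEQ_power_zero) simp
  then have "norm (G w0 - \<zeta>) \<le> M * 0"
    by (rule LIMSEQ_le_const) (use est in auto)
  then show ?thesis by simp
qed

text \<open>The Riemann map extends by its small oscillation at the boundary. A boundary fibre with
  two points would be connected, so it would contain an arc of the boundary on which the extension
  is constant; the maximum principle spreads this value to points of \<open>\<Omega>\<close>, which
  is absurd. The hypothesis \<open>ext\<close> provides the exterior point near the arc on which
  that principle is centred.\<close>

theorem caratheodory_extension:
  fixes \<gamma> :: "real \<Rightarrow> complex"
  assumes \<Omega>: "open \<Omega>" "bounded \<Omega>" "\<Omega> \<noteq> {}" "simply_connected \<Omega>"
    and \<gamma>: "simple_path \<gamma>" "pathfinish \<gamma> = pathstart \<gamma>" and fr: "frontier \<Omega> = path_image \<gamma>"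
    and ext: "frontier \<Omega> \<subseteq> closure (- closure \<Omega>)"
  obtains g f where "homeomorphism (closure \<Omega>) (cball (0::complex) 1) g f" "g ` \<Omega> = ball 0 1" "g ` frontier \<Omega> \<subseteq> sphere 0 1"
proof -
  have con: "connected \<Omega>" using \<Omega>(4) by (rule simply_connected_imp_connected)
  have "\<Omega> \<noteq> UNIV" using \<Omega>(2) not_bounded_UNIV by blast
  then obtain g \<phi> where hg: "g holomorphic_on \<Omega>" and h\<phi>: "\<phi> holomorphic_on ball 0 1"
    and g: "\<And>w. w \<in> \<Omega> \<Longrightarrow> g w \<in> ball 0 1 \<and> \<phi> (g w) = w"
    and \<phi>: "\<And>z. z \<in> ball 0 1 \<Longrightarrow> \<phi> z \<in> \<Omega> \<and> g (\<phi> z) = z"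
    using Riemann_mapping_theorem[of \<Omega>] \<Omega> by blast
  have cg: "continuous_on \<Omega> g" using hg by (rule holomorphic_on_imp_continuous_on)
  have c\<phi>: "continuous_on (ball 0 1) \<phi>" using h\<phi> by (rule holomorphic_on_imp_continuous_on)
  define J where "J = path_image \<gamma>"
  have disj: "\<Omega> \<inter> J = {}" using fr \<Omega>(1) by (auto simp: J_def frontier_def interior_open)
  have Jcl: "J = closure \<Omega> - \<Omega>" using fr \<Omega>(1) by (auto simp: J_def frontier_def interior_open)
  have ccl: "compact (closure \<Omega>)" using \<Omega>(2) by (simp add: compact_closure)
  obtain G where cG: "continuous_on (closure \<Omega>) G" and Gg: "\<And>x. x \<in> \<Omega> \<Longrightarrow> G x = g x"
  proof (rule continuous_extension_closure_of_small_oscillation[OF cg])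
    fix p d assume p: "p \<in> closure \<Omega>" "p \<notin> \<Omega>" and d: "(d::real) > 0"
    have pJ: "p \<in> path_image \<gamma>" using Jcl p by (auto simp: J_def)
    show "\<exists>\<delta>>0. \<forall>w\<in>\<Omega> \<inter> ball p \<delta>. \<forall>w'\<in>\<Omega> \<inter> ball p \<delta>. dist (g w) (g w') < d"
      unfolding dist_norm
    proof (rule riemann_map_oscillation_at_boundary[OF \<Omega>(2) cg h\<phi> g _ p _ d])
      fix \<eta> :: real assume \<eta>: "\<eta> > 0"
      show "\<exists>\<delta>>0. \<forall>w\<in>\<Omega> \<inter> ball p \<delta>. \<forall>w'\<in>\<Omega> \<inter> ball p \<delta>.
           \<exists>c. path c \<and> path_image c \<subseteq> \<Omega> \<inter> ball p \<eta> \<and> pathstart c = w \<and> pathfinish c = w'"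
        by (rule simple_loop_locally_connected_complement[OF \<gamma> pJ con _ _ \<eta>])
          (use disj fr in \<open>auto simp: J_def\<close>)
    qed (use \<phi> in auto)
  qed auto
  have hG: "G holomorphic_on \<Omega>" using hg Gg by (simp cong: holomorphic_cong)
  have Gcl: "G ` closure \<Omega> \<subseteq> cball 0 1"
    by (rule image_closure_subset[OF cG]) (use g Gg in force)+
  \<comment> \<open>If \<open>G p\<close> were in the open disc, passing to the limit in
    \<open>\<phi> (G w) = w\<close> would make \<open>p\<close> a value of \<open>\<phi>\<close>,
    hence a point of \<open>\<Omega>\<close>.\<close>
  have GJ: "norm (G p) = 1" if p: "p \<in> J" for p
  proof (rule ccontr)
    have pc: "p \<in> closure \<Omega>" "p \<notin> \<Omega>" using p Jcl by auto
    assume "norm (G p) \<noteq> 1"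
    then have b: "G p \<in> ball 0 1" using Gcl pc(1) by force
    have lp: "at p within \<Omega> \<noteq> bot"
      using pc by (simp add: trivial_limit_within closure_def)
    have "(G \<longlongrightarrow> G p) (at p within \<Omega>)"
      using cG pc(1) closure_subset[of \<Omega>] unfolding continuous_on_def by (meson tendsto_within_subset)
    moreover have "isCont \<phi> (G p)" using c\<phi> b by (simp add: continuous_on_eq_continuous_at)
    ultimately have "((\<lambda>w. \<phi> (G w)) \<longlongrightarrow> \<phi> (G p)) (at p within \<Omega>)" by (rule isCont_tendsto_compose[rotated])
    then have "((\<lambda>w. w) \<longlongrightarrow> \<phi> (G p)) (at p within \<Omega>)"
      by (rule tendsto_cong[THEN iffD1, rotated]) (use g Gg in \<open>auto simp: eventually_at_filter\<close>)
    moreover have "((\<lambda>w. w) \<longlongrightarrow> p) (at p within \<Omega>)" by (rule tendsto_ident_at)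
    ultimately have "\<phi> (G p) = p" using tendsto_unique[OF lp] by blast
    then show False using \<phi>[OF b] pc by auto
  qed
  have GOm: "G ` \<Omega> = ball 0 1"
  proof
    show "G ` \<Omega> \<subseteq> ball 0 1" using g Gg by auto
    show "ball 0 1 \<subseteq> G ` \<Omega>"
    proof
      fix z :: complex assume "z \<in> ball 0 1"
      then show "z \<in> G ` \<Omega>" using \<phi>[of z] Gg by (metis imageI)
    qed
  qed
  have surj: "G ` closure \<Omega> = cball 0 1"
  proof
    have "closure (ball 0 1) \<subseteq> G ` closure \<Omega>"
    proof (rule closure_minimal)
      show "ball 0 1 \<subseteq> G ` closure \<Omega>" using GOm closure_subset[of \<Omega>] by blast
      show "closed (G ` closure \<Omega>)" using ccl cG by (intro compact_imp_closed compact_continuous_image)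
    qed
    then show "cball 0 1 \<subseteq> G ` closure \<Omega>" by simp
  qed (rule Gcl)
  have injJ: "p = p'" if p: "p \<in> J" "p' \<in> J" "G p = G p'" for p p'
  proof (rule ccontr)
    assume pp: "p \<noteq> p'"
    define \<zeta> where "\<zeta> = G p"
    have n\<zeta>: "norm \<zeta> = 1" using GJ p by (simp add: \<zeta>_def)
    \<comment> \<open>An intersection of two discs is convex, so its image is connected. The
      closures are nested continua whose intersection is the boundary fibre over
      \<open>\<zeta>\<close>; this is why the fibre is connected.\<close>
    define K where "K n = \<phi> ` (ball 0 1 \<inter> ball \<zeta> (inverse (real (Suc n))))" for n
    have K\<Omega>: "K n \<subseteq> \<Omega>" for n using \<phi> by (auto simp: K_def)
    define F where "F = {q \<in> J. G q = \<zeta>}"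
    have Feq: "F = \<Inter> (range (\<lambda>n. closure (K n)))"
    proof
      show "F \<subseteq> \<Inter> (range (\<lambda>n. closure (K n)))"
      proof clarify
        fix q n assume q: "q \<in> F"
        have qc: "q \<in> closure \<Omega>" using q Jcl by (auto simp: F_def)
        show "q \<in> closure (K n)"
          unfolding closure_approachable
        proof (intro allI impI)
          fix e :: real assume e: "e > 0"
          have "inverse (real (Suc n)) > 0" by simp
          then obtain d where d: "d > 0" "\<And>x. x \<in> closure \<Omega> \<Longrightarrow> dist x q < d \<Longrightarrow> dist (G x) (G q) < inverse (real (Suc n))"
            using cG qc unfolding continuous_on_iff by meson
          obtain w where w: "w \<in> \<Omega>" "dist w q < min d e"
            using qc d(1) e unfolding closure_approachable by (metis min_less_iff_conj)
          have "dist (G w) \<zeta> < inverse (real (Suc n))" using d(2)[of w] w q closure_subset[of \<Omega>] by (auto simp: F_def)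
          then have "g w \<in> ball 0 1 \<inter> ball \<zeta> (inverse (real (Suc n)))" using w g Gg by (auto simp: dist_commute)
          then have "w \<in> K n" unfolding K_def using g[OF w(1)] by (metis imageI)
          then show "\<exists>y\<in>K n. dist y q < e" using w by auto
        qed
      qed
      show "\<Inter> (range (\<lambda>n. closure (K n))) \<subseteq> F"
      proof
        fix q assume q: "q \<in> \<Inter> (range (\<lambda>n. closure (K n)))"
        have qc: "q \<in> closure \<Omega>" using q closure_mono[OF K\<Omega>] by blast
        have "dist \<zeta> (G q) \<le> inverse (real (Suc n))" for n
        proof -
          have "G ` closure (K n) \<subseteq> cball \<zeta> (inverse (real (Suc n)))"
          proof (rule image_closure_subset)
            show "continuous_on (closure (K n)) G" using closure_mono[OF K\<Omega>] by (rule continuous_on_subset[OF cG])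
            show "G ` K n \<subseteq> cball \<zeta> (inverse (real (Suc n)))"
            proof
              fix y assume "y \<in> G ` K n"
              then obtain z where z: "z \<in> ball 0 1" "z \<in> ball \<zeta> (inverse (real (Suc n)))" "y = G (\<phi> z)" by (auto simp: K_def)
              then have "y = z" using \<phi> Gg by simp
              then show "y \<in> cball \<zeta> (inverse (real (Suc n)))" using z by auto
            qed
          qed simp
          moreover have "q \<in> closure (K n)" using q by blast
          ultimately have "G q \<in> cball \<zeta> (inverse (real (Suc n)))" by blast
          then show ?thesis by simp
        qed
        then have "dist \<zeta> (G q) \<le> 0"
          by (intro LIMSEQ_le_const[OF LIMSEQ_inverse_real_of_nat]) auto
        then have "G q = \<zeta>" by simp
        moreover have "q \<notin> \<Omega>" using g[of q] Gg[of q] n\<zeta> \<open>G q = \<zeta>\<close> by auto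
        ultimately show "q \<in> F" using qc Jcl by (auto simp: F_def)
      qed
    qed
    have "connected F"
      unfolding Feq
    proof (rule connected_nest)
      show "compact (closure (K n))" for n using K\<Omega> \<Omega>(2) bounded_subset compact_closure by metis
      show "connected (closure (K n))" for n
        unfolding K_def
        by (intro connected_imp_connected_closure connected_continuous_image continuous_on_subset[OF c\<phi>] convex_connected convex_Int) auto
      show "closure (K n) \<subseteq> closure (K m)" if "m \<le> n" for m n
      proof -
        have "inverse (real (Suc n)) \<le> inverse (real (Suc m))" using that by (simp add: field_simps)
        then show ?thesis unfolding K_def by (intro closure_mono image_mono Int_mono subset_ball) auto
      qed
    qed
    moreover have "p \<in> F" "p' \<in> F" using p by (auto simp: F_def \<zeta>_def)
    moreover have "F \<subseteq> path_image \<gamma>" by (auto simp: F_def J_def)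
    ultimately obtain p0 r where p0: "p0 \<in> path_image \<gamma>" "r > 0" "ball p0 r \<inter> path_image \<gamma> \<subseteq> F"
      using connected_in_simple_loop_contains_arc[OF \<gamma> _ _ _ _ pp] by blast
    have "p0 \<in> closure (- closure \<Omega>)" using ext fr p0 by auto
    \<comment> \<open>The radii fit together: \<open>w0\<close> is within r/3 + r/6 = r/2 of
      \<open>c\<close>, and the closed ball of radius r/2 about \<open>c\<close> stays in
      \<open>ball p0 r\<close>, where the boundary belongs to \<open>F\<close>.\<close>
    then obtain c where c: "c \<in> - closure \<Omega>" "dist c p0 < r / 3"
      using p0(2) unfolding closure_approachable by (meson divide_pos_pos zero_less_numeral)
    have "p0 \<in> closure \<Omega>" using p0 Jcl by (auto simp: J_def)
    then obtain w0 where w0: "w0 \<in> \<Omega>" "dist w0 p0 < r / 6"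
      using p0(2) unfolding closure_approachable by (meson divide_pos_pos zero_less_numeral)
    have "G w0 = \<zeta>"
    proof (rule holomorphic_eq_const_near_exterior_boundary_arc[OF \<Omega>(1) hG cG])
      show "norm (G w - \<zeta>) \<le> 2" if "w \<in> closure \<Omega>" for w
      proof -
        have "norm (G w) \<le> 1" using Gcl that by force
        then show ?thesis using norm_triangle_ineq4[of "G w" \<zeta>] n\<zeta> by linarith
      qed
      show "c \<notin> closure \<Omega>" using c by simp
      show "w0 \<in> ball c (r / 2)" using c(2) w0(2) dist_triangle[of c w0 p0] by (simp add: dist_commute)
      fix w assume w: "w \<in> frontier \<Omega>" "w \<in> cball c (r / 2)"
      have "dist p0 w \<le> dist c p0 + dist c w" by (metis dist_commute dist_triangle)
      then have "w \<in> ball p0 r" using w c p0(2) by simp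
      then show "G w = \<zeta>" using w p0(3) fr by (auto simp: F_def)
    qed (rule w0(1))
    then show False using g[OF w0(1)] Gg[OF w0(1)] n\<zeta> by simp
  qed
  have inj: "inj_on G (closure \<Omega>)"
  proof (rule inj_onI)
    fix x y assume xy: "x \<in> closure \<Omega>" "y \<in> closure \<Omega>" "G x = G y"
    have *: "u \<in> \<Omega>" if "u \<in> closure \<Omega>" "norm (G u) < 1" for u using GJ[of u] Jcl that by fastforce
    show "x = y"
    proof (cases "norm (G x) < 1")
      case True
      then have "x \<in> \<Omega>" "y \<in> \<Omega>" using * xy by auto
      then show ?thesis using xy(3) g Gg by metis
    next
      case False
      have "x \<in> J" "y \<in> J" using False xy g Gg Jcl by force+
      then show ?thesis using injJ xy by blast
    qed
  qed
  obtain f where "homeomorphism (closure \<Omega>) (cball 0 1) G f"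
    using homeomorphism_compact[OF ccl cG surj inj] by blast
  moreover have "G ` frontier \<Omega> \<subseteq> sphere 0 1" using GJ fr by (auto simp: J_def)
  ultimately show ?thesis using that GOm by blast
qed

text \<open>Inversion at the interior point \<open>c\<close> of the disc sends its exterior, with
  infinity added, to the bounded open set \<open>\<Omega>\<close>; infinity becomes 0. The
  complement of \<open>\<Omega>\<close> is the image of the punctured disc, which is connected, so
  \<open>\<Omega>\<close> is simply connected and Caratheodory's theorem applies.\<close>

lemma inverted_exterior_of_disc:
  fixes Q :: "real \<times> real \<Rightarrow> complex"
  assumes S: "convex S" "compact S" "x0 \<in> interior S"
    and cQ: "continuous_on S Q" and iQ: "inj_on Q S"
  defines "c \<equiv> Q x0"
  defines "\<Omega> \<equiv> {w. c + inverse w \<notin> Q ` S} \<union> {0}"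
  defines "Bd \<equiv> (\<lambda>x. inverse (Q x - c)) ` frontier S"
  obtains g f where "homeomorphism (\<Omega> \<union> Bd) (cball (0::complex) 1) g f"
    "g ` \<Omega> = ball 0 1" "g ` Bd \<subseteq> sphere 0 1" "\<Omega> \<inter> Bd = {}"
proof -
  define K where "K = Q ` S"
  have x0: "x0 \<in> S" using S(3) interior_subset by blast
  have cK: "compact K" unfolding K_def by (rule compact_continuous_image[OF cQ S(2)])
  have frS: "frontier S = S - interior S" using S(2) by (simp add: frontier_def compact_imp_closed)
  obtain R where R: "homeomorphism S K Q R"
    using homeomorphism_compact[OF S(2) cQ K_def[symmetric] iQ] by blast
  have QR: "\<And>y. y \<in> K \<Longrightarrow> Q (R y) = y" "\<And>x. x \<in> S \<Longrightarrow> R (Q x) = x" and cR: "continuous_on K R" and RK: "R ` K = S"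
    using R by (auto simp: homeomorphism_def)
  have injR: "inj_on R K" using QR by (metis inj_on_def)
  have Q_int: "Q ` interior S \<subseteq> interior K"
    unfolding K_def by (rule continuous_image_subset_interior[OF cQ iQ]) simp
  have R_int: "R ` interior K \<subseteq> interior S"
    unfolding RK[symmetric] by (rule continuous_image_subset_interior[OF cR injR]) simp
  have Qfr: "Q x \<notin> interior K" if "x \<in> frontier S" for x
  proof
    assume "Q x \<in> interior K"
    then have "R (Q x) \<in> interior S" using R_int by blast
    then show False using that QR(2) frS by auto
  qed
  have cint: "c \<in> interior K" using Q_int S(3) by (auto simp: c_def)
  have cinK: "c \<in> K" using x0 by (simp add: c_def K_def)
  obtain r where r: "r > 0" "ball c r \<subseteq> K" using cint mem_interior by blast
  obtain B where B: "B > 0" "\<And>y. y \<in> K \<Longrightarrow> dist c y < B"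
  proof -
    obtain e where "e > 0" "K \<subseteq> ball c e" using bounded_subset_ballD[OF compact_imp_bounded[OF cK], of c] by blast
    then show ?thesis using that[of e] by (metis mem_ball subsetD)
  qed
  have \<Omega>K: "w \<in> \<Omega> \<longleftrightarrow> w = 0 \<or> c + inverse w \<notin> K" for w by (auto simp: \<Omega>_def K_def)
  have small: "ball 0 (1 / B) \<subseteq> \<Omega>"
  proof
    fix w :: complex assume w: "w \<in> ball 0 (1 / B)"
    show "w \<in> \<Omega>"
    proof (cases "w = 0")
      case False
      then have "B < norm (inverse w)" using w B(1) by (simp add: norm_inverse norm_divide field_simps)
      then show ?thesis using B(2)[of "c + inverse w"] by (auto simp: \<Omega>K dist_norm)
    qed (simp add: \<Omega>K)
  qed
  define \<iota> where "\<iota> z = inverse (z - c)" for z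
  have \<iota>im: "\<iota> ` (- K) = \<Omega> - {0}"
  proof
    show "\<iota> ` (- K) \<subseteq> \<Omega> - {0}" using cinK by (auto simp: \<Omega>K \<iota>_def)
    show "\<Omega> - {0} \<subseteq> \<iota> ` (- K)"
    proof
      fix w assume "w \<in> \<Omega> - {0}"
      then show "w \<in> \<iota> ` (- K)" by (intro image_eqI[of _ _ "c + inverse w"]) (auto simp: \<Omega>K \<iota>_def)
    qed
  qed
  have compl: "- \<Omega> = \<iota> ` (K - {c})"
  proof
    show "- \<Omega> \<subseteq> \<iota> ` (K - {c})"
    proof
      fix w assume "w \<in> - \<Omega>"
      then show "w \<in> \<iota> ` (K - {c})" by (intro image_eqI[of _ _ "c + inverse w"]) (auto simp: \<Omega>K \<iota>_def)
    qed
    show "\<iota> ` (K - {c}) \<subseteq> - \<Omega>" by (auto simp: \<Omega>K \<iota>_def)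
  qed
  have c\<iota>: "continuous_on A \<iota>" if "c \<notin> A" for A
    unfolding \<iota>_def using that by (intro continuous_intros) auto
  have b\<Omega>: "bounded \<Omega>"
  proof -
    have "norm w \<le> 1 / r" if "w \<in> \<Omega>" for w
    proof (cases "w = 0")
      case False
      then have "c + inverse w \<notin> ball c r" using r that by (auto simp: \<Omega>K)
      then show ?thesis using False r by (simp add: dist_norm norm_inverse norm_divide field_simps)
    qed (use r in simp)
    then show ?thesis unfolding bounded_iff by blast
  qed
  have o\<Omega>: "open \<Omega>"
  proof -
    have "open ((\<lambda>w. c + inverse w) -` (- K) \<inter> (- {0}))"
    proof (rule continuous_on_open_vimage[THEN iffD1, rule_format])
      show "continuous_on (- {0}) (\<lambda>w::complex. c + inverse w)" by (intro continuous_intros) auto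
      show "open (- K)" using cK compact_imp_closed by blast
    qed auto
    moreover have "\<Omega> = ball 0 (1 / B) \<union> ((\<lambda>w. c + inverse w) -` (- K) \<inter> (- {0}))"
      using small \<Omega>K B(1) by (auto simp: dist_norm)
    ultimately show ?thesis by (metis open_Un open_ball)
  qed
  have conK: "connected (- K)"
  proof (rule connected_complement_homeomorphic_convex_compact)
    show "K homeomorphic S" using R homeomorphic_def homeomorphic_sym by blast
  qed (use S in auto)
  have con\<Omega>: "connected \<Omega>"
  proof -
    have e: "\<Omega> = ball 0 (1 / B) \<union> \<iota> ` (- K)" using small \<iota>im B(1) by auto
    have "c + of_real (2 * B) \<notin> K" using B by (force simp: dist_norm)
    then have "inverse (of_real (2 * B)) \<in> \<iota> ` (- K)" by (intro image_eqI[of _ _ "c + of_real (2 * B)"]) (auto simp: \<iota>_def)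
    moreover have "(inverse (of_real (2 * B)) :: complex) \<in> ball 0 (1 / B)" 
    proof -
      have "norm (inverse (of_real (2 * B)) :: complex) = inverse (2 * B)"
        using B(1) by (simp only: norm_inverse norm_of_real)
      then show ?thesis using B(1) by (simp add: field_simps)
    qed
    ultimately have "ball 0 (1 / B) \<inter> \<iota> ` (- K) \<noteq> {}" by blast
    moreover have "connected (\<iota> ` (- K))"
      using cinK by (intro connected_continuous_image c\<iota> conK) auto
    ultimately show ?thesis unfolding e by (intro connected_Un) auto
  qed
  have aff: "aff_dim S = 2" using aff_dim_nonempty_interior[of S] S(3) by force
  have "connected (- \<Omega>)"
  proof -
    have "K - {c} = Q ` (S - {x0})" using iQ x0 by (auto simp: K_def c_def inj_on_def)
    moreover have "connected (S - {x0})" using S aff by (intro connected_punctured_convex) auto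
    ultimately have "connected (K - {c})"
      by (metis connected_continuous_image continuous_on_subset cQ Diff_subset)
    then show ?thesis unfolding compl by (intro connected_continuous_image c\<iota>) auto
  qed
  then have sc: "simply_connected \<Omega>" using simply_connected_iff_simple[OF o\<Omega> b\<Omega>] con\<Omega> by blast
  have Bd: "Bd = \<iota> ` (Q ` frontier S)" by (simp add: Bd_def \<iota>_def image_image)
  have cfr: "c \<notin> Q ` frontier S"
    using iQ x0 frS S(3) by (auto simp: c_def inj_on_def)
  define I where "I = \<iota> ` (Q ` (interior S - {x0}))"
  have cI: "c \<notin> Q ` (interior S - {x0})"
    using iQ x0 interior_subset[of S] by (auto simp: c_def inj_on_def)
  have "-\<Omega> = Bd \<union> I"
  proof -
    have "K - {c} = Q ` (S - {x0})" using iQ x0 by (auto simp: K_def c_def inj_on_def)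
    also have "S - {x0} = frontier S \<union> (interior S - {x0})" using frS S(3) interior_subset[of S] by auto
    finally show ?thesis by (simp add: compl Bd I_def image_Un)
  qed
  then have split: "- \<Omega> = Bd \<union> I" .
  have "open I"
  proof -
    have "open (Q ` (interior S - {x0}))"
      using interior_subset[of S] by (intro invariance_of_domain_gen continuous_on_subset[OF cQ] inj_on_subset[OF iQ] open_delete) auto
    then show ?thesis unfolding I_def
      by (rule invariance_of_domain_gen[OF _ c\<iota>[OF cI]]) (auto simp: inj_on_def \<iota>_def)
  qed
  then have cl\<Omega>I: "closure \<Omega> \<inter> I = {}" using split open_Int_closure_eq_empty by blast
  have Bdcl: "Bd \<subseteq> closure \<Omega>"
  proof -
    have "Q ` frontier S \<subseteq> closure (- K)" using Qfr by (auto simp: closure_complement)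
    moreover have "\<iota> ` (closure (- K) ) \<subseteq> closure \<Omega>"
    proof (rule image_closure_subset)
      show "continuous_on (closure (- K)) \<iota>" using cint by (intro c\<iota>) (auto simp: closure_complement)
      show "\<iota> ` (- K) \<subseteq> closure \<Omega>" using \<iota>im closure_subset by blast
    qed simp
    ultimately show ?thesis unfolding Bd by blast
  qed
  have cl: "closure \<Omega> = \<Omega> \<union> Bd" using cl\<Omega>I Bdcl split closure_subset[of \<Omega>] by blast
  have dis: "\<Omega> \<inter> Bd = {}" using split by blast
  have fr: "frontier \<Omega> = Bd" using cl dis o\<Omega> by (auto simp: frontier_def interior_open)
  \<comment> \<open>This is the hypothesis \<open>ext\<close> of
    \<open>caratheodory_extension\<close>: every frontier point of \<open>S\<close> is a limit of
    interior points other than \<open>x0\<close>, and their images form the open set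
    \<open>I\<close>, which is disjoint from \<open>closure \<Omega>\<close>.\<close>
  have BdI: "Bd \<subseteq> closure (- closure \<Omega>)"
  proof -
    have "frontier S \<subseteq> closure (interior S)" using S(1,3) convex_closure_interior[of S] frS closure_subset by force
    also have "interior S = (interior S - {x0}) \<union> {x0}" using S(3) by auto
    also have "closure \<dots> = closure (interior S - {x0}) \<union> {x0}" by (subst closure_Un) simp
    finally have *: "frontier S \<subseteq> closure (interior S - {x0})" using frS S(3) by auto
    have "(\<iota> \<circ> Q) ` (frontier S \<union> (interior S - {x0})) \<subseteq> closure I"
    proof (clarsimp)
      fix x assume x: "x \<in> frontier S \<or> x \<in> interior S \<and> x \<noteq> x0"
      have xS: "x \<in> S - {x0}" using x frS S(3) interior_subset[of S] by auto
      have cx: "x \<in> closure (interior S - {x0})" using x * closure_subset[of "interior S - {x0}"] by auto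
      have "\<exists>s. (\<forall>n. s n \<in> interior S - {x0}) \<and> s \<longlonglongrightarrow> x"
        using cx by (simp only: closure_sequential)
      then obtain s where s: "\<And>n. s n \<in> interior S - {x0}" "s \<longlonglongrightarrow> x" by metis
      have con: "continuous_on (S - {x0}) (\<lambda>x. \<iota> (Q x))"
      proof (rule continuous_on_compose2[OF c\<iota>])
        show "continuous_on (S - {x0}) Q" by (rule continuous_on_subset[OF cQ]) auto
        show "c \<notin> - {c}" by simp
        show "Q ` (S - {x0}) \<subseteq> - {c}" using iQ x0 by (auto simp: c_def inj_on_def)
      qed
      have "(\<lambda>n. \<iota> (Q (s n))) \<longlonglongrightarrow> \<iota> (Q x)"
        by (rule continuous_on_tendsto_compose[OF con s(2) xS]) (use s(1) interior_subset[of S] in \<open>auto intro!: always_eventually\<close>)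
      then show "\<iota> (Q x) \<in> closure I"
        unfolding closure_sequential using s(1) by (intro exI[of _ "\<lambda>n. \<iota> (Q (s n))"]) (auto simp: I_def)
    qed
    moreover have "closure I \<subseteq> closure (- closure \<Omega>)" using cl\<Omega>I by (intro closure_mono) blast
    ultimately show ?thesis unfolding Bd by (auto simp: image_subset_iff)
  qed
  obtain \<gamma> where \<gamma>: "simple_path \<gamma>" "pathfinish \<gamma> = pathstart \<gamma>" "path_image \<gamma> = Bd"
  proof -
    have "rel_frontier S homeomorphic rel_frontier (cball (0::complex) 1)"
      using S compact_imp_bounded aff by (intro homeomorphic_rel_frontiers_convex_bounded_sets) (auto simp: aff_dim_cball)
    moreover have "rel_frontier S = frontier S" using S(3) by (intro rel_frontier_nonempty_interior) auto
    moreover have "rel_frontier (cball (0::complex) 1) = sphere 0 1" by (simp add: rel_frontier_cball)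
    ultimately have "sphere (0::complex) 1 homeomorphic frontier S" by (metis homeomorphic_sym)
    then obtain h h' where h: "homeomorphism (sphere (0::complex) 1) (frontier S) h h'" by (auto simp: homeomorphic_def)
    define k where "k = \<iota> \<circ> Q \<circ> h"
    have hS: "h ` sphere 0 1 = frontier S" using h by (simp add: homeomorphism_def)
    have frSS: "frontier S \<subseteq> S" using frS by blast
    have ck: "continuous_on (sphere 0 1) k"
      unfolding k_def
      by (intro continuous_on_compose) (use h hS cfr frSS c\<iota> continuous_on_subset[OF cQ] in \<open>auto simp: homeomorphism_def image_image\<close>)
    have ik: "inj_on k (sphere 0 1)"
    proof -
      have "inj_on h (sphere 0 1)" using h by (metis homeomorphism_def inj_on_inverseI)
      moreover have "inj_on Q (h ` sphere 0 1)" using hS frSS inj_on_subset[OF iQ] by metis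
      moreover have "inj \<iota>" by (auto simp: inj_on_def \<iota>_def)
      ultimately show ?thesis unfolding k_def by (metis comp_inj_on image_comp inj_on_subset subset_UNIV)
    qed
    have "simple_path (k \<circ> circlepath 0 1)"
      using ck ik by (intro simple_path_continuous_image) (auto simp: simple_path_circlepath)
    moreover have "path_image (k \<circ> circlepath 0 1) = Bd"
      by (simp add: path_image_compose k_def Bd image_image flip: hS)
    ultimately show ?thesis by (intro that[of "k \<circ> circlepath 0 1"]) (auto simp: pathfinish_compose pathstart_compose)
  qed
  obtain g f where "homeomorphism (closure \<Omega>) (cball (0::complex) 1) g f" "g ` \<Omega> = ball 0 1" "g ` frontier \<Omega> \<subseteq> sphere 0 1"
    using caratheodory_extension[OF o\<Omega> b\<Omega> _ sc \<gamma>(1,2)] fr \<gamma>(3) BdI small B(1)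
    by (metis \<Omega>K empty_iff)
  then show ?thesis using that[of g f] dis cl fr by simp
qed

section \<open>Approximation of quads from below\<close>

text \<open>Maximum norm about the centre of the square, scaled so that for t > 0 the sublevel set
  at t is the concentric square of side t; level 1 is the boundary of the unit square.\<close>

definition square_gauge :: "real \<times> real \<Rightarrow> real" where
  "square_gauge x = 2 * max \<bar>fst x - 1/2\<bar> \<bar>snd x - 1/2\<bar>"

lemma continuous_on_square_gauge [continuous_intros]:
  "continuous_on A f \<Longrightarrow> continuous_on A (\<lambda>x. square_gauge (f x))"
  unfolding square_gauge_def by (intro continuous_intros)

lemma square_gauge_le_iff:
  "square_gauge x \<le> t \<longleftrightarrow> 1 - t \<le> 2 * fst x \<and> 2 * fst x \<le> 1 + t \<and> 1 - t \<le> 2 * snd x \<and> 2 * snd x \<le> 1 + t"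
  unfolding square_gauge_def
  by (cases "fst x \<le> 1/2"; cases "snd x \<le> 1/2"; auto simp: max_def abs_if)

lemma square_gauge_less_iff:
  "square_gauge x < t \<longleftrightarrow> 1 - t < 2 * fst x \<and> 2 * fst x < 1 + t \<and> 1 - t < 2 * snd x \<and> 2 * snd x < 1 + t"
  unfolding square_gauge_def
  by (cases "fst x \<le> 1/2"; cases "snd x \<le> 1/2"; auto simp: max_def abs_if)

lemma unit_square_gauge: "unit_square = {x. square_gauge x \<le> 1}"
  by (auto simp: unit_square_def square_gauge_le_iff)

lemma mem_unit_square: "x \<in> unit_square \<longleftrightarrow> square_gauge x \<le> 1"
  by (simp add: unit_square_gauge)

lemma unit_square_cbox: "unit_square = cbox (0, 0) (1, 1)"
  by (auto simp: unit_square_def cbox_Pair_eq)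

lemma interior_unit_square: "interior unit_square = {x. square_gauge x < 1}"
  by (auto simp: unit_square_cbox box_def Basis_prod_def square_gauge_less_iff)

lemma frontier_unit_square: "frontier unit_square = {x. square_gauge x = 1}"
proof -
  have "closure unit_square = unit_square" using compact_unit_square by (simp add: compact_imp_closed)
  then have eq: "frontier unit_square = unit_square - interior unit_square" by (simp only: frontier_def)
  show ?thesis unfolding eq interior_unit_square by (auto simp: mem_unit_square)
qed

lemma square_gauge_affine:
  assumes "t > 0"
  shows "square_gauge ((1/2, 1/2) + t *\<^sub>R (x - (1/2, 1/2))) = t * square_gauge x"
proof -
  have "square_gauge ((1/2, 1/2) + t *\<^sub>R (x - (1/2, 1/2))) = 2 * max (t * \<bar>fst x - 1/2\<bar>) (t * \<bar>snd x - 1/2\<bar>)"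
    using assms by (simp add: square_gauge_def abs_mult)
  also have "max (t * \<bar>fst x - 1/2\<bar>) (t * \<bar>snd x - 1/2\<bar>) = t * max \<bar>fst x - 1/2\<bar> \<bar>snd x - 1/2\<bar>"
    using assms by (simp add: max_mult_distrib_left)
  finally show ?thesis by (simp only: square_gauge_def mult.left_commute)
qed

text \<open>Outside the square, \<open>F\<close> runs along the radii of the disc that uniformizes the inverted exterior.\<close>

theorem unit_square_embedding_extends:
  fixes Q :: "real \<times> real \<Rightarrow> complex"
  assumes cQ: "continuous_on unit_square Q" and iQ: "inj_on Q unit_square"
  obtains \<kappa> F where "\<kappa> > 0" "continuous_on {x. square_gauge x \<le> 1 + \<kappa>} F" "inj_on F {x. square_gauge x \<le> 1 + \<kappa>}"
    "\<And>x. x \<in> unit_square \<Longrightarrow> F x = Q x"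
proof -
  define x0 :: "real \<times> real" where "x0 = (1/2, 1/2)"
  define c where "c = Q x0"
  define \<Omega> where "\<Omega> = {w. c + inverse w \<notin> Q ` unit_square} \<union> {0}"
  define Bd where "Bd = (\<lambda>x. inverse (Q x - c)) ` frontier unit_square"
  have x0: "x0 \<in> interior unit_square" by (simp add: interior_unit_square x0_def square_gauge_def)
  have conv: "convex unit_square" by (simp add: unit_square_cbox)
  obtain g f where gf: "homeomorphism (\<Omega> \<union> Bd) (cball (0::complex) 1) g f"
    and g\<Omega>: "g ` \<Omega> = ball 0 1" and gBd: "g ` Bd \<subseteq> sphere 0 1" and dis: "\<Omega> \<inter> Bd = {}"
    using inverted_exterior_of_disc[OF conv compact_unit_square x0 cQ iQ]
    unfolding \<Omega>_def Bd_def c_def by blast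
  have fg: "\<And>x. x \<in> \<Omega> \<union> Bd \<Longrightarrow> f (g x) = x" and gf': "\<And>y. y \<in> cball 0 1 \<Longrightarrow> g (f y) = y"
    and f_im: "f ` cball 0 1 = \<Omega> \<union> Bd" and cf: "continuous_on (cball 0 1) f" and cg: "continuous_on (\<Omega> \<union> Bd) g"
    using gf by (auto simp: homeomorphism_def)
  have f_ball: "f z \<in> \<Omega>" if "norm z < 1" for z
    using that g\<Omega> fg by (metis UnI1 imageE mem_ball_0)
  define z0 where "z0 = g 0"
  have O0: "0 \<in> \<Omega>" by (simp add: \<Omega>_def)
  have z0: "norm z0 < 1" using g\<Omega> O0 by (auto simp: z0_def)
  \<comment> \<open>\<open>z0\<close> represents the point at infinity of the exterior. On the
    collar \<open>u x\<close> has norm at least \<open>1 - \<kappa>\<close>, which exceeds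
    \<open>norm z0\<close>, so \<open>f (u x)\<close> is never 0 and can be inverted back.\<close>
  define \<kappa> where "\<kappa> = (1 - norm z0) / 2"
  have \<kappa>: "\<kappa> > 0" "\<kappa> \<le> 1/2" "norm z0 < 1 - \<kappa>"
  proof -
    show "\<kappa> > 0" "\<kappa> \<le> 1/2" using z0 by (simp_all add: \<kappa>_def)
    have "2 * \<kappa> = 1 - norm z0" by (simp add: \<kappa>_def)
    then show "norm z0 < 1 - \<kappa>" using \<open>\<kappa> > 0\<close> by linarith
  qed
  \<comment> \<open>A point of the collar is projected radially onto the boundary of the square,
    carried to the unit circle by inversion and \<open>g\<close>, and then moved inward as its gauge
    grows. At gauge 1 nothing moves, so \<open>E\<close> agrees there with \<open>Q\<close>.\<close>
  define \<rho> where "\<rho> x = x0 + (1 / square_gauge x) *\<^sub>R (x - x0)" for x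
  have \<rho>1: "square_gauge (\<rho> x) = 1" if "square_gauge x > 0" for x
    using square_gauge_affine[of "1 / square_gauge x" x] that by (simp add: \<rho>_def x0_def)
  define b where "b x = inverse (Q (\<rho> x) - c)" for x
  define u where "u x = of_real (2 - square_gauge x) * g (b x)" for x
  define E where "E x = c + inverse (f (u x))" for x
  define F where "F x = (if square_gauge x \<le> 1 then Q x else E x)" for x
  define A where "A = {x. 1 \<le> square_gauge x \<and> square_gauge x \<le> 1 + \<kappa>}"
  have \<rho>A: "\<rho> x \<in> frontier unit_square" "\<rho> x \<in> unit_square" if "x \<in> A" for x
    using \<rho>1[of x] that by (auto simp: A_def frontier_unit_square mem_unit_square)
  have bA: "b x \<in> Bd" if "x \<in> A" for x using \<rho>A[OF that] by (auto simp: b_def Bd_def)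
  have gb: "norm (g (b x)) = 1" if "x \<in> A" for x using gBd bA[OF that] by auto
  have nu: "norm (u x) = 2 - square_gauge x" if "x \<in> A" for x
    unfolding u_def norm_mult gb[OF that] norm_of_real using that \<kappa> by (auto simp: A_def)
  have uA: "u x \<in> cball 0 1" if "x \<in> A" for x using nu[OF that] that by (auto simp: A_def)
  have fu0: "f (u x) \<noteq> 0" if "x \<in> A" for x
  proof
    assume "f (u x) = 0"
    then have "u x = z0" using gf'[OF uA[OF that]] by (simp add: z0_def)
    then show False using nu[OF that] \<kappa> that by (auto simp: A_def)
  qed
  have neqc: "Q y \<noteq> c" if "y \<in> frontier unit_square" for y
  proof
    assume "Q y = c"
    moreover have "y \<in> unit_square" "x0 \<in> unit_square" using that x0 interior_subset[of unit_square]
      by (auto simp: frontier_unit_square mem_unit_square)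
    ultimately have "y = x0" using iQ by (auto simp: c_def inj_on_def)
    then show False using that by (simp add: frontier_unit_square x0_def square_gauge_def)
  qed
  have E_eq: "E x = Q x" if "square_gauge x = 1" for x
  proof -
    have xA: "x \<in> A" using that \<kappa> by (simp add: A_def)
    have "u x = g (b x)" using that by (simp add: u_def)
    then have "f (u x) = b x" using fg bA[OF xA] by simp
    moreover have "\<rho> x = x" using that by (simp add: \<rho>_def)
    ultimately show ?thesis by (simp add: E_def b_def)
  qed
  have E_out: "E x \<notin> Q ` unit_square" if "x \<in> A" "square_gauge x > 1" for x
  proof -
    have "f (u x) \<in> \<Omega>" using nu[OF that(1)] that by (intro f_ball) auto
    then show ?thesis using fu0[OF that(1)] by (auto simp: \<Omega>_def E_def)
  qed
  \<comment> \<open>The norm of \<open>u x\<close> recovers the gauge of \<open>x\<close> and its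
    direction recovers the radial projection; together they determine \<open>x\<close>.\<close>
  have E_inj: "x = y" if x: "x \<in> A" and y: "y \<in> A" and e: "E x = E y" for x y
  proof -
    have "f (u x) = f (u y)" using e by (simp add: E_def)
    then have uu: "u x = u y" using gf' uA x y by metis
    then have N: "square_gauge x = square_gauge y" using nu x y by (metis add_diff_cancel_left' add_diff_eq diff_add_cancel)
    moreover have "2 - square_gauge y \<noteq> 0" using y \<kappa> by (auto simp: A_def)
    then have "complex_of_real (2 - square_gauge y) \<noteq> 0" by (simp only: of_real_eq_0_iff not_False_eq_True)
    ultimately have "g (b x) = g (b y)" using uu unfolding u_def by (metis mult_left_cancel)
    then have "b x = b y" using fg bA x y by (metis UnCI)
    then have "Q (\<rho> x) = Q (\<rho> y)" by (simp add: b_def)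
    then have "\<rho> x = \<rho> y" using iQ \<rho>A x y by (auto simp: inj_on_def)
    then have "(1 / square_gauge y) *\<^sub>R (x - x0) = (1 / square_gauge y) *\<^sub>R (y - x0)" by (simp add: \<rho>_def N)
    moreover have "1 / square_gauge y \<noteq> 0" using y by (auto simp: A_def)
    ultimately show ?thesis by (metis add_diff_cancel_right' diff_add_cancel scaleR_cancel_left)
  qed
  have cE: "continuous_on A E"
  proof -
    have c\<rho>: "continuous_on A \<rho>" unfolding \<rho>_def by (intro continuous_intros) (auto simp: A_def)
    have cb: "continuous_on A b" unfolding b_def
    proof (intro continuous_intros)
      show "continuous_on A (\<lambda>x. Q (\<rho> x))" using \<rho>A by (intro continuous_on_compose2[OF cQ c\<rho>]) auto
    qed (use neqc \<rho>A in auto)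
    have cu: "continuous_on A u" unfolding u_def
      using bA by (intro continuous_intros continuous_on_compose2[OF cg cb]) auto
    show ?thesis unfolding E_def
    proof (intro continuous_intros)
      show "continuous_on A (\<lambda>x. f (u x))" using uA by (intro continuous_on_compose2[OF cf cu]) auto
    qed (use fu0 in auto)
  qed
  have "continuous_on {x. square_gauge x \<le> 1 + \<kappa>} F"
    unfolding F_def
  proof (rule continuous_on_cases_le)
    show "continuous_on {t \<in> {x. square_gauge x \<le> 1 + \<kappa>}. square_gauge t \<le> 1} Q"
      by (rule continuous_on_subset[OF cQ]) (auto simp: unit_square_gauge)
    show "continuous_on {t \<in> {x. square_gauge x \<le> 1 + \<kappa>}. 1 \<le> square_gauge t} E"
      by (rule continuous_on_subset[OF cE]) (auto simp: A_def)
    show "continuous_on {x. square_gauge x \<le> 1 + \<kappa>} square_gauge" by (intro continuous_intros)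
    show "Q t = E t" if "t \<in> {x. square_gauge x \<le> 1 + \<kappa>}" "square_gauge t = 1" for t using E_eq[OF that(2)] by simp
  qed
  moreover have "inj_on F {x. square_gauge x \<le> 1 + \<kappa>}"
  proof (rule inj_onI)
    fix x y assume x: "x \<in> {x. square_gauge x \<le> 1 + \<kappa>}" and y: "y \<in> {x. square_gauge x \<le> 1 + \<kappa>}" and e: "F x = F y"
    have out: "E z \<noteq> Q w" if "square_gauge z > 1" "square_gauge z \<le> 1 + \<kappa>" "square_gauge w \<le> 1" for z w
      using E_out[of z] that by (auto simp: A_def unit_square_gauge)
    consider "square_gauge x \<le> 1" "square_gauge y \<le> 1" | "square_gauge x > 1" "square_gauge y > 1"
      | "square_gauge x \<le> 1" "square_gauge y > 1" | "square_gauge x > 1" "square_gauge y \<le> 1" by linarith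
    then show "x = y"
    proof cases
      case 1 then show ?thesis using e by (intro inj_onD[OF iQ]) (auto simp: F_def mem_unit_square)
    next
      case 2 then show ?thesis using e x y E_inj by (auto simp: F_def A_def)
    next
      case 3 then show ?thesis using e out[of y x] y by (auto simp: F_def)
    next
      case 4 then show ?thesis using e out[of x y] x by (auto simp: F_def)
    qed
  qed
  ultimately show ?thesis using that[of \<kappa> F] \<kappa> by (auto simp: F_def unit_square_gauge)
qed

text \<open>Components and quasicomponents agree in a compact Hausdorff space. It is used for a
  continuum that contains no crossing of a narrow quad, and for the open tiles in a quad that they
  do not cross.\<close>

lemma compact_separation_if_unlinked:
  fixes S :: "'a::euclidean_space set"
  assumes S: "compact S" and A: "closed A" and B: "closed B"
    and no: "\<And>C. connected C \<Longrightarrow> C \<subseteq> S \<Longrightarrow> C \<inter> A \<noteq> {} \<Longrightarrow> C \<inter> B \<noteq> {} \<Longrightarrow> False"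
  obtains S1 S2 where "compact S1" "compact S2" "S1 \<union> S2 = S" "S1 \<inter> S2 = {}" "S \<inter> A \<subseteq> S1" "S \<inter> B \<subseteq> S2"
proof -
  have "separated_between (top_of_set S) (S \<inter> A) (S \<inter> B)"
  proof (rule cut_wire_fence_theorem)
    show "compact_space (top_of_set S)" using S by (simp add: compact_space_subtopology)
    show "closedin (top_of_set S) (S \<inter> A)" "closedin (top_of_set S) (S \<inter> B)" using A B by (auto intro: closedin_closed_Int)
    show "disjnt C (S \<inter> A) \<or> disjnt C (S \<inter> B)" if "connectedin (top_of_set S) C" for C
      using no[of C] that by (auto simp: connectedin_subtopology disjnt_def)
  qed (simp add: Hausdorff_space_subtopology)
  then obtain S1 S2 where "closedin (top_of_set S) S1" "closedin (top_of_set S) S2" "S1 \<union> S2 = S" "disjnt S1 S2"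
    "S \<inter> A \<subseteq> S1" "S \<inter> B \<subseteq> S2"
    unfolding separated_between_alt by auto
  then show ?thesis using S by (intro that[of S1 S2]) (auto simp: disjnt_def intro: closedin_compact)
qed

section \<open>Crossings of a perturbed narrow and tall rectangle\<close>

lemma abs_fst_le_norm: "\<bar>fst z\<bar> \<le> norm z" and abs_snd_le_norm: "\<bar>snd z\<bar> \<le> norm z" for z :: "real \<times> real"
  using norm_fst_le[of "fst z" "snd z"] norm_snd_le[of "snd z" "fst z"] by simp_all

text \<open>The affine map of the unit square onto [d, 1 - d] \<times> [-d, 1 + d], for d < 1/2:
  shorter to cross, with an overhang of d above and below.\<close>

definition narrow_tall :: "real \<Rightarrow> real \<times> real \<Rightarrow> real \<times> real" where
  "narrow_tall d x = (d + (1 - 2 * d) * fst x, (1 + 2 * d) * snd x - d)"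

text \<open>The heights of \<open>K\<close> keep it off the top and bottom of the perturbed
  rectangle \<open>P\<close>, so it can leave \<open>P\<close> only through the left side
  \<open>L\<close> or the right side \<open>R\<close>. If no part of \<open>K\<close> in
  \<open>P\<close> joined them, a partition of \<open>K \<inter> P\<close> separating
  \<open>L\<close> from \<open>R\<close> would extend to a disconnection of
  \<open>K\<close>.\<close>

lemma narrow_tall_contains_crossing:
  fixes p :: "real \<times> real \<Rightarrow> real \<times> real"
  assumes e: "0 < e" "3 * e < d" "d < 1/4"
    and p: "continuous_on unit_square p" "inj_on p unit_square"
    and pA: "\<And>x. x \<in> unit_square \<Longrightarrow> norm (p x - narrow_tall d x) < e"
    and K: "connected K" "compact K" and Kb: "\<And>z. z \<in> K \<Longrightarrow> - e \<le> snd z \<and> snd z \<le> 1 + e"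
    and a: "a \<in> K" "fst a \<le> e" and b: "b \<in> K" "1 - e \<le> fst b"
  shows "\<exists>K'\<subseteq>K. connected K' \<and> compact K' \<and> K' \<subseteq> p ` unit_square \<and>
    K' \<inter> p ` ({0} \<times> {0..1}) \<noteq> {} \<and> K' \<inter> p ` ({1} \<times> {0..1}) \<noteq> {}"
proof (rule ccontr)
  assume no: "\<not> ?thesis"
  define P where "P = p ` unit_square"
  define G where "G = p ` interior unit_square"
  define L where "L = p ` ({0} \<times> {0..1})"
  define R where "R = p ` ({1} \<times> {0..1})"
  have sub: "{0} \<times> {0..1} \<subseteq> unit_square" "{1} \<times> {0..1} \<subseteq> unit_square" by (auto simp: unit_square_def)
  have pf: "\<bar>fst (p x) - (d + (1 - 2 * d) * fst x)\<bar> < e" "\<bar>snd (p x) - ((1 + 2 * d) * snd x - d)\<bar> < e"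
    if "x \<in> unit_square" for x
  proof -
    have "\<bar>fst (p x - narrow_tall d x)\<bar> \<le> norm (p x - narrow_tall d x)"
      "\<bar>snd (p x - narrow_tall d x)\<bar> \<le> norm (p x - narrow_tall d x)"
      by (rule abs_fst_le_norm abs_snd_le_norm)+
    then show "\<bar>fst (p x) - (d + (1 - 2 * d) * fst x)\<bar> < e" "\<bar>snd (p x) - ((1 + 2 * d) * snd x - d)\<bar> < e"
      using pA[OF that] by (auto simp: narrow_tall_def)
  qed
  have cP: "compact P" unfolding P_def by (rule compact_continuous_image[OF p(1) compact_unit_square])
  have clL: "closed L" "closed R" unfolding L_def R_def
    by (intro compact_imp_closed compact_continuous_image continuous_on_subset[OF p(1)] compact_Times sub; simp)+
  have oG: "open G" unfolding G_def
    by (intro invariance_of_domain_gen open_interior continuous_on_subset[OF p(1)] inj_on_subset[OF p(2)] interior_subset) simp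
  have GP: "G \<subseteq> P" unfolding G_def P_def by (intro image_mono interior_subset)
  have PG: "P - G \<subseteq> p ` frontier unit_square"
  proof
    fix z assume z: "z \<in> P - G"
    then obtain x where x: "x \<in> unit_square" "z = p x" by (auto simp: P_def)
    then have "x \<notin> interior unit_square" using z by (auto simp: G_def)
    then have "x \<in> frontier unit_square" using x(1)
      by (auto simp: frontier_unit_square interior_unit_square mem_unit_square)
    then show "z \<in> p ` frontier unit_square" using x(2) by blast
  qed
  have frU: "x \<in> unit_square \<and> (fst x = 0 \<or> fst x = 1 \<or> snd x = 0 \<or> snd x = 1)" if "x \<in> frontier unit_square" for x
    using that by (auto simp: frontier_unit_square mem_unit_square square_gauge_def max_def abs_if split: if_splits)
  have frP: "frontier P \<subseteq> P - G"
    using cP interior_maximal[OF GP oG] by (auto simp: frontier_def compact_imp_closed)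
  \<comment> \<open>The image of the boundary of the square is within \<open>e\<close> of the
    boundary of the rectangle and therefore avoids \<open>W\<close>. As \<open>W\<close> is
    connected and contains \<open>p (1/2, 1/2)\<close>, it lies in \<open>P\<close>.\<close>
  define W where "W = {d + e .. 1 - d - e} \<times> {e - d .. 1 + d - e}"
  have Wfr: "p x \<notin> W" if x: "x \<in> frontier unit_square" for x
  proof
    assume "p x \<in> W"
    then have W: "d + e \<le> fst (p x)" "fst (p x) \<le> 1 - d - e" "e - d \<le> snd (p x)" "snd (p x) \<le> 1 + d - e"
      by (auto simp: W_def)
    note pf' = pf[of x]
    from frU[OF x] pf' W show False by (auto simp: abs_less_iff)
  qed
  have "W \<subseteq> P"
  proof (rule ccontr)
    assume "\<not> W \<subseteq> P"
    moreover have "p (1/2, 1/2) \<in> W \<inter> P"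
    proof -
      have u: "(1/2, 1/2) \<in> unit_square" by (simp add: unit_square_def)
      then have "p (1/2, 1/2) \<in> P" by (auto simp: P_def)
      moreover have "\<bar>fst (p (1/2, 1/2)) - 1/2\<bar> < e" "\<bar>snd (p (1/2, 1/2)) - 1/2\<bar> < e"
        using pf[OF u] by (simp_all add: field_simps)
      then have "d + e \<le> fst (p (1/2, 1/2))" "fst (p (1/2, 1/2)) \<le> 1 - d - e"
        "e - d \<le> snd (p (1/2, 1/2))" "snd (p (1/2, 1/2)) \<le> 1 + d - e" using e by linarith+
      then have "p (1/2, 1/2) \<in> W" by (simp add: W_def mem_Times_iff)
      ultimately show ?thesis by blast
    qed
    moreover have "connected W" unfolding W_def by (intro connected_Times connected_Icc)
    ultimately have "W \<inter> frontier P \<noteq> {}" by (intro connected_Int_frontier) auto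
    then show False using frP PG Wfr by blast
  qed
  define Ko where "Ko = K - G"
  have cKo: "closed Ko" unfolding Ko_def using K(2) oG compact_imp_closed closed_Diff by blast
  \<comment> \<open>The images of the bottom and the top lie below height \<open>e - d\<close> and
    above height \<open>1 + d - e\<close>, out of reach of \<open>K\<close>.\<close>
  have KPG: "z \<in> L \<union> R" if z: "z \<in> K" "z \<in> P" "z \<notin> G" for z
  proof -
    obtain x where x: "x \<in> frontier unit_square" "z = p x" using PG z by blast
    have xU: "x \<in> unit_square" using frU[OF x(1)] by simp
    have "snd x \<noteq> 0" "snd x \<noteq> 1" using pf(2)[OF xU] Kb[OF z(1)] e x(2) by (auto simp: abs_less_iff)
    then have "fst x = 0 \<or> fst x = 1" using frU[OF x(1)] by blast
    then show ?thesis using x(2) xU by (force simp: L_def R_def unit_square_def)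
  qed
  have Lfst: "fst z < d + e" if "z \<in> L" for z
  proof -
    from that obtain x where x: "z = p x" "x \<in> {0} \<times> {0..1}" unfolding L_def by (rule imageE)
    have "x \<in> unit_square" "fst x = 0" using x(2) sub(1) by auto
    then show ?thesis using pf(1)[of x] x(1) unfolding abs_less_iff by simp
  qed
  have Rfst: "1 - d - e < fst z" if "z \<in> R" for z
  proof -
    from that obtain x where x: "z = p x" "x \<in> {1} \<times> {0..1}" unfolding R_def by (rule imageE)
    have "x \<in> unit_square" "fst x = 1" using x(2) sub(2) by auto
    then show ?thesis using pf(1)[of x] x(1) unfolding abs_less_iff by simp
  qed
  have Ko_split: "fst z \<le> d + e \<or> 1 - d - e \<le> fst z" if z: "z \<in> Ko" for z
  proof (rule ccontr)
    assume "\<not> ?thesis"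
    then have "z \<in> W" using Kb[of z] z e by (auto simp: Ko_def W_def mem_Times_iff)
    then have "z \<in> P - G" using \<open>W \<subseteq> P\<close> z by (auto simp: Ko_def)
    then show False using PG Wfr \<open>z \<in> W\<close> by blast
  qed
  have G_fst: "e < fst z \<and> fst z < 1 - e" if z: "z \<in> G" for z
  proof -
    obtain x where x: "x \<in> interior unit_square" "z = p x" using z by (auto simp: G_def)
    have xU: "x \<in> unit_square" using x interior_subset[of unit_square] by auto
    then have "0 \<le> fst x" "fst x \<le> 1" by (auto simp: unit_square_def)
    then have "0 \<le> (1 - 2 * d) * fst x" "(1 - 2 * d) * fst x \<le> 1 - 2 * d" using e by (auto intro!: mult_left_le)
    then have "e < fst (p x)" "fst (p x) < 1 - e" using pf(1)[OF xU] e by linarith+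
    then show ?thesis using x(2) by simp
  qed
  obtain S1 S2 where S: "compact S1" "compact S2" "S1 \<union> S2 = K \<inter> P" "S1 \<inter> S2 = {}"
    "K \<inter> P \<inter> L \<subseteq> S1" "K \<inter> P \<inter> R \<subseteq> S2"
  proof (rule compact_separation_if_unlinked[OF compact_Int[OF K(2) cP] clL])
    fix C assume C: "connected C" "C \<subseteq> K \<inter> P" "C \<inter> L \<noteq> {}" "C \<inter> R \<noteq> {}"
    have "closure C \<subseteq> K \<inter> P" using C(2) compact_Int[OF K(2) cP] by (intro closure_minimal) (auto intro: compact_imp_closed)
    moreover have "compact (closure C)" using C(2) compact_Int[OF K(2) cP] bounded_subset compact_imp_bounded compact_closure by metis
    moreover have "connected (closure C)" by (rule connected_imp_connected_closure[OF C(1)])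
    moreover have "closure C \<inter> L \<noteq> {}" "closure C \<inter> R \<noteq> {}" using C(3,4) closure_subset[of C] by auto
    ultimately show False using no unfolding P_def L_def R_def by blast
  qed auto
  \<comment> \<open>What remains of \<open>K\<close> outside \<open>G\<close> is left or right of
    \<open>W\<close> and joins the corresponding piece. No overlap arises: a point of
    \<open>S1\<close> or \<open>S2\<close> outside \<open>G\<close> lies on \<open>L\<close> or
    \<open>R\<close>, and its first coordinate tells on which.\<close>
  define KL where "KL = S1 \<union> (Ko \<inter> {z. fst z \<le> d + e})"
  define KR where "KR = S2 \<union> (Ko \<inter> {z. 1 - d - e \<le> fst z})"
  have "closed {z :: real \<times> real. fst z \<le> d + e}" "closed {z :: real \<times> real. 1 - d - e \<le> fst z}"
    by (intro closed_Collect_le continuous_intros)+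
  then have "closed KL" "closed KR" unfolding KL_def KR_def
    using compact_imp_closed[OF S(1)] compact_imp_closed[OF S(2)] cKo closed_Int closed_Un by metis+
  moreover have "K \<subseteq> KL \<union> KR"
  proof
    fix z assume "z \<in> K"
    then show "z \<in> KL \<union> KR" using S(3) GP Ko_split[of z] by (auto simp: KL_def KR_def Ko_def)
  qed
  moreover have "KL \<inter> KR \<inter> K = {}"
  proof -
    have False if z: "z \<in> KL" "z \<in> KR" for z
    proof -
      have 1: "z \<in> S2" if "z \<in> S1" "z \<in> Ko" "1 - d - e \<le> fst z"
        using that KPG[of z] Lfst[of z] S e by (auto simp: Ko_def)
      have 2: "z \<in> S1" if "z \<in> S2" "z \<in> Ko" "fst z \<le> d + e"
        using that KPG[of z] Rfst[of z] S e by (auto simp: Ko_def)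
      show False using z 1 2 S(4) e by (auto simp: KL_def KR_def)
    qed
    then show ?thesis by blast
  qed
  moreover have "a \<in> KL \<inter> K" using a G_fst[of a] e by (auto simp: KL_def Ko_def)
  moreover have "b \<in> KR \<inter> K" using b G_fst[of b] e by (auto simp: KR_def Ko_def)
  ultimately show False using K(1) unfolding connected_closed by blast
qed

section \<open>Quads, the uniform metric, and the approximation theorem\<close>

lemma quadsD:
  assumes "Q \<in> quads D"
  shows "continuous_on unit_square Q" "inj_on Q unit_square" "Q ` unit_square \<subseteq> D" "Q \<in> extensional unit_square"
  using assms by (auto simp: quads_def homeomorphism_def quad_image_def intro: inj_on_inverseI)

lemma quadsI:
  assumes "continuous_on unit_square Q" "inj_on Q unit_square" "Q ` unit_square \<subseteq> D" "Q \<in> extensional unit_square"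
  shows "Q \<in> quads D"
  using assms homeomorphism_compact[OF compact_unit_square assms(1) refl assms(2)]
  by (auto simp: quads_def quad_image_def)

lemma quad_dist_less:
  assumes Q: "Q1 \<in> quads D" "Q2 \<in> quads D" and d: "mdist (quad_metric D) Q1 Q2 < r" and z: "z \<in> unit_square"
  shows "cmod (Q1 z - Q2 z) < r"
proof -
  have "compact ((\<lambda>z. cmod (Q1 z - Q2 z)) ` unit_square)"
    using quadsD(1)[OF Q(1)] quadsD(1)[OF Q(2)]
    by (intro compact_continuous_image continuous_intros compact_unit_square)
  then have "bdd_above ((\<lambda>z. cmod (Q1 z - Q2 z)) ` unit_square)"
    by (intro bounded_imp_bdd_above compact_imp_bounded)
  then have "cmod (Q1 z - Q2 z) \<le> (SUP z\<in>unit_square. cmod (Q1 z - Q2 z))"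
    using z by (intro cSUP_upper)
  then show ?thesis using d mdist_quad_metric[OF Q] by simp
qed

lemma quad_dist_le:
  assumes Q: "Q1 \<in> quads D" "Q2 \<in> quads D" and d: "\<And>z. z \<in> unit_square \<Longrightarrow> cmod (Q1 z - Q2 z) \<le> r"
  shows "mdist (quad_metric D) Q1 Q2 \<le> r"
  unfolding mdist_quad_metric[OF Q] using d by (intro cSUP_least) (auto simp: unit_square_def)

definition quad_ball :: "complex set \<Rightarrow> quad \<Rightarrow> real \<Rightarrow> quad set" where
  "quad_ball D Q r = {Q' \<in> quads D. mdist (quad_metric D) Q Q' < r}"

lemma quad_ball_eq_mball:
  "Q \<in> quads D \<Longrightarrow> quad_ball D Q r = Metric_space.mball (mspace (quad_metric D)) (mdist (quad_metric D)) Q r"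
  unfolding quad_ball_def Metric_space.mball_def[OF Metric_space_mspace_mdist] by (simp add: mspace_quad_metric)

lemma openin_quad_ball: "Q \<in> quads D \<Longrightarrow> openin (quad_topology D) (quad_ball D Q r)"
  unfolding quad_ball_eq_mball mtopology_of_def
  by (rule Metric_space.openin_mball[OF Metric_space_mspace_mdist])

lemma quad_ball_self: "Q \<in> quads D \<Longrightarrow> r > 0 \<Longrightarrow> Q \<in> quad_ball D Q r"
  unfolding quad_ball_eq_mball
  by (rule Metric_space.centre_in_mball_iff[OF Metric_space_mspace_mdist, THEN iffD2]) (simp add: mspace_quad_metric)

lemma openin_quad_topology:
  "openin (quad_topology D) U \<longleftrightarrow> U \<subseteq> quads D \<and> (\<forall>Q\<in>U. \<exists>r>0. quad_ball D Q r \<subseteq> U)"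
proof -
  have "openin (quad_topology D) U \<longleftrightarrow> U \<subseteq> quads D \<and>
      (\<forall>Q. Q \<in> U \<longrightarrow> (\<exists>r>0. Metric_space.mball (mspace (quad_metric D)) (mdist (quad_metric D)) Q r \<subseteq> U))"
    using Metric_space.openin_mtopology[OF Metric_space_mspace_mdist, of "quad_metric D" U]
    by (simp only: mtopology_of_def mspace_quad_metric)
  also have "\<dots> \<longleftrightarrow> U \<subseteq> quads D \<and> (\<forall>Q\<in>U. \<exists>r>0. quad_ball D Q r \<subseteq> U)"
    by (metis quad_ball_eq_mball subsetD)
  finally show ?thesis .
qed

lemma topspace_quad_topology: "topspace (quad_topology D) = quads D"
  by (simp add: mspace_quad_metric)

text \<open>In the coordinates \<open>H\<close>, inverse to the extension \<open>F\<close>, a quad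
  near \<open>Q'\<close> is a map near \<open>narrow_tall d\<close>, and a crossing of a quad near
  \<open>Q\<close> is a continuum nearly spanning the unit square. So
  \<open>narrow_tall_contains_crossing\<close> applies, and \<open>F\<close> carries the crossing
  that it finds back.\<close>

theorem quad_less_approximation:
  assumes D: "open D" and Q: "Q \<in> quads D" and eps: "\<epsilon> > 0"
  shows "\<exists>Q'\<in>quad_ball D Q \<epsilon>. quad_less D Q' Q"
proof -
  note Qp = quadsD[OF Q]
  obtain \<kappa> F where \<kappa>: "\<kappa> > 0" and cF: "continuous_on {x. square_gauge x \<le> 1 + \<kappa>} F"
    and iF: "inj_on F {x. square_gauge x \<le> 1 + \<kappa>}" and FQ: "\<And>x. x \<in> unit_square \<Longrightarrow> F x = Q x"
    using unit_square_embedding_extends[OF Qp(1,2)] by blast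
  define T where "T = {x. square_gauge x \<le> 1 + \<kappa>}"
  \<comment> \<open>Compactness of \<open>T\<close> gives uniform continuity of \<open>F\<close> and
    \<open>H\<close>. The smaller open square \<open>T0\<close> gives, by invariance of domain, an
    open set \<open>V\<close> on which \<open>H\<close> is defined, so that perturbed quads can
    still be pulled back.\<close>
  define T0 where "T0 = {x. square_gauge x < 1 + \<kappa>}"
  have T_cbox: "T = cbox (-\<kappa>/2, -\<kappa>/2) (1 + \<kappa>/2, 1 + \<kappa>/2)"
    by (auto simp: T_def cbox_Pair_eq square_gauge_le_iff)
  have cT: "compact T" by (simp add: T_cbox)
  have cF: "continuous_on T F" and iF: "inj_on F T" using cF iF by (simp_all add: T_def)
  have UT0: "unit_square \<subseteq> T0" and T0T: "T0 \<subseteq> T" using \<kappa> by (auto simp: T0_def T_def unit_square_gauge)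
  obtain H where H: "homeomorphism T (F ` T) F H" using homeomorphism_compact[OF cT cF refl iF] by blast
  have HF: "\<And>x. x \<in> T \<Longrightarrow> H (F x) = x" and FH: "\<And>z. z \<in> F ` T \<Longrightarrow> F (H z) = z" and cH: "continuous_on (F ` T) H"
    using H by (auto simp: homeomorphism_def)
  have oT0: "open T0" unfolding T0_def by (intro open_Collect_less continuous_intros)
  define V where "V = F ` T0"
  have oV: "open V" unfolding V_def
    by (rule invariance_of_domain_gen[OF oT0 continuous_on_subset[OF cF T0T] inj_on_subset[OF iF T0T]]) simp
  have VFT: "V \<subseteq> F ` T" unfolding V_def using T0T by blast
  have QV: "Q ` unit_square \<subseteq> V" using FQ UT0 by (force simp: V_def)
  have cQU: "compact (Q ` unit_square)" by (rule compact_continuous_image[OF Qp(1) compact_unit_square])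
  obtain r where r: "r > 0" "(\<Union>x\<in>Q ` unit_square. cball x r) \<subseteq> D"
    using compact_subset_open_imp_cball_epsilon_subset[OF cQU D Qp(3)] by blast
  define \<epsilon>' where "\<epsilon>' = min (\<epsilon> / 2) r"
  have \<epsilon>': "\<epsilon>' > 0" using eps r by (simp add: \<epsilon>'_def)
  have "uniformly_continuous_on T F" using cF cT by (rule compact_uniformly_continuous)
  then obtain \<delta> where \<delta>: "\<delta> > 0" "\<And>x y. x \<in> T \<Longrightarrow> y \<in> T \<Longrightarrow> dist y x < \<delta> \<Longrightarrow> dist (F y) (F x) < \<epsilon>'"
    unfolding uniformly_continuous_on_def using \<epsilon>' by metis
  \<comment> \<open>\<open>A\<close> moves points by at most \<open>2 * d\<close>, so
    \<open>2 * d < \<delta>\<close> makes \<open>Q'\<close> close to \<open>Q\<close>;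
    \<open>d < \<kappa> / 2\<close> keeps the overhang inside \<open>T0\<close>.\<close>
  define d where "d = min (min (\<kappa> / 4) (1/8)) (\<delta> / 4)"
  have d: "d > 0" "d < \<kappa> / 2" "d < 1/4" "2 * d < \<delta>" using \<kappa> \<delta>(1) by (auto simp: d_def)
  define A where "A = narrow_tall d"
  have AT0: "A x \<in> T0" if "x \<in> unit_square" for x
  proof -
    have x: "0 \<le> fst x" "fst x \<le> 1" "0 \<le> snd x" "snd x \<le> 1" using that by (auto simp: unit_square_def)
    define u v where "u = (1 - 2 * d) * fst x" and "v = (1 + 2 * d) * snd x"
    have "0 \<le> u" "u \<le> 1 - 2 * d" "0 \<le> v" "v \<le> 1 + 2 * d"
      unfolding u_def v_def using x d by (auto intro!: mult_left_le)
    then have "square_gauge (d + u, v - d) < 1 + \<kappa>" using d by (simp add: square_gauge_less_iff)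
    then show ?thesis by (simp add: T0_def A_def narrow_tall_def u_def v_def)
  qed
  have Ax: "norm (A x - x) < \<delta>" if "x \<in> unit_square" for x
  proof -
    have x: "0 \<le> fst x" "fst x \<le> 1" "0 \<le> snd x" "snd x \<le> 1" using that by (auto simp: unit_square_def)
    have "\<bar>1 - 2 * fst x\<bar> \<le> 1" "\<bar>2 * snd x - 1\<bar> \<le> 1" using x by auto
    then have "\<bar>d * (1 - 2 * fst x)\<bar> \<le> d" "\<bar>d * (2 * snd x - 1)\<bar> \<le> d"
      using d(1) by (simp_all add: abs_mult mult_left_le)
    moreover have "A x - x = (d * (1 - 2 * fst x), d * (2 * snd x - 1))"
      by (simp add: A_def narrow_tall_def prod_eq_iff algebra_simps)
    ultimately show ?thesis using norm_Pair_le[of "d * (1 - 2 * fst x)" "d * (2 * snd x - 1)"] d(4) by simp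
  qed
  have cA: "continuous_on unit_square A" unfolding A_def narrow_tall_def by (intro continuous_intros)
  have iA: "inj_on A unit_square" using d by (auto simp: inj_on_def A_def narrow_tall_def)
  define Q' where "Q' = restrict (F \<circ> A) unit_square"
  have Q'F: "Q' x = F (A x)" if "x \<in> unit_square" for x using that by (simp add: Q'_def)
  have Q'near: "dist (Q' x) (Q x) < \<epsilon>'" if "x \<in> unit_square" for x
    using \<delta>(2)[of x "A x"] Ax[OF that] AT0[OF that] UT0 T0T that Q'F[OF that] FQ[OF that] by (auto simp: dist_norm)
  have Q'q: "Q' \<in> quads D"
  proof (rule quadsI)
    have "continuous_on unit_square (F \<circ> A)"
      using AT0 T0T by (intro continuous_on_compose cA continuous_on_subset[OF cF]) auto
    then show "continuous_on unit_square Q'" using Q'F by (simp cong: continuous_on_cong)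
    show "inj_on Q' unit_square"
    proof (rule inj_onI)
      fix x y assume xy: "x \<in> unit_square" "y \<in> unit_square" "Q' x = Q' y"
      then have "A x = A y" using Q'F AT0 T0T HF by (metis subsetD)
      then show "x = y" using iA xy by (auto dest: inj_onD)
    qed
    show "Q' ` unit_square \<subseteq> D"
    proof
      fix z assume "z \<in> Q' ` unit_square"
      then obtain x where x: "x \<in> unit_square" "z = Q' x" by blast
      have "z \<in> cball (Q x) r" using Q'near[OF x(1)] x(2) by (simp add: \<epsilon>'_def dist_commute)
      then show "z \<in> D" using r(2) x(1) by blast
    qed
  qed (simp add: Q'_def)
  have Q'V: "Q' ` unit_square \<subseteq> V" using Q'F AT0 by (auto simp: V_def)
  have cQ'U: "compact (Q' ` unit_square)"
    by (rule compact_continuous_image[OF quadsD(1)[OF Q'q] compact_unit_square])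
  have "Q' \<in> quad_ball D Q \<epsilon>"
  proof -
    have "mdist (quad_metric D) Q Q' \<le> \<epsilon> / 2"
      using Q'near by (intro quad_dist_le Q Q'q) (force simp: \<epsilon>'_def dist_norm norm_minus_commute)
    then show ?thesis using eps Q'q by (simp add: quad_ball_def)
  qed
  moreover have "quad_less D Q' Q"
  proof -
    define e where "e = d / 4"
    have e: "0 < e" "3 * e < d" using d by (auto simp: e_def)
    have "uniformly_continuous_on (F ` T) H"
      by (rule compact_uniformly_continuous[OF cH compact_continuous_image[OF cF cT]])
    then obtain \<eta>1 where \<eta>1: "\<eta>1 > 0" "\<And>x y. x \<in> F ` T \<Longrightarrow> y \<in> F ` T \<Longrightarrow> dist y x < \<eta>1 \<Longrightarrow> dist (H y) (H x) < e"
      unfolding uniformly_continuous_on_def using e(1) by metis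
    obtain \<eta>2 where \<eta>2: "\<eta>2 > 0" "(\<Union>x\<in>Q ` unit_square. cball x \<eta>2) \<subseteq> V"
      using compact_subset_open_imp_cball_epsilon_subset[OF cQU oV QV] by blast
    obtain \<eta>3 where \<eta>3: "\<eta>3 > 0" "(\<Union>x\<in>Q' ` unit_square. cball x \<eta>3) \<subseteq> V"
      using compact_subset_open_imp_cball_epsilon_subset[OF cQ'U oV Q'V] by blast
    \<comment> \<open>\<open>\<eta>1\<close> turns closeness of quads into closeness
      \<open>e\<close> in the coordinates \<open>H\<close>; \<open>\<eta>2\<close> and
      \<open>\<eta>3\<close> keep the perturbations of \<open>Q\<close> and \<open>Q'\<close> inside
      \<open>V\<close>.\<close>
    define \<eta> where "\<eta> = min \<eta>1 (min \<eta>2 \<eta>3)"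
    have \<eta>: "\<eta> > 0" "\<eta> \<le> \<eta>1" "\<eta> \<le> \<eta>2" "\<eta> \<le> \<eta>3" using \<eta>1 \<eta>2 \<eta>3 by (auto simp: \<eta>_def)
    have "quad_le Q1 Q2" if Q1: "Q1 \<in> quad_ball D Q' \<eta>" and Q2: "Q2 \<in> quad_ball D Q \<eta>" for Q1 Q2
      unfolding quad_le_def
    proof (intro allI impI)
      fix K assume "crossing Q2 K"
      then have K: "connected K" "compact K" "K \<subseteq> Q2 ` unit_square" "K \<inter> Q2 ` ({0} \<times> {0..1}) \<noteq> {}" "K \<inter> Q2 ` ({1} \<times> {0..1}) \<noteq> {}"
        by (auto simp: crossing_def quad_image_def quad_side0_def quad_side2_def)
      have Qq: "Q1 \<in> quads D" "Q2 \<in> quads D" using Q1 Q2 by (auto simp: quad_ball_def)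
      have n1: "dist (Q1 x) (Q' x) < \<eta>" if "x \<in> unit_square" for x
        using quad_dist_less[OF Q'q Qq(1) _ that] Q1 by (auto simp: quad_ball_def dist_norm norm_minus_commute)
      have n2: "dist (Q2 x) (Q x) < \<eta>" if "x \<in> unit_square" for x
        using quad_dist_less[OF Q Qq(2) _ that] Q2 by (auto simp: quad_ball_def dist_norm norm_minus_commute)
      have V1: "Q1 x \<in> V" if "x \<in> unit_square" for x
      proof -
        have "Q1 x \<in> cball (Q' x) \<eta>3" using n1[OF that] \<eta> by (simp add: dist_commute)
        then show ?thesis using \<eta>3(2) that by blast
      qed
      have V2: "Q2 x \<in> V" if "x \<in> unit_square" for x
      proof -
        have "Q2 x \<in> cball (Q x) \<eta>2" using n2[OF that] \<eta> by (simp add: dist_commute)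
        then show ?thesis using \<eta>2(2) that by blast
      qed
      have h1: "norm (H (Q1 x) - A x) < e" if "x \<in> unit_square" for x
      proof -
        have "H (Q' x) = A x" using Q'F[OF that] HF[of "A x"] AT0[OF that] T0T by auto
        then show ?thesis
          using \<eta>1(2)[of "Q' x" "Q1 x"] n1[OF that] \<eta> V1[OF that] Q'V VFT that by (force simp: dist_norm)
      qed
      have h2: "norm (H (Q2 x) - x) < e" if "x \<in> unit_square" for x
      proof -
        have "H (Q x) = x" using FQ[OF that] HF[of x] that UT0 T0T by auto
        then show ?thesis
          using \<eta>1(2)[of "Q x" "Q2 x"] n2[OF that] \<eta> V2[OF that] QV VFT that by (force simp: dist_norm)
      qed
      have h2': "\<bar>fst (H (Q2 x)) - fst x\<bar> < e" "\<bar>snd (H (Q2 x)) - snd x\<bar> < e" if "x \<in> unit_square" for x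
        using h2[OF that] abs_fst_le_norm[of "H (Q2 x) - x"] abs_snd_le_norm[of "H (Q2 x) - x"] by auto
      have sub: "{0} \<times> {0..1} \<subseteq> unit_square" "{1} \<times> {0..1} \<subseteq> unit_square" by (auto simp: unit_square_def)
      have KV: "K \<subseteq> V" using K(3) V2 by auto
      have Q1im: "Q1 ` unit_square \<subseteq> F ` T" using V1 VFT by auto
      obtain a where a: "a \<in> {0} \<times> {0..1}" "Q2 a \<in> K" using K(4) by auto
      obtain b where b: "b \<in> {1} \<times> {0..1}" "Q2 b \<in> K" using K(5) by auto
      have "\<exists>K'\<subseteq>H ` K. connected K' \<and> compact K' \<and> K' \<subseteq> (H \<circ> Q1) ` unit_square \<and>
        K' \<inter> (H \<circ> Q1) ` ({0} \<times> {0..1}) \<noteq> {} \<and> K' \<inter> (H \<circ> Q1) ` ({1} \<times> {0..1}) \<noteq> {}"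
      proof (rule narrow_tall_contains_crossing[OF e d(3), where a = "H (Q2 a)" and b = "H (Q2 b)"])
        show "continuous_on unit_square (H \<circ> Q1)"
          using quadsD(1)[OF Qq(1)] Q1im by (intro continuous_on_compose continuous_on_subset[OF cH]) auto
        show "inj_on (H \<circ> Q1) unit_square"
        proof (rule comp_inj_on[OF quadsD(2)[OF Qq(1)]])
          show "inj_on H (Q1 ` unit_square)" using FH Q1im by (metis inj_on_inverseI inj_on_subset)
        qed
        show "norm ((H \<circ> Q1) x - narrow_tall d x) < e" if "x \<in> unit_square" for x
          using h1[OF that] by (simp add: A_def)
        show "connected (H ` K)" "compact (H ` K)"
          using KV VFT K(1,2) by (auto intro!: connected_continuous_image compact_continuous_image continuous_on_subset[OF cH])
        show "- e \<le> snd z \<and> snd z \<le> 1 + e" if z: "z \<in> H ` K" for z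
        proof -
          obtain x where "x \<in> unit_square" "z = H (Q2 x)" using z K(3) by blast
          then show ?thesis using h2'(2)[of x] by (auto simp: unit_square_def)
        qed
        have "a \<in> unit_square" "b \<in> unit_square" using a b sub by blast+
        then show "fst (H (Q2 a)) \<le> e" "1 - e \<le> fst (H (Q2 b))" using h2'(1)[of a] h2'(1)[of b] a b by auto
      qed (use a b in auto)
      then obtain K' where K': "K' \<subseteq> H ` K" "connected K'" "compact K'" "K' \<subseteq> (H \<circ> Q1) ` unit_square"
        "K' \<inter> (H \<circ> Q1) ` ({0} \<times> {0..1}) \<noteq> {}" "K' \<inter> (H \<circ> Q1) ` ({1} \<times> {0..1}) \<noteq> {}" by blast
      have FHQ: "F (H (Q1 x)) = Q1 x" if "x \<in> unit_square" for x using FH Q1im that by blast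
      have K'T: "K' \<subseteq> T"
      proof
        fix y assume "y \<in> K'"
        then obtain z where "z \<in> K" "y = H z" using K'(1) by blast
        then show "y \<in> T" using KV VFT HF by force
      qed
      have "F ` K' \<subseteq> K"
      proof
        fix y assume "y \<in> F ` K'"
        then obtain z where z: "z \<in> K" "y = F (H z)" using K'(1) by blast
        then show "y \<in> K" using FH[of z] KV VFT by auto
      qed
      moreover have "crossing Q1 (F ` K')"
        unfolding crossing_def quad_image_def quad_side0_def quad_side2_def
      proof (intro conjI)
        show "connected (F ` K')" "compact (F ` K')"
          using K'(2,3) K'T by (auto intro!: connected_continuous_image compact_continuous_image continuous_on_subset[OF cF])
        show "F ` K' \<subseteq> Q1 ` unit_square"
        proof
          fix y assume "y \<in> F ` K'"
          then obtain x where "x \<in> unit_square" "y = F (H (Q1 x))" using K'(4) by auto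
          then show "y \<in> Q1 ` unit_square" using FHQ by auto
        qed
        have side: "F ` K' \<inter> Q1 ` X \<noteq> {}" if X: "K' \<inter> (H \<circ> Q1) ` X \<noteq> {}" "X \<subseteq> unit_square" for X
        proof -
          obtain y where y: "y \<in> K'" "y \<in> (H \<circ> Q1) ` X" using X(1) by blast
          from y(2) obtain x where "y = (H \<circ> Q1) x" "x \<in> X" by (rule imageE)
          then have x: "x \<in> X" "H (Q1 x) \<in> K'" using y(1) by simp_all
          have "Q1 x \<in> F ` K'" using FHQ[of x] x X(2) by (metis imageI subsetD)
          then show ?thesis using x(1) by blast
        qed
        show "F ` K' \<inter> Q1 ` ({0} \<times> {0..1}) \<noteq> {}" by (rule side[OF K'(5) sub(1)])
        show "F ` K' \<inter> Q1 ` ({1} \<times> {0..1}) \<noteq> {}" by (rule side[OF K'(6) sub(2)])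
      qed
      ultimately show "\<exists>K'\<subseteq>K. crossing Q1 K'" by blast
    qed
    then show ?thesis unfolding quad_less_def
      using openin_quad_ball[OF Q'q, of \<eta>] openin_quad_ball[OF Q, of \<eta>] quad_ball_self[OF Q'q \<eta>(1)] quad_ball_self[OF Q \<eta>(1)]
      by blast
  qed
  ultimately show ?thesis by blast
qed

section \<open>The topology of the configuration space\<close>

text \<open>The family is taken nonempty because \<open>\<Inter>{}\<close> is the whole type and not
  the underlying space.\<close>

lemma generate_topology_on_local_base:
  assumes "generate_topology_on \<S> U" "x \<in> U"
  shows "\<exists>F. finite F \<and> F \<noteq> {} \<and> F \<subseteq> \<S> \<and> x \<in> \<Inter>F \<and> \<Inter>F \<subseteq> U"
  using assms
proof (induction arbitrary: x rule: generate_topology_on.induct)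
  case (Int a b)
  obtain F where F: "finite F" "F \<noteq> {}" "F \<subseteq> \<S>" "x \<in> \<Inter>F" "\<Inter>F \<subseteq> a" using Int.IH(1)[of x] Int.prems by auto
  obtain G where G: "finite G" "G \<noteq> {}" "G \<subseteq> \<S>" "x \<in> \<Inter>G" "\<Inter>G \<subseteq> b" using Int.IH(2)[of x] Int.prems by auto
  have "\<Inter>(F \<union> G) \<subseteq> a \<inter> b" using F(5) G(5) by blast
  then show ?case using F G by (intro exI[of _ "F \<union> G"]) auto
next
  case (UN K)
  then obtain k where k: "k \<in> K" "x \<in> k" by blast
  then obtain F where F: "finite F" "F \<noteq> {}" "F \<subseteq> \<S>" "x \<in> \<Inter>F" "\<Inter>F \<subseteq> k" using UN.IH[OF k] by blast
  then have "\<Inter>F \<subseteq> \<Union>K" using k(1) by blast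
  then show ?case using F by blast
next
  case (Basis s)
  then show ?case by (intro exI[of _ "{s}"]) auto
qed auto

text \<open>Bridge to the form in which Alexander's theorem speaks of a subbase; there the empty
  intersection is read relative to the union of the subbase.\<close>

lemma topology_generated_by_subbase:
  "topology (arbitrary union_of (finite intersection_of (\<lambda>x. x \<in> \<S>) relative_to \<Union>\<S>)) = topology_generated_by \<S>"
proof (rule topology_base_unique)
  fix U assume "(finite intersection_of (\<lambda>x. x \<in> \<S>) relative_to \<Union>\<S>) U"
  then obtain F where F: "finite F" "F \<subseteq> \<S>" "U = \<Union>\<S> \<inter> \<Inter>F" by (auto simp: relative_to_def intersection_of_def)
  have top: "openin (topology_generated_by \<S>) (\<Union>\<S>)" by (metis openin_topspace topology_generated_by_topspace)
  show "openin (topology_generated_by \<S>) U"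
  proof (cases "F = {}")
    case True then show ?thesis using F top by simp
  next
    case False
    then have "openin (topology_generated_by \<S>) (\<Inter>F)"
      using F by (intro openin_Inter) (auto intro: topology_generated_by_Basis)
    then show ?thesis using F top by (simp add: openin_Int)
  qed
next
  fix U x assume U: "openin (topology_generated_by \<S>) U" "x \<in> U"
  then obtain F where F: "finite F" "F \<noteq> {}" "F \<subseteq> \<S>" "x \<in> \<Inter>F" "\<Inter>F \<subseteq> U"
    using generate_topology_on_local_base openin_topology_generated_by by metis
  have "(finite intersection_of (\<lambda>x. x \<in> \<S>)) (\<Inter>F)" using F by (auto simp: intersection_of_def)
  moreover have "\<Inter>F = \<Union>\<S> \<inter> \<Inter>F" using F by blast
  ultimately have "(finite intersection_of (\<lambda>x. x \<in> \<S>) relative_to \<Union>\<S>) (\<Inter>F)" unfolding relative_to_def by metis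
  then show "\<exists>B. (finite intersection_of (\<lambda>x. x \<in> \<S>) relative_to \<Union>\<S>) B \<and> x \<in> B \<and> B \<subseteq> U" using F by blast
qed

text \<open>The subbasic sets V_U; \<open>miss_set\<close> gives the sets V^Q.\<close>

definition hit_set :: "complex set \<Rightarrow> quad set \<Rightarrow> quad set set" where
  "hit_set D U = {S \<in> config_space D. S \<inter> U \<noteq> {}}"

definition miss_set :: "complex set \<Rightarrow> quad \<Rightarrow> quad set set" where
  "miss_set D Q = {S \<in> config_space D. Q \<notin> S}"

definition config_subbase :: "complex set \<Rightarrow> quad set set set" where
  "config_subbase D = insert (config_space D)
     ({hit_set D U | U. openin (quad_topology D) U} \<union> {miss_set D Q | Q. Q \<in> quads D})"

lemma config_topology_subbase: "config_topology D = topology_generated_by (config_subbase D)"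
  unfolding config_topology_def config_subbase_def hit_set_def miss_set_def ..

lemma openin_hit_set: "openin (quad_topology D) U \<Longrightarrow> openin (config_topology D) (hit_set D U)"
  unfolding config_topology_subbase by (rule topology_generated_by_Basis) (auto simp: config_subbase_def)

lemma openin_miss_set: "Q \<in> quads D \<Longrightarrow> openin (config_topology D) (miss_set D Q)"
  unfolding config_topology_subbase by (rule topology_generated_by_Basis) (auto simp: config_subbase_def)

section \<open>Lower sets, the strict order, and compactness of the configuration space\<close>

lemma config_spaceD:
  assumes "S \<in> config_space D"
  shows "S \<subseteq> quads D" "closedin (quad_topology D) S"
    "\<And>Q Q'. Q \<in> S \<Longrightarrow> Q' \<in> quads D \<Longrightarrow> quad_less D Q' Q \<Longrightarrow> Q' \<in> S"
  using assms by (auto simp: config_space_def lower_set_def)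

lemma quad_le_trans: "quad_le Q1 Q2 \<Longrightarrow> quad_le Q2 Q3 \<Longrightarrow> quad_le Q1 Q3"
  unfolding quad_le_def by (meson order_trans)

lemma quad_less_trans: "quad_less D Q1 Q2 \<Longrightarrow> quad_less D Q2 Q3 \<Longrightarrow> quad_less D Q1 Q3"
  unfolding quad_less_def using quad_le_trans by meson

text \<open>A pair of neighbourhoods that witnesses \<open>Q' < Q\<close> witnesses it for every
  quad of the upper neighbourhood as well.\<close>

lemma openin_quads_above: "openin (quad_topology D) {Q \<in> quads D. quad_less D Q' Q}"
proof (subst openin_subopen, intro ballI)
  fix Q assume "Q \<in> {Q \<in> quads D. quad_less D Q' Q}"
  then obtain U1 U2 where U: "openin (quad_topology D) U1" "openin (quad_topology D) U2" "Q' \<in> U1" "Q \<in> U2"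
    "\<forall>Q\<in>U1. \<forall>Q'\<in>U2. quad_le Q Q'" by (auto simp: quad_less_def)
  have "U2 \<subseteq> quads D" using U(2) openin_subset topspace_quad_topology by metis
  then have "U2 \<subseteq> {Q \<in> quads D. quad_less D Q' Q}" using U unfolding quad_less_def by blast
  then show "\<exists>T. openin (quad_topology D) T \<and> Q \<in> T \<and> T \<subseteq> {Q \<in> quads D. quad_less D Q' Q}" using U by blast
qed

text \<open>Transitivity makes the set before closing a lower set. Closing does no harm, because the
  order is open in its larger argument: a quad below a limit is already below a quad of the
  set.\<close>

lemma lower_hull_config_space:
  assumes A: "A \<subseteq> quads D"
  shows "quad_topology D closure_of (A \<union> {Q' \<in> quads D. \<exists>Q\<in>A. quad_less D Q' Q}) \<in> config_space D"
proof -
  define L where "L = A \<union> {Q' \<in> quads D. \<exists>Q\<in>A. quad_less D Q' Q}"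
  have LQ: "L \<subseteq> quads D" using A by (auto simp: L_def)
  have cl: "quad_topology D closure_of L \<subseteq> quads D"
    by (metis closure_of_subset_topspace topspace_quad_topology)
  have "Q' \<in> quad_topology D closure_of L"
    if Q: "Q \<in> quad_topology D closure_of L" and Q': "Q' \<in> quads D" "quad_less D Q' Q" for Q Q'
  proof -
    have "{Q \<in> quads D. quad_less D Q' Q} \<inter> quad_topology D closure_of L \<noteq> {}" using Q cl Q' by blast
    then obtain Q2 where Q2: "Q2 \<in> L" "quad_less D Q' Q2"
      using openin_Int_closure_of_eq_empty[OF openin_quads_above[of D Q'], of L] by blast
    from Q2(1) have "\<exists>Q\<in>A. quad_less D Q' Q"
      unfolding L_def using Q2(2) quad_less_trans[OF Q2(2)] by blast
    then have "Q' \<in> L" using Q'(1) by (simp add: L_def)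
    then show ?thesis using closure_of_subset[of L "quad_topology D"] LQ topspace_quad_topology by blast
  qed
  then show ?thesis unfolding L_def[symmetric] config_space_def lower_set_def using cl by simp
qed

theorem compact_config_topology: "compact_space (config_topology D)"
  unfolding config_topology_subbase
proof (rule Alexander_subbase)
  show "topology (arbitrary union_of (finite intersection_of (\<lambda>x. x \<in> config_subbase D) relative_to \<Union> (config_subbase D)))
      = topology_generated_by (config_subbase D)" by (rule topology_generated_by_subbase)
next
  fix C assume C: "C \<subseteq> config_subbase D" "\<Union>C = topspace (topology_generated_by (config_subbase D))"
  have CX: "\<Union>C = config_space D"
    using C(2) topspace_config_topology[of D] unfolding config_topology_subbase by simp
  have "\<exists>C'. finite C' \<and> C' \<subseteq> C \<and> config_space D \<subseteq> \<Union>C'"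
  proof (cases "config_space D \<in> C")
    case True
    then show ?thesis by (intro exI[of _ "{config_space D}"]) auto
  next
    case False
    define A where "A = {Q \<in> quads D. miss_set D Q \<in> C}"
    define S0 where "S0 = quad_topology D closure_of (A \<union> {Q' \<in> quads D. \<exists>Q\<in>A. quad_less D Q' Q})"
    have AQ: "A \<subseteq> quads D" by (auto simp: A_def)
    have S0: "S0 \<in> config_space D" unfolding S0_def by (rule lower_hull_config_space[OF AQ])
    then obtain V where V: "V \<in> C" "S0 \<in> V" using CX by blast
    have AS0: "A \<subseteq> S0" unfolding S0_def
      using closure_of_subset[of "A \<union> {Q' \<in> quads D. \<exists>Q\<in>A. quad_less D Q' Q}" "quad_topology D"] AQ
      unfolding topspace_quad_topology by blast
    \<comment> \<open>\<open>S0\<close> contains every \<open>Q\<close> whose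
      \<open>miss_set D Q\<close> belongs to the cover, so a member that contains \<open>S0\<close>
      can only be a hit set.\<close>
    from V(1) C(1) False consider U where "openin (quad_topology D) U" "V = hit_set D U"
      | Q where "Q \<in> quads D" "V = miss_set D Q" unfolding config_subbase_def by blast
    then show ?thesis
    proof cases
      case (1 U)
      then have "S0 \<inter> U \<noteq> {}" using V(2) by (auto simp: hit_set_def)
      \<comment> \<open>Being open, \<open>U\<close> meets not just the closure but the set itself,
        at some \<open>Q'\<close> equal to or below a \<open>Q\<close> in \<open>A\<close>. A
        configuration either misses \<open>Q\<close> or contains \<open>Q'\<close> and so meets
        \<open>U\<close>: two members cover everything.\<close>
      then obtain Q' where Q': "Q' \<in> U" "Q' \<in> A \<union> {Q' \<in> quads D. \<exists>Q\<in>A. quad_less D Q' Q}"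
        unfolding S0_def using openin_Int_closure_of_eq_empty[OF 1(1)] by blast
      have Q'q: "Q' \<in> quads D" using Q'(2) AQ by blast
      obtain Q where Q: "Q \<in> A" "Q' = Q \<or> quad_less D Q' Q" using Q'(2) by blast
      have "config_space D \<subseteq> \<Union> {V, miss_set D Q}"
      proof
        fix S assume S: "S \<in> config_space D"
        show "S \<in> \<Union> {V, miss_set D Q}"
        proof (cases "Q \<in> S")
          case True
          then have "Q' \<in> S" using Q(2) config_spaceD(3)[OF S True Q'q] by blast
          then show ?thesis using 1(2) S Q'(1) by (auto simp: hit_set_def)
        next
          case False
          then show ?thesis using S by (auto simp: miss_set_def)
        qed
      qed
      moreover have "{V, miss_set D Q} \<subseteq> C" using V(1) Q(1) by (auto simp: A_def)
      ultimately show ?thesis by (intro exI[of _ "{V, miss_set D Q}"]) auto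
    next
      case (2 Q)
      then have "Q \<in> A" using V(1) by (auto simp: A_def)
      then have "Q \<in> S0" using AS0 by blast
      then show ?thesis using 2 V(2) by (auto simp: miss_set_def)
    qed
  qed
  then show "\<exists>C'. finite C' \<and> C' \<subseteq> C \<and> \<Union>C' = topspace (topology_generated_by (config_subbase D))"
    using CX C(2) by (metis Union_mono subset_antisym)
qed

text \<open>Since \<open>S\<close> is closed, a ball about \<open>Q\<close> avoids it, and
  approximation from below finds \<open>Q'\<close> in that ball. The Hausdorff property and second
  countability both rest on this.\<close>

lemma quad_below_outside_config:
  assumes D: "open D" and S: "S \<in> config_space D" and Q: "Q \<in> quads D" "Q \<notin> S"
  obtains Q' U where "Q' \<in> quads D" "quad_less D Q' Q" "openin (quad_topology D) U" "Q' \<in> U" "U \<inter> S = {}"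
proof -
  have "openin (quad_topology D) (quads D - S)"
    using config_spaceD(2)[OF S] topspace_quad_topology[of D] by (metis closedin_def)
  moreover from this obtain r where r: "r > 0" "quad_ball D Q r \<subseteq> quads D - S"
    using Q unfolding openin_quad_topology by blast
  moreover obtain Q' where "Q' \<in> quad_ball D Q r" "quad_less D Q' Q"
    using quad_less_approximation[OF D Q(1) r(1)] by blast
  ultimately show ?thesis by (intro that[of Q' "quads D - S"]) auto
qed

theorem Hausdorff_config_topology:
  assumes D: "open D"
  shows "Hausdorff_space (config_topology D)"
proof -
  have *: "\<exists>U V. openin (config_topology D) U \<and> openin (config_topology D) V \<and> S \<in> U \<and> S' \<in> V \<and> disjnt U V"
    if S: "S \<in> config_space D" "S' \<in> config_space D" and Q: "Q \<in> S" "Q \<notin> S'" for S S' Q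
  proof -
    have Qq: "Q \<in> quads D" using Q(1) config_spaceD(1)[OF S(1)] by blast
    obtain Q' U where Q': "Q' \<in> quads D" "quad_less D Q' Q" "Q' \<in> U" "U \<inter> S' = {}"
      using quad_below_outside_config[OF D S(2) Qq Q(2)] by metis
    \<comment> \<open>A configuration that meets \<open>W\<close> contains \<open>Q'\<close>,
      because it is a lower set.\<close>
    define W where "W = {Q2 \<in> quads D. quad_less D Q' Q2}"
    have "disjnt (hit_set D W) (miss_set D Q')"
      using config_spaceD(3)[OF _ _ Q'(1)] by (auto simp: disjnt_iff hit_set_def miss_set_def W_def)
    moreover have "S \<in> hit_set D W" using S(1) Q(1) Qq Q'(2) by (auto simp: hit_set_def W_def)
    moreover have "S' \<in> miss_set D Q'" using S(2) Q' by (auto simp: miss_set_def)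
    moreover have "openin (quad_topology D) W" unfolding W_def by (rule openin_quads_above)
    ultimately show ?thesis using openin_hit_set openin_miss_set[OF Q'(1)] by blast
  qed
  show ?thesis
    unfolding Hausdorff_space_def topspace_config_topology
  proof clarify
    fix S S' assume S: "S \<in> config_space D" "S' \<in> config_space D" "S \<noteq> S'"
    then consider Q where "Q \<in> S" "Q \<notin> S'" | Q where "Q \<in> S'" "Q \<notin> S" by blast
    then show "\<exists>U V. openin (config_topology D) U \<and> openin (config_topology D) V \<and> S \<in> U \<and> S' \<in> V \<and> disjnt U V"
    proof cases
      case 1
      then show ?thesis using * S by blast
    next
      case 2
      then obtain U V where "openin (config_topology D) U" "openin (config_topology D) V" "S' \<in> U" "S \<in> V" "disjnt U V"
        using *[OF S(2,1) 2] by blast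
      then show ?thesis using disjnt_sym by blast
    qed
  qed
qed

text \<open>These are subbasic sets of the compact-open topology: the compact image of
  \<open>K\<close> has a positive distance from the complement of \<open>W\<close>. They serve for
  second countability and for the closedness of the set of crossed quads.\<close>

lemma openin_quads_mapping_into:
  assumes K: "compact K" "K \<subseteq> unit_square" and W: "open W"
  shows "openin (quad_topology D) {Q \<in> quads D. Q ` K \<subseteq> W}"
  unfolding openin_quad_topology
proof (intro conjI ballI)
  fix Q assume "Q \<in> {Q \<in> quads D. Q ` K \<subseteq> W}"
  then have Q: "Q \<in> quads D" "Q ` K \<subseteq> W" by auto
  have "compact (Q ` K)"
    by (rule compact_continuous_image[OF continuous_on_subset[OF quadsD(1)[OF Q(1)] K(2)] K(1)])
  then obtain e where e: "e > 0" "(\<Union>x\<in>Q ` K. cball x e) \<subseteq> W"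
    using compact_subset_open_imp_cball_epsilon_subset[OF _ W Q(2)] by blast
  have "quad_ball D Q e \<subseteq> {Q \<in> quads D. Q ` K \<subseteq> W}"
  proof
    fix Q' assume "Q' \<in> quad_ball D Q e"
    then have Q': "Q' \<in> quads D" "mdist (quad_metric D) Q Q' < e" by (auto simp: quad_ball_def)
    have "Q' x \<in> W" if x: "x \<in> K" for x
    proof -
      have "cmod (Q x - Q' x) < e" using quad_dist_less[OF Q(1) Q'] K(2) x by blast
      then have "Q' x \<in> cball (Q x) e" by (simp add: dist_norm)
      then show ?thesis using e(2) x by blast
    qed
    then show "Q' \<in> {Q \<in> quads D. Q ` K \<subseteq> W}" using Q'(1) by blast
  qed
  then show "\<exists>r>0. quad_ball D Q r \<subseteq> {Q \<in> quads D. Q ` K \<subseteq> W}" using e(1) by blast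
qed auto

text \<open>Over the compact square the uniform metric induces the compact-open topology, so the
  sets \<open>N p\<close>, with \<open>p\<close> a pair of members of two countable bases, form a
  countable subbase.\<close>

theorem second_countable_quad_topology: "second_countable (quad_topology D)"
proof -
  obtain \<O> :: "(real \<times> real) set set" where O: "countable \<O>" "topological_basis \<O>"
    using ex_countable_basis by blast
  obtain \<W> :: "complex set set" where W: "countable \<W>" "topological_basis \<W>"
    using ex_countable_basis by blast
  define N where "N p = {Q \<in> quads D. Q ` (unit_square \<inter> closure (fst p)) \<subseteq> snd p}" for p :: "(real \<times> real) set \<times> complex set"
  define \<B> where "\<B> = (\<lambda>F. quads D \<inter> \<Inter> (N ` F)) ` {F. finite F \<and> F \<subseteq> \<O> \<times> \<W>}"
  have cnt: "countable \<B>" unfolding \<B>_def using O(1) W(1) by (intro countable_image countable_Collect_finite_subset) simp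
  have opN: "openin (quad_topology D) (N p)" if "p \<in> \<O> \<times> \<W>" for p
    unfolding N_def using that W(2) by (intro openin_quads_mapping_into compact_Int_closed compact_unit_square)
      (auto intro: topological_basis_open)
  have op: "openin (quad_topology D) V" if V: "V \<in> \<B>" for V
  proof -
    obtain F where F: "finite F" "F \<subseteq> \<O> \<times> \<W>" "V = quads D \<inter> \<Inter> (N ` F)" using V by (auto simp: \<B>_def)
    have top: "openin (quad_topology D) (quads D)" by (metis openin_topspace topspace_quad_topology)
    show ?thesis
    proof (cases "F = {}")
      case False
      have "openin (quad_topology D) (\<Inter> (N ` F))" using F(1,2) False opN by (intro openin_Inter) auto
      then show ?thesis unfolding F(3) by (rule openin_Int[OF top])
    qed (use F top in simp)
  qed
  have base: "\<exists>V\<in>\<B>. Q \<in> V \<and> V \<subseteq> U" if U: "openin (quad_topology D) U" "Q \<in> U" for U Q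
  proof -
    have Qq: "Q \<in> quads D" using U openin_quad_topology by blast
    obtain r where r: "r > 0" "quad_ball D Q r \<subseteq> U" using U openin_quad_topology by blast
    have "\<exists>p. p \<in> \<O> \<times> \<W> \<and> x \<in> fst p \<and> open (fst p) \<and> Q ` (unit_square \<inter> closure (fst p)) \<subseteq> snd p \<and> snd p \<subseteq> ball (Q x) (r / 3)"
      if x: "x \<in> unit_square" for x
    proof -
      obtain w where w: "w \<in> \<W>" "Q x \<in> w" "w \<subseteq> ball (Q x) (r / 3)"
        using topological_basisE[OF W(2) open_ball, of "Q x" "Q x" "r / 3"] r(1) by auto
      have "open w" using w(1) W(2) topological_basis_open by blast
      then obtain s where s: "s > 0" "ball (Q x) s \<subseteq> w" using w(2) unfolding open_contains_ball by blast
      obtain \<rho> where \<rho>: "\<rho> > 0" "\<And>y. y \<in> unit_square \<Longrightarrow> dist y x < \<rho> \<Longrightarrow> dist (Q y) (Q x) < s"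
        using quadsD(1)[OF Qq] x s(1) unfolding continuous_on_iff by metis
      obtain V where V: "V \<in> \<O>" "x \<in> V" "V \<subseteq> ball x (\<rho> / 2)"
        using topological_basisE[OF O(2) open_ball, of x x "\<rho> / 2"] \<rho>(1) by auto
      have "closure V \<subseteq> cball x (\<rho> / 2)" using V(3) by (intro closure_minimal) auto
      then have "closure V \<subseteq> ball x \<rho>" using \<rho>(1) by auto
      then have "Q ` (unit_square \<inter> closure V) \<subseteq> w" using \<rho>(2) s(2) by (force simp: dist_commute)
      moreover have "open V" using V(1) O(2) topological_basis_open by blast
      ultimately show ?thesis using V w by (intro exI[of _ "(V, w)"]) auto
    qed
    then obtain p where p: "\<And>x. x \<in> unit_square \<Longrightarrow> p x \<in> \<O> \<times> \<W> \<and> x \<in> fst (p x) \<and> open (fst (p x)) \<and>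
        Q ` (unit_square \<inter> closure (fst (p x))) \<subseteq> snd (p x) \<and> snd (p x) \<subseteq> ball (Q x) (r / 3)" by metis
    obtain X where X: "X \<subseteq> unit_square" "finite X" "unit_square \<subseteq> (\<Union>x\<in>X. fst (p x))"
      using compactE_image[OF compact_unit_square, of unit_square "\<lambda>x. fst (p x)"] p by blast
    define V where "V = quads D \<inter> \<Inter> (N ` p ` X)"
    have "p ` X \<subseteq> \<O> \<times> \<W>" using p X(1) by blast
    then have "V \<in> \<B>" unfolding \<B>_def V_def using X(2) by (intro image_eqI[of _ _ "p ` X"]) auto
    moreover have "Q \<in> V" using p X(1) Qq by (auto simp: V_def N_def)
    moreover have "V \<subseteq> U"
    proof
      fix Q' assume Q': "Q' \<in> V"
      have Q'q: "Q' \<in> quads D" using Q' by (simp add: V_def)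
      \<comment> \<open>Two radii of r/3 leave room below r, as only weak inequalities pass to the
        supremum.\<close>
      have "cmod (Q z - Q' z) \<le> 2 * r / 3" if z: "z \<in> unit_square" for z
      proof -
        obtain x where x: "x \<in> X" "z \<in> fst (p x)" using X(3) z by blast
        have xU: "x \<in> unit_square" using x(1) X(1) by blast
        have zc: "z \<in> unit_square \<inter> closure (fst (p x))" using z x(2) closure_subset[of "fst (p x)"] by auto
        have "Q' \<in> N (p x)" using Q' x(1) by (auto simp: V_def)
        then have "Q' ` (unit_square \<inter> closure (fst (p x))) \<subseteq> snd (p x)" by (simp add: N_def)
        then have "Q' z \<in> ball (Q x) (r / 3)" using p[OF xU] zc by blast
        moreover have "Q z \<in> ball (Q x) (r / 3)" using p[OF xU] zc by blast
        ultimately have "dist (Q z) (Q' z) < r / 3 + r / 3"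
          using dist_triangle[of "Q z" "Q' z" "Q x"] by (simp add: dist_commute)
        then show ?thesis by (simp add: dist_norm)
      qed
      then have "mdist (quad_metric D) Q Q' \<le> 2 * r / 3" by (rule quad_dist_le[OF Qq Q'q])
      then have "Q' \<in> quad_ball D Q r" using Q'q r(1) by (simp add: quad_ball_def)
      then show "Q' \<in> U" using r(2) by blast
    qed
    ultimately show ?thesis by blast
  qed
  show ?thesis unfolding second_countable_def using cnt op base by blast
qed

text \<open>Sets V_U need only \<open>U\<close> from a countable base. For V^Q and a configuration
  \<open>S\<close> that misses \<open>Q\<close>, take \<open>Q' < Q\<close> outside \<open>S\<close>
  and a small base set \<open>V\<close> around \<open>Q'\<close>: the quad \<open>c V\<close> chosen
  in \<open>V\<close> is still below \<open>Q\<close> and outside \<open>S\<close>, so missing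
  \<open>c V\<close> implies missing \<open>Q\<close>.\<close>

theorem second_countable_config_topology:
  assumes D: "open D"
  shows "second_countable (config_topology D)"
proof -
  from second_countable_quad_topology[of D] obtain \<B> where \<B>0: "countable \<B> \<and> (\<forall>V\<in>\<B>. openin (quad_topology D) V) \<and>
      (\<forall>U Q. openin (quad_topology D) U \<and> Q \<in> U \<longrightarrow> (\<exists>V\<in>\<B>. Q \<in> V \<and> V \<subseteq> U))"
    unfolding second_countable_def by (rule exE)
  then have \<B>: "countable \<B>" "\<And>V. V \<in> \<B> \<Longrightarrow> openin (quad_topology D) V"
    "\<And>U Q. openin (quad_topology D) U \<Longrightarrow> Q \<in> U \<Longrightarrow> \<exists>V\<in>\<B>. Q \<in> V \<and> V \<subseteq> U"
    by simp_all
  define c where "c V = (SOME Q. Q \<in> V)" for V :: "quad set"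
  have c: "c V \<in> V" if "V \<noteq> {}" for V using that unfolding c_def by (metis ex_in_conv someI_ex)
  define C where "C = c ` {V \<in> \<B>. V \<noteq> {}}"
  have CQ: "C \<subseteq> quads D" 
  proof
    fix Q assume "Q \<in> C"
    then obtain V where V: "V \<in> \<B>" "V \<noteq> {}" "Q = c V" by (auto simp: C_def)
    then have "V \<subseteq> quads D" using \<B>(2) openin_quad_topology by metis
    then show "Q \<in> quads D" using c[OF V(2)] V(3) by blast
  qed
  define \<S> where "\<S> = hit_set D ` \<B> \<union> miss_set D ` C"
  have cnt: "countable \<S>" unfolding \<S>_def C_def using \<B>(1) by (intro countable_Un countable_image) (auto intro: countable_subset)
  have op: "openin (config_topology D) V" if "V \<in> \<S>" for V
    using that \<B>(2) CQ by (auto simp: \<S>_def intro: openin_hit_set openin_miss_set)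
  have sb: "\<exists>F. finite F \<and> F \<subseteq> \<S> \<and> S \<in> config_space D \<inter> \<Inter>F \<and> config_space D \<inter> \<Inter>F \<subseteq> B"
    if B: "B \<in> config_subbase D" and S: "S \<in> B" for B S
  proof -
    from B consider "B = config_space D" | U where "openin (quad_topology D) U" "B = hit_set D U"
      | Q where "Q \<in> quads D" "B = miss_set D Q" unfolding config_subbase_def by blast
    then show ?thesis
    proof cases
      case 1
      then show ?thesis using S by (intro exI[of _ "{}"]) auto
    next
      case (2 U)
      then obtain Q where Q: "S \<in> config_space D" "Q \<in> S" "Q \<in> U" using S by (auto simp: hit_set_def)
      then obtain V where V: "V \<in> \<B>" "Q \<in> V" "V \<subseteq> U" using \<B>(3)[OF 2(1)] by blast
      have "hit_set D V \<subseteq> B" using V(3) 2(2) by (auto simp: hit_set_def)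
      moreover have "S \<in> hit_set D V" using Q V(2) by (auto simp: hit_set_def)
      ultimately show ?thesis using V(1) Q(1) by (intro exI[of _ "{hit_set D V}"]) (auto simp: \<S>_def)
    next
      case (3 Q)
      then have SQ: "S \<in> config_space D" "Q \<notin> S" using S by (auto simp: miss_set_def)
      obtain Q' U where Q': "Q' \<in> quads D" "quad_less D Q' Q" "openin (quad_topology D) U" "Q' \<in> U" "U \<inter> S = {}"
        using quad_below_outside_config[OF D SQ(1) 3(1) SQ(2)] by blast
      obtain U1 U2 where U: "openin (quad_topology D) U1" "openin (quad_topology D) U2" "Q' \<in> U1" "Q \<in> U2"
        "\<forall>Q\<in>U1. \<forall>Q'\<in>U2. quad_le Q Q'" using Q'(2) unfolding quad_less_def by blast
      obtain V where V: "V \<in> \<B>" "Q' \<in> V" "V \<subseteq> U \<inter> U1"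
        using \<B>(3)[OF openin_Int[OF Q'(3) U(1)]] Q'(4) U(3) by blast
      have cV: "c V \<in> V" "c V \<in> C" using c[of V] V by (auto simp: C_def)
      have "quad_less D (c V) Q" unfolding quad_less_def using U cV(1) V(3) by blast
      then have "miss_set D (c V) \<subseteq> B"
        using config_spaceD(3) cV(2) CQ unfolding 3(2) miss_set_def by blast
      moreover have "S \<in> miss_set D (c V)" using SQ(1) cV(1) V(3) Q'(5) by (auto simp: miss_set_def)
      ultimately show ?thesis using cV(2) SQ(1) by (intro exI[of _ "{miss_set D (c V)}"]) (auto simp: \<S>_def)
    qed
  qed
  define \<T> where "\<T> = (\<lambda>F. config_space D \<inter> \<Inter>F) ` {F. finite F \<and> F \<subseteq> \<S>}"
  have "countable \<T>" unfolding \<T>_def using cnt by (intro countable_image countable_Collect_finite_subset)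
  moreover have "openin (config_topology D) V" if "V \<in> \<T>" for V
  proof -
    obtain F where F: "finite F" "F \<subseteq> \<S>" "V = config_space D \<inter> \<Inter>F" using \<open>V \<in> \<T>\<close> by (auto simp: \<T>_def)
    have top: "openin (config_topology D) (config_space D)" by (metis openin_topspace topspace_config_topology)
    show ?thesis
    proof (cases "F = {}")
      case False
      have "openin (config_topology D) (\<Inter>F)" using F(1,2) False op by (intro openin_Inter) auto
      then show ?thesis unfolding F(3) by (rule openin_Int[OF top])
    qed (use F top in simp)
  qed
  moreover have "\<exists>V\<in>\<T>. S \<in> V \<and> V \<subseteq> U" if U: "openin (config_topology D) U" "S \<in> U" for U S
  proof -
    have SX: "S \<in> config_space D" using U openin_subset topspace_config_topology by blast
    have "generate_topology_on (config_subbase D) U"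
      using U(1) unfolding config_topology_subbase by (rule openin_topology_generated_by)
    then obtain G where G: "finite G" "G \<subseteq> config_subbase D" "S \<in> \<Inter>G" "\<Inter>G \<subseteq> U" "G \<noteq> {}"
      using generate_topology_on_local_base[OF _ U(2)] by metis
    have "\<forall>B\<in>G. \<exists>F. finite F \<and> F \<subseteq> \<S> \<and> S \<in> config_space D \<inter> \<Inter>F \<and> config_space D \<inter> \<Inter>F \<subseteq> B"
      using sb G by blast
    then obtain F where F: "\<And>B. B \<in> G \<Longrightarrow> finite (F B) \<and> F B \<subseteq> \<S> \<and> S \<in> config_space D \<inter> \<Inter>(F B) \<and> config_space D \<inter> \<Inter>(F B) \<subseteq> B"
      by metis
    define E where "E = config_space D \<inter> \<Inter>(\<Union> (F ` G))"
    have "finite (\<Union> (F ` G))" "\<Union> (F ` G) \<subseteq> \<S>" using F G(1) by auto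
    then have "E \<in> \<T>" unfolding E_def \<T>_def by blast
    moreover have "S \<in> E" using F SX by (auto simp: E_def)
    moreover have "E \<subseteq> U"
    proof -
      have "E \<subseteq> B" if "B \<in> G" for B
      proof -
        have "E \<subseteq> config_space D \<inter> \<Inter>(F B)" using that by (auto simp: E_def)
        then show ?thesis using F[OF that] by blast
      qed
      then show ?thesis using G(4) by blast
    qed
    ultimately show ?thesis by blast
  qed
  ultimately show ?thesis unfolding second_countable_def by blast
qed

section \<open>Probability measures on a compact space\<close>

lemma borel_of_simps: "space (borel_of X) = topspace X" "openin X V \<Longrightarrow> V \<in> sets (borel_of X)"
proof -
  have "{U. openin X U} \<subseteq> Pow (topspace X)" by (auto dest: openin_subset)
  then show "space (borel_of X) = topspace X" "openin X V \<Longrightarrow> V \<in> sets (borel_of X)"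
    unfolding borel_of_def by (auto simp: sets_measure_of)
qed

lemma measurable_borel_of_continuous_map:
  fixes f :: "'a \<Rightarrow> 'b :: topological_space"
  assumes f: "continuous_map X euclidean f" and M: "sets M = sets (borel_of X)"
  shows "f \<in> borel_measurable M"
proof (rule borel_measurableI)
  fix S :: "'b set" assume "open S"
  then have "openin X {x \<in> topspace X. f x \<in> S}"
    using f by (intro openin_continuous_map_preimage[where Y = euclidean]) auto
  moreover have "f -` S \<inter> space M = {x \<in> topspace X. f x \<in> S}"
    using sets_eq_imp_space_eq[OF M] borel_of_simps(1)[of X] by auto
  ultimately show "f -` S \<inter> space M \<in> sets M" using borel_of_simps(2) M by auto
qed

text \<open>Used for a measure on \<open>X\<close> split into cells and for Lebesgue measure split
  into intervals of addresses, which brings both integrals to the same finite sum.\<close>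

lemma prob_integral_finite_valued_approx:
  fixes F :: "'a \<Rightarrow> real"
  assumes N: "prob_space N" and F: "F \<in> borel_measurable N" and L: "finite L" "\<And>\<omega>. \<omega> \<in> space N \<Longrightarrow> A \<omega> \<in> L"
    and A: "\<And>s. s \<in> L \<Longrightarrow> {\<omega> \<in> space N. A \<omega> = s} \<in> sets N"
    and approx: "\<And>\<omega>. \<omega> \<in> space N \<Longrightarrow> \<bar>F \<omega> - g (A \<omega>)\<bar> \<le> \<epsilon>"
  shows "\<bar>integral\<^sup>L N F - (\<Sum>s\<in>L. measure N {\<omega> \<in> space N. A \<omega> = s} * g s)\<bar> \<le> \<epsilon>"
proof -
  interpret prob_space N by (rule N)
  define G where "G \<omega> = (\<Sum>s\<in>L. g s * indicator {\<omega> \<in> space N. A \<omega> = s} \<omega>)" for \<omega>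
  have G: "G \<omega> = g (A \<omega>)" if "\<omega> \<in> space N" for \<omega>
  proof -
    have "G \<omega> = (\<Sum>s\<in>L. if A \<omega> = s then g s else 0)"
      unfolding G_def using that by (intro sum.cong) (auto simp: indicator_def)
    then show ?thesis using L that by simp
  qed
  have iG: "integrable N G" unfolding G_def using A
    by (intro Bochner_Integration.integrable_sum integrable_mult_right integrable_real_indicator) (auto simp: emeasure_eq_measure)
  have "integrable N (\<lambda>\<omega>. F \<omega> - G \<omega>)"
    by (rule integrable_const_bound[where B = \<epsilon>]) (use approx G F iG in auto)
  then have "integrable N (\<lambda>\<omega>. (F \<omega> - G \<omega>) + G \<omega>)" by (rule Bochner_Integration.integrable_add[OF _ iG])
  then have iF: "integrable N F" by simp
  have "integral\<^sup>L N G = (\<Sum>s\<in>L. g s * measure N {\<omega> \<in> space N. A \<omega> = s})"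
    unfolding G_def using A
    by (subst Bochner_Integration.integral_sum)
      (auto intro!: integrable_mult_right integrable_real_indicator sum.cong simp: emeasure_eq_measure)
  then have "integral\<^sup>L N F - (\<Sum>s\<in>L. measure N {\<omega> \<in> space N. A \<omega> = s} * g s) = (\<integral>\<omega>. F \<omega> - G \<omega> \<partial>N)"
    using iF iG by (simp add: mult.commute)
  also have "\<bar>\<dots>\<bar> \<le> (\<integral>\<omega>. \<bar>F \<omega> - G \<omega>\<bar> \<partial>N)" by (rule integral_abs_bound)
  also have "\<dots> \<le> \<epsilon>"
    using approx G iF iG by (intro integral_le_const) auto
  finally show ?thesis .
qed

text \<open>It replaces uniqueness of representing measures: a measure and the law rebuilt from its
  weights are only shown to have equal integrals, and open sets cannot tell more.\<close>

lemma weak_star_indistinguishable: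
  assumes B: "openin (weak_star_topology X) B" "\<mu> \<in> B" and \<nu>: "\<nu> \<in> prob_measures X"
    and eq: "\<And>f. continuous_map X euclideanreal f \<Longrightarrow> bounded (f ` topspace X) \<Longrightarrow> (\<integral>x. f x \<partial>\<mu>) = (\<integral>x. f x \<partial>\<nu>)"
  shows "\<nu> \<in> B"
proof -
  have "generate_topology_on {{\<mu> \<in> prob_measures X. (\<integral>x. f x \<partial>\<mu>) \<in> V} | f V.
        continuous_map X euclideanreal f \<and> bounded (f ` topspace X) \<and> open V} B"
    using B(1) unfolding weak_star_topology_def by (rule openin_topology_generated_by)
  then show ?thesis using B(2)
  proof induction
    case (Basis S)
    then show ?case using eq \<nu> by auto
  qed auto
qed

section \<open>Probability measures as weights on a binary tree of cells\<close>

locale compact_space_with_base =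
  fixes X :: "'a topology" and U :: "nat \<Rightarrow> 'a set"
  assumes compact: "compact_space X" and Hausdorff: "Hausdorff_space X"
    and openU: "\<And>i. openin X (U i)"
    and baseU: "\<And>V x. openin X V \<Longrightarrow> x \<in> V \<Longrightarrow> \<exists>i. x \<in> U i \<and> U i \<subseteq> V"
begin

text \<open>A word of length \<open>n\<close> records, last letter first, which of \<open>U 0, \<dots>, U (n - 1)\<close> contain the
  points of its cell.\<close>

primrec cell :: "bool list \<Rightarrow> 'a set" where
  "cell [] = topspace X"
| "cell (b # s) = cell s \<inter> (if b then U (length s) else - U (length s))"

lemma cell_subset: "cell s \<subseteq> topspace X"
  by (induction s) auto

lemma cell_borel: "cell s \<in> sets (borel_of X)"
proof (induction s)
  case Nil
  then show ?case using borel_of_simps(2)[OF openin_topspace] by simp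
next
  case (Cons b s)
  have U: "U (length s) \<in> sets (borel_of X)" by (rule borel_of_simps(2)[OF openU])
  have "cell s \<inter> - U (length s) = cell s - U (length s)" by blast
  then show ?case using Cons U by (cases b) (auto intro: sets.Int sets.Diff)
qed

text \<open>Words grow at the front, so the letter for \<open>U i\<close> is counted from the right
  end and does not change when the word is prolonged.\<close>

definition bit :: "bool list \<Rightarrow> nat \<Rightarrow> bool" where
  "bit s i = s ! (length s - Suc i)"

lemma bit_Cons: "i \<le> length s \<Longrightarrow> bit (b # s) i = (if i = length s then b else bit s i)"
  by (auto simp: bit_def nth_Cons' Suc_diff_Suc)

lemma cell_bit: "i < length s \<Longrightarrow> cell s \<subseteq> (if bit s i then U i else - U i)"
  by (induction s) (auto simp: bit_Cons less_Suc_eq split: if_splits)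

text \<open>An open set that meets the closure meets the cell. There is no analogue for points
  outside \<open>U i\<close>, since the closure of a cell inside \<open>U i\<close> may leave
  \<open>U i\<close>.\<close>

lemma bit_if_closure_meets:
  assumes "x \<in> X closure_of cell s" "x \<in> U i" "i < length s"
  shows "bit s i"
proof -
  have "cell s \<inter> U i \<noteq> {}"
    using assms(1,2) openU[of i] by (auto simp: in_closure_of)
  then show ?thesis using cell_bit[OF assms(3)] by (auto split: if_splits)
qed

text \<open>For an empty cell the value is arbitrary; in the sums below it is multiplied by weight
  0.\<close>

definition rep :: "bool list \<Rightarrow> 'a" where
  "rep s = (SOME x. x \<in> cell s)"

lemma rep: "cell s \<noteq> {} \<Longrightarrow> rep s \<in> cell s"
  unfolding rep_def by (simp add: some_in_eq)

text \<open>By compactness finitely many \<open>U i\<close> on which \<open>f\<close> varies by at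
  most \<open>\<epsilon>\<close> cover the space. Once words are long enough to decide all of these,
  each nonempty cell lies inside one of them, and the closed condition passes to the closure of the
  cell.\<close>

lemma oscillation_on_cells:
  assumes f: "continuous_map X euclideanreal f" and e: "\<epsilon> > 0"
  shows "\<exists>n0. \<forall>s x. n0 \<le> length s \<longrightarrow> cell s \<noteq> {} \<longrightarrow> x \<in> X closure_of cell s \<longrightarrow> \<bar>f x - f (rep s)\<bar> \<le> \<epsilon>"
proof -
  define J where "J = {i. \<forall>x\<in>U i. \<forall>y\<in>U i. \<bar>f x - f y\<bar> \<le> \<epsilon>}"
  have "topspace X \<subseteq> \<Union> (U ` J)"
  proof
    fix x assume x: "x \<in> topspace X"
    have "openin X {y \<in> topspace X. f y \<in> ball (f x) (\<epsilon> / 2)}"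
      using f by (intro openin_continuous_map_preimage[where Y = euclidean]) auto
    then obtain i where i: "x \<in> U i" "U i \<subseteq> {y \<in> topspace X. f y \<in> ball (f x) (\<epsilon> / 2)}"
      using baseU[of "{y \<in> topspace X. f y \<in> ball (f x) (\<epsilon> / 2)}" x] x e by auto
    have "\<bar>f y - f z\<bar> \<le> \<epsilon>" if "y \<in> U i" "z \<in> U i" for y z
    proof -
      have "dist (f x) (f y) < \<epsilon> / 2" "dist (f x) (f z) < \<epsilon> / 2" using i(2) that by auto
      then show ?thesis by (simp add: dist_real_def abs_if split: if_splits)
    qed
    then show "x \<in> \<Union> (U ` J)" using i(1) by (auto simp: J_def)
  qed
  then obtain F where F: "finite F" "F \<subseteq> U ` J" "topspace X \<subseteq> \<Union>F"
    using compact openU unfolding compact_space_alt by (metis imageE)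
  then obtain I where I: "finite I" "I \<subseteq> J" "F = U ` I" using finite_subset_image by metis
  \<comment> \<open>Inserting 0 keeps \<open>Max\<close> meaningful for empty \<open>I\<close>;
    \<open>Suc\<close> is needed because letters are numbered from 0.\<close>
  have "\<bar>f x - f (rep s)\<bar> \<le> \<epsilon>" if s: "Suc (Max (insert 0 I)) \<le> length s" "cell s \<noteq> {}" "x \<in> X closure_of cell s" for s x
  proof -
    have "rep s \<in> topspace X" using rep[OF s(2)] cell_subset by blast
    then obtain i where i: "i \<in> I" "rep s \<in> U i" using F(3) I(3) by blast
    have "i \<le> Max (insert 0 I)" using i(1) I(1) by simp
    then have "i < length s" using s(1) by linarith
    then have "cell s \<subseteq> U i" using cell_bit[of i s] rep[OF s(2)] i(2) by (auto split: if_splits)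
    moreover have "i \<in> J" using i(1) I(2) by blast
    ultimately have "cell s \<subseteq> {y \<in> topspace X. f y \<in> cball (f (rep s)) \<epsilon>}"
      using rep[OF s(2)] cell_subset by (auto simp: J_def dist_real_def subset_iff)
    moreover have "closedin X {y \<in> topspace X. f y \<in> cball (f (rep s)) \<epsilon>}"
      using f by (intro closedin_continuous_map_preimage[where Y = euclidean]) auto
    ultimately have "X closure_of cell s \<subseteq> {y \<in> topspace X. f y \<in> cball (f (rep s)) \<epsilon>}" by (rule closure_of_minimal)
    then have "dist (f (rep s)) (f x) \<le> \<epsilon>" using s(3) by auto
    then show ?thesis by (simp add: dist_real_def abs_minus_commute)
  qed
  then show ?thesis by blast
qed

text \<open>The third condition lets the nested cells chosen below have a common limit point.\<close>

definition weights :: "(bool list \<Rightarrow> real) set" where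
  "weights = {m. (\<forall>s. 0 \<le> m s \<and> m s \<le> 1) \<and> m [] = 1 \<and> (\<forall>s. m s = m (True # s) + m (False # s)) \<and>
     (\<forall>s. cell s = {} \<longrightarrow> m s = 0)}"

text \<open>Tychonoff's theorem for a product of unit intervals; each remaining condition concerns
  finitely many coordinates and is closed.\<close>

lemma compact_weights: "compact weights"
proof -
  have "compactin (product_topology (\<lambda>_. euclideanreal) UNIV) (PiE (UNIV :: bool list set) (\<lambda>_. {0..1}))"
    by (simp add: compactin_PiE)
  then have "compact (PiE (UNIV :: bool list set) (\<lambda>_. {0..1::real}))"
    by (simp add: euclidean_product_topology)
  moreover have "closed {m :: bool list \<Rightarrow> real. m [] = 1 \<and> (\<forall>s. m s = m (True # s) + m (False # s)) \<and> (\<forall>s. cell s = {} \<longrightarrow> m s = 0)}"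
    by (intro closed_Collect_conj closed_Collect_all closed_Collect_imp closed_Collect_eq continuous_intros open_Collect_const
        continuous_on_product_coordinates)
  ultimately have "compact (PiE UNIV (\<lambda>_. {0..1}) \<inter>
      {m :: bool list \<Rightarrow> real. m [] = 1 \<and> (\<forall>s. m s = m (True # s) + m (False # s)) \<and> (\<forall>s. cell s = {} \<longrightarrow> m s = 0)})"
    by (rule compact_Int_closed)
  moreover have "weights = PiE UNIV (\<lambda>_. {0..1}) \<inter>
      {m :: bool list \<Rightarrow> real. m [] = 1 \<and> (\<forall>s. m s = m (True # s) + m (False # s)) \<and> (\<forall>s. cell s = {} \<longrightarrow> m s = 0)}"
    unfolding weights_def PiE_UNIV_domain Pi_def atLeastAtMost_iff by blast
  ultimately show ?thesis by simp
qed

lemma weightsD: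
  assumes "m \<in> weights"
  shows "0 \<le> m s" "m s \<le> 1" "m [] = 1" "m s = m (True # s) + m (False # s)" "m s \<noteq> 0 \<Longrightarrow> cell s \<noteq> {}"
  using assms unfolding weights_def by blast+

lemma finite_words: "finite {s :: bool list. length s = n}"
  using finite_lists_length_eq[of "UNIV :: bool set" n] by simp

primrec word :: "'a \<Rightarrow> nat \<Rightarrow> bool list" where
  "word x 0 = []"
| "word x (Suc n) = (x \<in> U n) # word x n"

lemma length_word [simp]: "length (word x n) = n"
  by (induction n) auto

lemma cell_eq_word: "cell s = {x \<in> topspace X. word x (length s) = s}"
  by (induction s) auto

lemma prob_measures_weights:
  assumes "\<mu> \<in> prob_measures X"
  shows "(\<lambda>s. measure \<mu> (cell s)) \<in> weights"
proof -
  interpret prob_space \<mu> using assms by (simp add: prob_measures_def)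
  have sets: "sets \<mu> = sets (borel_of X)" using assms by (simp add: prob_measures_def)
  have space: "space \<mu> = topspace X" using sets_eq_imp_space_eq[OF sets] by (simp add: borel_of_simps)
  have meas: "cell s \<in> sets \<mu>" for s using cell_borel sets by simp
  have "measure \<mu> (cell s) = measure \<mu> (cell (True # s)) + measure \<mu> (cell (False # s))" for s
  proof -
    have "measure \<mu> (cell (True # s) \<union> cell (False # s)) = measure \<mu> (cell (True # s)) + measure \<mu> (cell (False # s))"
      by (rule finite_measure_Union[OF meas meas]) auto
    moreover have "cell (True # s) \<union> cell (False # s) = cell s" by auto
    ultimately show ?thesis by simp
  qed
  moreover have "measure \<mu> (cell []) = 1" using prob_space space by simp
  moreover have "measure \<mu> (cell s) = 0" if "cell s = {}" for s using that by simp
  ultimately show ?thesis unfolding weights_def mem_Collect_eq using prob_le_1 measure_nonneg by blast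
qed

lemma prob_measures_integral_approx:
  assumes "\<mu> \<in> prob_measures X" and f: "continuous_map X euclideanreal f"
    and n: "\<And>s x. length s = n \<Longrightarrow> cell s \<noteq> {} \<Longrightarrow> x \<in> X closure_of cell s \<Longrightarrow> \<bar>f x - f (rep s)\<bar> \<le> \<epsilon>"
  shows "\<bar>(\<integral>x. f x \<partial>\<mu>) - (\<Sum>s | length s = n. measure \<mu> (cell s) * f (rep s))\<bar> \<le> \<epsilon>"
proof -
  have sets: "sets \<mu> = sets (borel_of X)" using assms by (simp add: prob_measures_def)
  have space: "space \<mu> = topspace X" using sets_eq_imp_space_eq[OF sets] by (simp add: borel_of_simps)
  have cell: "{x \<in> space \<mu>. word x n = s} = cell s" if "length s = n" for s
    using cell_eq_word[of s] that space by simp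
  have "\<bar>(\<integral>x. f x \<partial>\<mu>) - (\<Sum>s | length s = n. measure \<mu> {x \<in> space \<mu>. word x n = s} * f (rep s))\<bar> \<le> \<epsilon>"
  proof (rule prob_integral_finite_valued_approx)
    show "prob_space \<mu>" using assms by (simp add: prob_measures_def)
    show "{x \<in> space \<mu>. word x n = s} \<in> sets \<mu>" if "s \<in> {s. length s = n}" for s
      using cell[of s] cell_borel[of s] that sets by simp
    fix x assume "x \<in> space \<mu>"
    then have "x \<in> cell (word x n)" using space by (simp add: cell_eq_word)
    then show "\<bar>f x - f (rep (word x n))\<bar> \<le> \<epsilon>"
      using n[of "word x n" x] closure_of_subset[OF cell_subset[of "word x n"]] by auto
  qed (use f sets finite_words in \<open>auto intro: measurable_borel_of_continuous_map\<close>)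
  then show ?thesis using cell by simp
qed

text \<open>The unit interval is cut, for every \<open>n\<close>, into consecutive intervals of lengths \<open>m s\<close>; these
  partitions refine each other.\<close>

primrec left_end :: "(bool list \<Rightarrow> real) \<Rightarrow> bool list \<Rightarrow> real" where
  "left_end m [] = 0"
| "left_end m (b # s) = left_end m s + (if b then m (False # s) else 0)"

text \<open>The word whose interval contains \<open>u\<close>, found letter by letter; inside the
  interval of a word the \<open>False\<close> part lies to the left of the \<open>True\<close>
  part.\<close>

primrec address :: "(bool list \<Rightarrow> real) \<Rightarrow> real \<Rightarrow> nat \<Rightarrow> bool list" where
  "address m u 0 = []"
| "address m u (Suc n) = (left_end m (True # address m u n) \<le> u) # address m u n"

lemma length_address [simp]: "length (address m u n) = n"
  by (induction n) auto

lemma left_end_bounds: "m \<in> weights \<Longrightarrow> 0 \<le> left_end m s \<and> left_end m s + m s \<le> 1"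
proof (induction s)
  case Nil
  then show ?case by (simp add: weightsD(3))
next
  case (Cons b s)
  note m = Cons.prems
  show ?case using Cons.IH[OF m] weightsD(1)[OF m, of "True # s"] weightsD(1)[OF m, of "False # s"] weightsD(4)[OF m, of s]
    by (cases b) auto
qed

text \<open>The intervals are half-open, so each \<open>u\<close> has one address of each length,
  and a word of weight 0 is the address of no \<open>u\<close>. Hence addresses have nonempty
  cells.\<close>

lemma address_eq_iff:
  assumes m: "m \<in> weights" and u: "0 \<le> u" "u < 1"
  shows "address m u n = s \<longleftrightarrow> length s = n \<and> left_end m s \<le> u \<and> u < left_end m s + m s"
proof (induction n arbitrary: s)
  case 0
  then show ?case using u weightsD(3)[OF m] by auto
next
  case (Suc n)
  show ?case
  proof (cases s)
    case (Cons b t)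
    show ?thesis
      using Suc.IH[of t] weightsD(1)[OF m, of "True # t"] weightsD(1)[OF m, of "False # t"] weightsD(4)[OF m, of t]
      unfolding Cons by (cases b) auto
  qed auto
qed

lemma cell_address_nonempty:
  assumes "m \<in> weights" "0 \<le> u" "u < 1"
  shows "cell (address m u n) \<noteq> {}"
proof -
  have "m (address m u n) \<noteq> 0" using address_eq_iff[OF assms, of n "address m u n"] by auto
  then show ?thesis using weightsD(5)[OF assms(1)] by blast
qed

text \<open>Closures are taken because the nested cells themselves may have empty intersection. The
  choice is harmless for measurability, as \<open>limit_point_mem_U_iff\<close> shows.\<close>

definition limit_point :: "(bool list \<Rightarrow> real) \<Rightarrow> real \<Rightarrow> 'a" where
  "limit_point m u = (SOME x. \<forall>n. x \<in> X closure_of cell (address m u n))"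

lemma limit_point:
  assumes "m \<in> weights" "0 \<le> u" "u < 1"
  shows "limit_point m u \<in> X closure_of cell (address m u n)"
proof -
  have "(\<Inter>n. X closure_of cell (address m u n)) \<noteq> {}"
  proof (rule compact_space_imp_nest[OF compact])
    show "decseq (\<lambda>n. X closure_of cell (address m u n))"
      by (intro decseq_SucI closure_of_mono) auto
    show "X closure_of cell (address m u n) \<noteq> {}" for n
      using cell_address_nonempty[OF assms, of n] closure_of_eq_empty[OF cell_subset] by auto
  qed simp
  then have "\<exists>x. \<forall>n. x \<in> X closure_of cell (address m u n)" by blast
  from someI_ex[OF this] show ?thesis unfolding limit_point_def by blast
qed

definition unit_interval :: "real measure" where
  "unit_interval = restrict_space lborel {0..<1}"

lemma space_unit_interval: "space unit_interval = {0..<1}"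
  by (simp add: unit_interval_def)

lemma prob_space_unit_interval: "prob_space unit_interval"
  by (rule prob_spaceI) (simp add: unit_interval_def emeasure_restrict_space)

lemma measure_address:
  assumes m: "m \<in> weights" and s: "length s = n"
  shows "{u \<in> space unit_interval. address m u n = s} \<in> sets unit_interval"
    "measure unit_interval {u \<in> space unit_interval. address m u n = s} = m s"
proof -
  have eq: "{u \<in> space unit_interval. address m u n = s} = {left_end m s ..< left_end m s + m s}"
    using address_eq_iff[OF m, of _ n s] s left_end_bounds[OF m, of s] by (auto simp: space_unit_interval)
  have sub: "{left_end m s ..< left_end m s + m s} \<subseteq> {0..<1}" using left_end_bounds[OF m, of s] by auto
  show "{u \<in> space unit_interval. address m u n = s} \<in> sets unit_interval"
    unfolding eq unfolding unit_interval_def using sub by (simp add: sets_restrict_space_iff)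
  show "measure unit_interval {u \<in> space unit_interval. address m u n = s} = m s"
    unfolding eq unfolding unit_interval_def using sub weightsD(1)[OF m, of s] by (simp add: measure_restrict_space)
qed

text \<open>Regularity places around the limit point some \<open>U j\<close> whose closure is inside
  \<open>V\<close>, and conversely bit \<open>j\<close> alone puts the limit point into that
  closure. So membership in \<open>V\<close> is a countable union of conditions on
  addresses.\<close>

lemma limit_point_mem_U_iff:
  assumes m: "m \<in> weights" and u: "0 \<le> u" "u < 1" and V: "openin X V"
  shows "limit_point m u \<in> V \<longleftrightarrow> (\<exists>j. X closure_of U j \<subseteq> V \<and> bit (address m u (Suc j)) j)"
proof
  assume "limit_point m u \<in> V"
  then obtain W C where W: "openin X W" "closedin X C" "limit_point m u \<in> W" "W \<subseteq> C" "C \<subseteq> V"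
    using compact_Hausdorff_imp_regular_space[OF compact Hausdorff] V
    unfolding neighbourhood_base_of_closedin[symmetric] neighbourhood_base_of by metis
  obtain j where j: "limit_point m u \<in> U j" "U j \<subseteq> W" using baseU[OF W(1,3)] by blast
  have "X closure_of U j \<subseteq> C" using j(2) W(2,4) by (intro closure_of_minimal) auto
  moreover have "bit (address m u (Suc j)) j"
    using bit_if_closure_meets[OF limit_point[OF m u, of "Suc j"] j(1)] by simp
  ultimately show "\<exists>j. X closure_of U j \<subseteq> V \<and> bit (address m u (Suc j)) j" using W(5) by blast
next
  assume "\<exists>j. X closure_of U j \<subseteq> V \<and> bit (address m u (Suc j)) j"
  then obtain j where j: "X closure_of U j \<subseteq> V" "bit (address m u (Suc j)) j" by blast
  then have "cell (address m u (Suc j)) \<subseteq> U j" using cell_bit[of j "address m u (Suc j)"] by simp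
  then show "limit_point m u \<in> V" using limit_point[OF m u, of "Suc j"] j(1) closure_of_mono by blast
qed

lemma measurable_limit_point:
  assumes m: "m \<in> weights"
  shows "limit_point m \<in> measurable unit_interval (borel_of X)"
  unfolding borel_of_def
proof (rule measurable_measure_of)
  show "{U. openin X U} \<subseteq> Pow (topspace X)" by (auto dest: openin_subset)
  show "limit_point m \<in> space unit_interval \<rightarrow> topspace X"
    using limit_point[OF m] by (auto simp: space_unit_interval in_closure_of)
  fix V assume "V \<in> {U. openin X U}"
  then have V: "openin X V" by simp
  have "limit_point m -` V \<inter> space unit_interval =
      (\<Union>j\<in>{j. X closure_of U j \<subseteq> V}. \<Union>s\<in>{s. length s = Suc j \<and> bit s j}. {u \<in> space unit_interval. address m u (Suc j) = s})"
    using limit_point_mem_U_iff[OF m _ _ V] by (auto simp: space_unit_interval simp del: address.simps)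
  also have "\<dots> \<in> sets unit_interval"
  proof (rule sets.countable_UN'')
    fix j
    show "(\<Union>s\<in>{s. length s = Suc j \<and> bit s j}. {u \<in> space unit_interval. address m u (Suc j) = s}) \<in> sets unit_interval"
    proof (rule sets.finite_UN)
      show "finite {s. length s = Suc j \<and> bit s j}" by (rule finite_subset[OF _ finite_words[of "Suc j"]]) blast
    qed (use measure_address(1)[OF m] in blast)
  qed simp
  finally show "limit_point m -` V \<inter> space unit_interval \<in> sets unit_interval" .
qed

text \<open>The masses of the cells under \<open>law m\<close> may differ from \<open>m\<close>,
  since a limit point can lie outside the cells that it is built from. Only integrals of continuous
  functions are compared.\<close>

definition law :: "(bool list \<Rightarrow> real) \<Rightarrow> 'a measure" where
  "law m = distr unit_interval (borel_of X) (limit_point m)"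

lemma law_prob_measures: "m \<in> weights \<Longrightarrow> law m \<in> prob_measures X"
  unfolding prob_measures_def law_def
  by (simp add: prob_space.prob_space_distr[OF prob_space_unit_interval measurable_limit_point])

text \<open>The finite sum is the one in \<open>prob_measures_integral_approx\<close>, so for
  weights that come from a measure the two integrals agree.\<close>

lemma law_integral_approx:
  assumes m: "m \<in> weights" and f: "continuous_map X euclideanreal f"
    and n: "\<And>s x. length s = n \<Longrightarrow> cell s \<noteq> {} \<Longrightarrow> x \<in> X closure_of cell s \<Longrightarrow> \<bar>f x - f (rep s)\<bar> \<le> \<epsilon>"
  shows "\<bar>(\<integral>x. f x \<partial>law m) - (\<Sum>s | length s = n. m s * f (rep s))\<bar> \<le> \<epsilon>"
proof -
  have fm: "f \<in> borel_measurable (borel_of X)" using f by (rule measurable_borel_of_continuous_map) simp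
  have "\<bar>(\<integral>u. f (limit_point m u) \<partial>unit_interval) -
      (\<Sum>s | length s = n. measure unit_interval {u \<in> space unit_interval. address m u n = s} * f (rep s))\<bar> \<le> \<epsilon>"
  proof (rule prob_integral_finite_valued_approx[OF prob_space_unit_interval])
    show "(\<lambda>u. f (limit_point m u)) \<in> borel_measurable unit_interval"
      by (rule measurable_compose[OF measurable_limit_point[OF m] fm])
    fix u assume "u \<in> space unit_interval"
    then have "0 \<le> u" "u < 1" by (auto simp: space_unit_interval)
    then show "\<bar>f (limit_point m u) - f (rep (address m u n))\<bar> \<le> \<epsilon>"
      using n limit_point[OF m] cell_address_nonempty[OF m] by simp
  qed (use measure_address(1)[OF m] finite_words in auto)
  then show ?thesis
    using measure_address(2)[OF m] integral_distr[OF measurable_limit_point[OF m] fm] by (simp add: law_def)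
qed

text \<open>The approximating sums are finite combinations of coordinates, and their error is
  uniform in \<open>m\<close>.\<close>

lemma continuous_on_law_integral:
  assumes f: "continuous_map X euclideanreal f"
  shows "continuous_on weights (\<lambda>m. \<integral>x. f x \<partial>law m)"
proof (rule uniform_limit_theorem)
  show "uniform_limit weights (\<lambda>n m. \<Sum>s | length s = n. m s * f (rep s)) (\<lambda>m. \<integral>x. f x \<partial>law m) sequentially"
  proof (rule uniform_limitI)
    fix e :: real assume e: "e > 0"
    then obtain n0 where n0: "\<And>s x. n0 \<le> length s \<Longrightarrow> cell s \<noteq> {} \<Longrightarrow> x \<in> X closure_of cell s \<Longrightarrow> \<bar>f x - f (rep s)\<bar> \<le> e / 2"
      using oscillation_on_cells[OF f, of "e / 2"] by auto
    have "dist (\<Sum>s | length s = n. m s * f (rep s)) (\<integral>x. f x \<partial>law m) < e" if "n0 \<le> n" "m \<in> weights" for n m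
      using law_integral_approx[OF that(2) f n0, of n] that(1) e by (simp add: dist_real_def abs_minus_commute)
    then show "\<forall>\<^sub>F n in sequentially. \<forall>m\<in>weights. dist (\<Sum>s | length s = n. m s * f (rep s)) (\<integral>x. f x \<partial>law m) < e"
      by (auto simp: eventually_sequentially)
  qed
  show "\<forall>\<^sub>F n in sequentially. continuous_on weights (\<lambda>m. \<Sum>s | length s = n. m s * f (rep s))"
    by (intro always_eventually allI continuous_intros continuous_on_subset[OF continuous_on_product_coordinates subset_UNIV])
qed simp

text \<open>The image of the compact set \<open>weights\<close> under the continuous map
  \<open>law\<close> is compact. Finitely many open sets that cover it cover every
  \<open>\<mu>\<close> too, since \<open>\<mu>\<close> cannot be told apart from the law of its own
  weights.\<close>

lemma compact_space_weak_star_topology: "compact_space (weak_star_topology X)"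
proof -
  have "continuous_map (top_of_set weights) (weak_star_topology X) law"
    unfolding weak_star_topology_def
  proof (rule continuous_on_generated_topo)
    fix B assume "B \<in> {{\<mu> \<in> prob_measures X. (\<integral>x. f x \<partial>\<mu>) \<in> V} | f V.
        continuous_map X euclideanreal f \<and> bounded (f ` topspace X) \<and> open V}"
    then obtain f V where B: "B = {\<mu> \<in> prob_measures X. (\<integral>x. f x \<partial>\<mu>) \<in> V}" "continuous_map X euclideanreal f" "open V" by blast
    have "law -` B \<inter> topspace (top_of_set weights) = weights \<inter> (\<lambda>m. \<integral>x. f x \<partial>law m) -` V"
      using law_prob_measures by (auto simp: B(1))
    then show "openin (top_of_set weights) (law -` B \<inter> topspace (top_of_set weights))"
      using continuous_openin_preimage_gen[OF continuous_on_law_integral[OF B(2)] B(3)] by simp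
  next
    show "law ` topspace (top_of_set weights) \<subseteq> \<Union> {{\<mu> \<in> prob_measures X. (\<integral>x. f x \<partial>\<mu>) \<in> V} | f V.
        continuous_map X euclideanreal f \<and> bounded (f ` topspace X) \<and> open V}"
      unfolding topology_generated_by_topspace[symmetric] weak_star_topology_def[symmetric] topspace_weak_star_topology
      using law_prob_measures by auto
  qed
  moreover have "compactin (top_of_set weights) weights" using compact_weights by (simp add: compactin_subtopology)
  ultimately have cpt: "compactin (weak_star_topology X) (law ` weights)" by (rule image_compactin[rotated])
  show ?thesis
    unfolding compact_space_alt
  proof (intro allI impI)
    fix \<U> assume "(\<forall>B\<in>\<U>. openin (weak_star_topology X) B) \<and> topspace (weak_star_topology X) \<subseteq> \<Union>\<U>"
    then have \<U>: "\<forall>B\<in>\<U>. openin (weak_star_topology X) B" "topspace (weak_star_topology X) \<subseteq> \<Union>\<U>" by auto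
    have "law ` weights \<subseteq> \<Union>\<U>" using \<U>(2) law_prob_measures unfolding topspace_weak_star_topology by blast
    then obtain \<F> where F: "finite \<F>" "\<F> \<subseteq> \<U>" "law ` weights \<subseteq> \<Union>\<F>"
      using cpt \<U>(1) unfolding compactin_def by metis
    have "\<mu> \<in> \<Union>\<F>" if \<mu>: "\<mu> \<in> prob_measures X" for \<mu>
    proof -
      define m where "m = (\<lambda>s. measure \<mu> (cell s))"
      have m: "m \<in> weights" unfolding m_def by (rule prob_measures_weights[OF \<mu>])
      then obtain B where B: "B \<in> \<F>" "law m \<in> B" using F(3) by blast
      have "(\<integral>x. f x \<partial>law m) = (\<integral>x. f x \<partial>\<mu>)" if f: "continuous_map X euclideanreal f" for f
      proof (rule ccontr)
        assume "(\<integral>x. f x \<partial>law m) \<noteq> (\<integral>x. f x \<partial>\<mu>)"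
        \<comment> \<open>Both integrals lie within a third of their distance from the same sum,
          which is impossible.\<close>
        then have e: "\<bar>(\<integral>x. f x \<partial>law m) - (\<integral>x. f x \<partial>\<mu>)\<bar> / 3 > 0" (is "?e > 0") by simp
        then obtain n where n: "\<And>s x. n \<le> length s \<Longrightarrow> cell s \<noteq> {} \<Longrightarrow> x \<in> X closure_of cell s \<Longrightarrow> \<bar>f x - f (rep s)\<bar> \<le> ?e"
          using oscillation_on_cells[OF f e] by auto
        have "\<bar>(\<integral>x. f x \<partial>law m) - (\<Sum>s | length s = n. m s * f (rep s))\<bar> \<le> ?e"
          using n by (intro law_integral_approx[OF m f]) auto
        moreover have "\<bar>(\<integral>x. f x \<partial>\<mu>) - (\<Sum>s | length s = n. m s * f (rep s))\<bar> \<le> ?e"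
          unfolding m_def using n[unfolded m_def] by (intro prob_measures_integral_approx[OF \<mu> f]) auto
        moreover have False if "\<bar>a - c\<bar> \<le> \<bar>a - b\<bar> / 3" "\<bar>b - c\<bar> \<le> \<bar>a - b\<bar> / 3" "0 < \<bar>a - b\<bar> / 3" for a b c :: real
          using that by (auto simp: abs_if split: if_splits)
        ultimately show False using e by blast
      qed
      then have "\<mu> \<in> B" using weak_star_indistinguishable[OF _ B(2) \<mu>] B(1) F(2) \<U>(1) by blast
      then show ?thesis using B(1) by blast
    qed
    then show "\<exists>\<F>. finite \<F> \<and> \<F> \<subseteq> \<U> \<and> topspace (weak_star_topology X) \<subseteq> \<Union>\<F>"
      unfolding topspace_weak_star_topology using F(1,2) by (intro exI[of _ \<F>]) blast
  qed
qed

end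

theorem compact_space_weak_star_topology:
  assumes "compact_space X" "Hausdorff_space X" "second_countable X"
  shows "compact_space (weak_star_topology X)"
proof -
  obtain \<B> where \<B>: "countable \<B>" "\<And>V. V \<in> \<B> \<Longrightarrow> openin X V"
    "\<And>V x. openin X V \<Longrightarrow> x \<in> V \<Longrightarrow> \<exists>B\<in>\<B>. x \<in> B \<and> B \<subseteq> V"
    using assms(3) unfolding second_countable_def by metis
  \<comment> \<open>The added empty set makes the enumerated family nonempty, so its range is
    exact.\<close>
  define U where "U = from_nat_into (insert {} \<B>)"
  have U: "range U = insert {} \<B>" unfolding U_def using \<B>(1) by (intro range_from_nat_into) auto
  interpret compact_space_with_base X U
  proof
    show "openin X (U i)" for i using U \<B>(2) openin_empty by (metis insertE rangeI)
    show "\<exists>i. x \<in> U i \<and> U i \<subseteq> V" if "openin X V" "x \<in> V" for V x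
      using \<B>(3)[OF that] U by (metis insertCI rangeE)
  qed (use assms in auto)
  show ?thesis by (rule compact_space_weak_star_topology)
qed

section \<open>Colorings\<close>

lemma pathstart_polygonal_path: "vs \<noteq> [] \<Longrightarrow> pathstart (polygonal_path vs) = hd vs"
  by (induction vs rule: polygonal_path.induct) auto

lemma pathfinish_polygonal_path: "vs \<noteq> [] \<Longrightarrow> pathfinish (polygonal_path vs) = last vs"
  by (induction vs rule: polygonal_path.induct) auto

text \<open>Appending \<open>hd vs\<close> closes the polygon, so the Jordan curve theorem provides
  a nonempty open inside.\<close>

lemma polygonal_tile_closed_interior:
  assumes "polygonal_tile P"
  shows "closed P" "interior P \<noteq> {}"
proof -
  obtain vs \<gamma> where vs: "3 \<le> length vs" and \<gamma>: "\<gamma> = polygonal_path (vs @ [hd vs])" "simple_path \<gamma>"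
    and P: "P = path_image \<gamma> \<union> inside (path_image \<gamma>)"
    using assms by (auto simp: polygonal_tile_def polygon_with_vertices_def Let_def)
  show "closed P" unfolding P by (rule closed_path_image_Un_inside[OF simple_path_imp_path[OF \<gamma>(2)]])
  have "vs \<noteq> []" using vs by auto
  then have "pathfinish \<gamma> = pathstart \<gamma>" by (simp add: \<gamma>(1) pathstart_polygonal_path pathfinish_polygonal_path)
  from Jordan_inside_outside[OF \<gamma>(2) this] have "inside (path_image \<gamma>) \<noteq> {}" "open (inside (path_image \<gamma>))" by auto
  moreover from this have "inside (path_image \<gamma>) \<subseteq> interior P" unfolding P by (intro interior_maximal) auto
  ultimately show "interior P \<noteq> {}" by blast
qed

text \<open>Disjoint nonempty open sets in the plane are countable in number. Countability is what
  puts open sets of colorings into the product \<sigma>-field.\<close>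

lemma countable_tiling:
  assumes "tiling E H"
  shows "countable H"
proof (rule countable_image_inj_on)
  have ne: "interior P \<noteq> {}" if "P \<in> H" for P
    using polygonal_tile_closed_interior(2) assms that by (auto simp: tiling_def)
  have dis: "interior P \<inter> interior P' = {}" if "P \<in> H" "P' \<in> H" "P \<noteq> P'" for P P'
    using assms that by (auto simp: tiling_def)
  show "countable (interior ` H)"
  proof (rule countable_disjoint_open_subsets)
    show "disjoint (interior ` H)" using dis by (fastforce simp: pairwise_def disjnt_def)
  qed auto
  show "inj_on interior H" using dis ne by (metis inf.idem inj_onI)
qed

lemma finite_tiles_meeting_compact:
  assumes H: "tiling E H" and K: "compact K" "K \<subseteq> E"
  shows "finite {P \<in> H. P \<inter> K \<noteq> {}}"
proof -
  have "\<forall>x\<in>K. \<exists>e>0. finite {P \<in> H. P \<inter> ball x e \<noteq> {}}" using H K(2) by (auto simp: tiling_def)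
  then obtain e where e: "\<And>x. x \<in> K \<Longrightarrow> e x > 0 \<and> finite {P \<in> H. P \<inter> ball x (e x) \<noteq> {}}" by metis
  have "K \<subseteq> (\<Union>x\<in>K. ball x (e x))" using e by auto
  then obtain X where X: "X \<subseteq> K" "finite X" "K \<subseteq> (\<Union>x\<in>X. ball x (e x))"
    by (rule compactE_image[OF K(1), of K "\<lambda>x. ball x (e x)", rotated]) auto
  have "{P \<in> H. P \<inter> K \<noteq> {}} \<subseteq> (\<Union>x\<in>X. {P \<in> H. P \<inter> ball x (e x) \<noteq> {}})" using X(3) by blast
  moreover have "finite (\<Union>x\<in>X. {P \<in> H. P \<inter> ball x (e x) \<noteq> {}})" using X e by blast
  ultimately show ?thesis by (rule finite_subset)
qed

text \<open>Local finiteness: near a point of \<open>E\<close> the open region is a finite union of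
  closed tiles.\<close>

lemma open_Diff_open_region:
  assumes E: "open E" and H: "tiling E H"
  shows "open (E - open_region H \<omega>)"
proof (subst open_subopen, intro ballI)
  fix x assume x: "x \<in> E - open_region H \<omega>"
  then obtain e where e: "e > 0" "finite {P \<in> H. P \<inter> ball x e \<noteq> {}}" using H by (auto simp: tiling_def)
  define F where "F = {P \<in> {P \<in> H. P \<inter> ball x e \<noteq> {}}. \<omega> P}"
  have "closed P" if "P \<in> F" for P
    using polygonal_tile_closed_interior(1) H that by (auto simp: F_def tiling_def)
  moreover have "finite F" unfolding F_def by (rule finite_subset[OF _ e(2)]) blast
  ultimately have "closed (\<Union>F)" by (intro closed_Union) auto
  then have "open (E \<inter> ball x e - \<Union>F)" using E by (intro open_Diff open_Int) auto
  moreover have "x \<in> E \<inter> ball x e - \<Union>F" using x e(1) by (auto simp: open_region_def F_def)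
  moreover have "E \<inter> ball x e - \<Union>F \<subseteq> E - open_region H \<omega>" by (auto simp: open_region_def F_def)
  ultimately show "\<exists>T. open T \<and> x \<in> T \<and> T \<subseteq> E - open_region H \<omega>" by blast
qed

lemma compact_Int_open_region:
  assumes "open E" "tiling E H" "compact K" "K \<subseteq> E"
  shows "compact (K \<inter> open_region H \<omega>)"
proof -
  have "K \<inter> open_region H \<omega> = K - (E - open_region H \<omega>)" using assms(4) by blast
  then show ?thesis using open_Diff_open_region[OF assms(1,2)] assms(3) by (simp add: compact_diff)
qed

lemma compact_quad_image:
  assumes "Q \<in> quads D"
  shows "compact (quad_image Q)"
  unfolding quad_image_def by (rule compact_continuous_image[OF quadsD(1)[OF assms] compact_unit_square])

lemma quad_sides:
  assumes Q: "Q \<in> quads D"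
  shows "compact (quad_side0 Q)" "compact (quad_side2 Q)" "quad_side0 Q \<subseteq> quad_image Q" "quad_side2 Q \<subseteq> quad_image Q"
    "quad_side0 Q \<inter> quad_side2 Q = {}"
proof -
  have sub: "{0} \<times> {0..1} \<subseteq> unit_square" "{1} \<times> {0..1} \<subseteq> unit_square" by (auto simp: unit_square_def)
  have "compact ({0::real} \<times> {0..1::real})" "compact ({1::real} \<times> {0..1::real})" by (intro compact_Times; simp)+
  then show "compact (quad_side0 Q)" "compact (quad_side2 Q)" unfolding quad_side0_def quad_side2_def
    using sub quadsD(1)[OF Q] by (auto intro!: compact_continuous_image continuous_on_subset[of unit_square Q])
  show "quad_side0 Q \<subseteq> quad_image Q" "quad_side2 Q \<subseteq> quad_image Q"
    unfolding quad_side0_def quad_side2_def quad_image_def using sub by blast+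
  have "Q ` ({0} \<times> {0..1}) \<inter> Q ` ({1} \<times> {0..1}) = Q ` (({0} \<times> {0..1}) \<inter> ({1} \<times> {0..1}))"
    by (rule inj_on_image_Int[OF quadsD(2)[OF Q] sub, symmetric])
  then show "quad_side0 Q \<inter> quad_side2 Q = {}" by (auto simp: quad_side0_def quad_side2_def)
qed

text \<open>The open part of a quad is compact, hence so are its components, and a component that
  meets both sides is itself a crossing. Conversely a crossing extends to a component.\<close>

lemma crossed_by_iff_crossing:
  assumes E: "open E" "tiling E H" "D \<subseteq> E" and Q: "Q \<in> quads D"
  shows "crossed_by H \<omega> Q \<longleftrightarrow> (\<exists>K. crossing Q K \<and> K \<subseteq> open_region H \<omega>)"
proof
  assume "crossed_by H \<omega> Q"
  then obtain C where C: "C \<in> components (quad_image Q \<inter> open_region H \<omega>)" "C \<inter> quad_side0 Q \<noteq> {}" "C \<inter> quad_side2 Q \<noteq> {}"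
    unfolding crossed_by_def by blast
  have "compact (quad_image Q \<inter> open_region H \<omega>)"
    by (rule compact_Int_open_region[OF E(1,2) compact_quad_image[OF Q]]) (use quadsD(3)[OF Q] E(3) in \<open>auto simp: quad_image_def\<close>)
  then have "compact C" using C(1) compact_components by blast
  then have "crossing Q C" using C in_components_connected[OF C(1)] in_components_subset[OF C(1)] by (auto simp: crossing_def)
  then show "\<exists>K. crossing Q K \<and> K \<subseteq> open_region H \<omega>" using in_components_subset[OF C(1)] by blast
next
  assume "\<exists>K. crossing Q K \<and> K \<subseteq> open_region H \<omega>"
  then obtain K where K: "connected K" "K \<subseteq> quad_image Q \<inter> open_region H \<omega>" "K \<inter> quad_side0 Q \<noteq> {}" "K \<inter> quad_side2 Q \<noteq> {}"
    by (auto simp: crossing_def)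
  then have "K \<noteq> {}" by blast
  then obtain C where "C \<in> components (quad_image Q \<inter> open_region H \<omega>)" "K \<subseteq> C"
    using exists_component_superset[OF K(2) _ K(1)] K(2) by blast
  then show "crossed_by H \<omega> Q" unfolding crossed_by_def using K(3,4) by blast
qed

text \<open>If \<open>Q\<close> is not crossed, the open part of \<open>[Q]\<close> splits into two
  compact pieces, one for each side. Disjoint open sets \<open>V1\<close>, \<open>V2\<close> around
  the pieces and their sides catch all open points of a nearby quad, so a crossing of that quad
  would be disconnected.\<close>

lemma openin_uncrossed_quads:
  assumes E: "open E" "tiling E H" "D \<subseteq> E"
  shows "openin (quad_topology D) {Q \<in> quads D. \<not> crossed_by H \<omega> Q}"
proof (subst openin_subopen, intro ballI)
  fix Q assume "Q \<in> {Q \<in> quads D. \<not> crossed_by H \<omega> Q}"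
  then have Q: "Q \<in> quads D" and nc: "\<not> crossed_by H \<omega> Q" by auto
  have QE: "quad_image Q \<subseteq> E" using quadsD(3)[OF Q] E(3) by (auto simp: quad_image_def)
  define A where "A = quad_image Q \<inter> open_region H \<omega>"
  have cA: "compact A" unfolding A_def by (rule compact_Int_open_region[OF E(1,2) compact_quad_image[OF Q] QE])
  have "closed (quad_side0 Q)" "closed (quad_side2 Q)" using quad_sides(1,2)[OF Q] by (auto intro: compact_imp_closed)
  then obtain A1 A2 where A: "compact A1" "compact A2" "A1 \<union> A2 = A" "A1 \<inter> A2 = {}"
    "A \<inter> quad_side0 Q \<subseteq> A1" "A \<inter> quad_side2 Q \<subseteq> A2"
  proof (rule compact_separation_if_unlinked[OF cA])
    fix C assume C: "connected C" "C \<subseteq> A" "C \<inter> quad_side0 Q \<noteq> {}" "C \<inter> quad_side2 Q \<noteq> {}"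
    have clA: "closure C \<subseteq> A" using C(2) cA by (simp add: closure_minimal compact_imp_closed)
    have "compact (closure C)" using compact_closure compact_imp_bounded[OF cA] bounded_subset C(2) by blast
    moreover have "connected (closure C)" by (rule connected_imp_connected_closure[OF C(1)])
    ultimately have "crossing Q (closure C)" using clA C(3,4) closure_subset[of C] by (auto simp: crossing_def A_def)
    then show False using nc crossed_by_iff_crossing[OF E Q] clA by (auto simp: A_def)
  qed
  have "compact (A1 \<union> quad_side0 Q)" "compact (A2 \<union> quad_side2 Q)"
    using A(1,2) quad_sides(1,2)[OF Q] by (auto intro: compact_Un)
  moreover have "(A1 \<union> quad_side0 Q) \<inter> (A2 \<union> quad_side2 Q) = {}"
    using A(3-6) quad_sides(5)[OF Q] by blast
  ultimately obtain V1 V2 where V: "open V1" "open V2" "A1 \<union> quad_side0 Q \<subseteq> V1" "A2 \<union> quad_side2 Q \<subseteq> V2" "V1 \<inter> V2 = {}"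
    using separation_normal_compact compact_imp_closed by metis
  define W where "W = (E - open_region H \<omega>) \<union> (V1 \<union> V2)"
  have W: "open W" unfolding W_def by (intro open_Un open_Diff_open_region[OF E(1,2)] V)
  have QW: "quad_image Q \<subseteq> W" using QE A(3) V(3,4) by (auto simp: W_def A_def)
  define N where "N = {Q' \<in> quads D. Q' ` unit_square \<subseteq> W} \<inter> {Q' \<in> quads D. Q' ` ({0} \<times> {0..1}) \<subseteq> V1} \<inter>
      {Q' \<in> quads D. Q' ` ({1} \<times> {0..1}) \<subseteq> V2}"
  have "compact ({0::real} \<times> {0..1::real})" "compact ({1::real} \<times> {0..1::real})" by (intro compact_Times; simp)+
  then have "openin (quad_topology D) N"
    unfolding N_def by (intro openin_Int openin_quads_mapping_into compact_unit_square W V(1,2)) (auto simp: unit_square_def)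
  moreover have "Q \<in> N" using Q QW V(3,4) by (auto simp: N_def quad_image_def quad_side0_def quad_side2_def)
  moreover have "N \<subseteq> {Q \<in> quads D. \<not> crossed_by H \<omega> Q}"
  proof
    fix Q' assume Q': "Q' \<in> N"
    then have Q'q: "Q' \<in> quads D" by (simp add: N_def)
    have "\<not> crossed_by H \<omega> Q'"
    proof
      assume "crossed_by H \<omega> Q'"
      then obtain K where K: "crossing Q' K" "K \<subseteq> open_region H \<omega>" using crossed_by_iff_crossing[OF E Q'q] by blast
      have sides: "quad_image Q' \<subseteq> W" "quad_side0 Q' \<subseteq> V1" "quad_side2 Q' \<subseteq> V2"
        using Q' by (simp_all add: N_def quad_image_def quad_side0_def quad_side2_def)
      have K': "K \<subseteq> quad_image Q'" "K \<inter> quad_side0 Q' \<noteq> {}" "K \<inter> quad_side2 Q' \<noteq> {}" "connected K"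
        using K(1) by (simp_all add: crossing_def)
      have "K \<subseteq> W" using K'(1) sides(1) by (rule subset_trans)
      then have "K \<subseteq> V1 \<union> V2" using K(2) unfolding W_def by blast
      moreover have "V1 \<inter> K \<noteq> {}" "V2 \<inter> K \<noteq> {}" using K'(2,3) sides(2,3) by blast+
      ultimately show False using connectedD[OF K'(4) V(1,2)] V(5) by auto
    qed
    then show "Q' \<in> {Q \<in> quads D. \<not> crossed_by H \<omega> Q}" using Q'q by simp
  qed
  ultimately show "\<exists>N. openin (quad_topology D) N \<and> Q \<in> N \<and> N \<subseteq> {Q \<in> quads D. \<not> crossed_by H \<omega> Q}" by blast
qed

lemma crossed_quads_config_space:
  assumes E: "open E" "tiling E H" "D \<subseteq> E"
  shows "crossed_quads D H \<omega> \<in> config_space D"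
proof -
  have "Q' \<in> crossed_quads D H \<omega>" if Q: "Q \<in> crossed_quads D H \<omega>" "Q' \<in> quads D" "quad_less D Q' Q" for Q Q'
  proof -
    have "Q \<in> quads D" "crossed_by H \<omega> Q" using Q(1) by (auto simp: crossed_quads_def)
    then obtain K where K: "crossing Q K" "K \<subseteq> open_region H \<omega>" using crossed_by_iff_crossing[OF E] by blast
    have "quad_le Q' Q" using Q(3) unfolding quad_less_def by blast
    then obtain K' where "K' \<subseteq> K" "crossing Q' K'" using K(1) unfolding quad_le_def by blast
    then have "crossed_by H \<omega> Q'" using crossed_by_iff_crossing[OF E Q(2)] K(2) by blast
    then show ?thesis using Q(2) by (simp add: crossed_quads_def)
  qed
  moreover have "closedin (quad_topology D) (crossed_quads D H \<omega>)"
  proof -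
    have "topspace (quad_topology D) - crossed_quads D H \<omega> = {Q \<in> quads D. \<not> crossed_by H \<omega> Q}"
      unfolding topspace_quad_topology by (auto simp: crossed_quads_def)
    then show ?thesis using openin_uncrossed_quads[OF E, of \<omega>] topspace_quad_topology[of D]
      unfolding closedin_def by (simp add: crossed_quads_def)
  qed
  moreover have "crossed_quads D H \<omega> \<subseteq> quads D" by (auto simp: crossed_quads_def)
  ultimately show ?thesis by (auto simp: config_space_def lower_set_def)
qed

section \<open>Measurability of the crossed quads as a function of the coloring\<close>

lemma openin_product_discrete_iff:
  "openin (product_topology (\<lambda>_. discrete_topology UNIV) I) S \<longleftrightarrow> S \<subseteq> extensional I \<and>
     (\<forall>x\<in>S. \<exists>F. finite F \<and> F \<subseteq> I \<and> (\<forall>y\<in>extensional I. (\<forall>i\<in>F. y i = x i) \<longrightarrow> y \<in> S))"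
  (is "openin ?T S \<longleftrightarrow> ?R")
proof
  assume S: "openin ?T S"
  have "S \<subseteq> extensional I" using openin_subset[OF S] by (auto simp: PiE_def)
  moreover have "\<exists>F. finite F \<and> F \<subseteq> I \<and> (\<forall>y\<in>extensional I. (\<forall>i\<in>F. y i = x i) \<longrightarrow> y \<in> S)" if x: "x \<in> S" for x
  proof -
    obtain X where X: "x \<in> PiE I X" "finite {i. X i \<noteq> UNIV}" "PiE I X \<subseteq> S"
      using product_topology_open_contains_basis[OF S x] by auto
    define F where "F = {i \<in> I. X i \<noteq> UNIV}"
    have "y \<in> PiE I X" if "y \<in> extensional I" "\<forall>i\<in>F. y i = x i" for y
    proof (rule PiE_I)
      fix i assume "i \<in> I"
      then show "y i \<in> X i" using that(2) X(1) by (cases "X i = UNIV") (auto simp: F_def)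
    qed (use that(1) in \<open>auto simp: extensional_def\<close>)
    moreover have "finite F" "F \<subseteq> I" unfolding F_def using finite_subset[OF _ X(2)] by auto
    ultimately show ?thesis using X(3) by (intro exI[of _ F]) blast
  qed
  ultimately show ?R by blast
next
  assume R: ?R
  show "openin ?T S"
  proof (subst openin_subopen, intro ballI)
    fix x assume x: "x \<in> S"
    then obtain F where F: "finite F" "F \<subseteq> I" "\<And>y. y \<in> extensional I \<Longrightarrow> (\<And>i. i \<in> F \<Longrightarrow> y i = x i) \<Longrightarrow> y \<in> S" using R by meson
    define T where "T = PiE I (\<lambda>i. if i \<in> F then {x i} else UNIV)"
    have "{i \<in> I. (if i \<in> F then {x i} else UNIV) \<noteq> topspace (discrete_topology UNIV)} \<subseteq> F" by auto
    then have "openin ?T T" unfolding T_def openin_PiE_gen using F(1) finite_subset by auto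
    moreover have "x \<in> T" using x R by (auto simp: T_def PiE_def)
    moreover have "T \<subseteq> S" using F(2,3) by (fastforce simp: T_def PiE_def Pi_def)
    ultimately show "\<exists>T. openin ?T T \<and> x \<in> T \<and> T \<subseteq> S" by blast
  qed
qed

text \<open>An open set is the union of the cylinders inside it, and over a countable index set
  there are only countably many cylinders.\<close>

lemma sets_PiM_openin_product_discrete:
  fixes S :: "('i \<Rightarrow> bool) set"
  assumes I: "countable I" and S: "openin (product_topology (\<lambda>_. discrete_topology UNIV) I) S"
  shows "S \<in> sets (\<Pi>\<^sub>M i\<in>I. count_space (UNIV :: bool set))"
proof -
  let ?M = "\<Pi>\<^sub>M i\<in>I. count_space (UNIV :: bool set)"
  have space: "space ?M = extensional I" by (auto simp: space_PiM PiE_def)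
  \<comment> \<open>A pair encodes a finite pattern: the first set lists the prescribed coordinates,
    the second those with value \<open>True\<close>.\<close>
  define cyl where "cyl p = {y \<in> space ?M. \<forall>i\<in>fst p. y i = (i \<in> snd p)}" for p :: "'i set \<times> 'i set"
  define J where "J = {p \<in> {F. finite F \<and> F \<subseteq> I} \<times> {F. finite F \<and> F \<subseteq> I}. cyl p \<subseteq> S}"
  have ext_S: "S \<subseteq> extensional I"
    and loc: "\<forall>x\<in>S. \<exists>F. finite F \<and> F \<subseteq> I \<and> (\<forall>y\<in>extensional I. (\<forall>i\<in>F. y i = x i) \<longrightarrow> y \<in> S)"
    using S[unfolded openin_product_discrete_iff] by blast+
  have "S = (\<Union>p\<in>J. cyl p)"
  proof
    show "S \<subseteq> (\<Union>p\<in>J. cyl p)"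
    proof
      fix x assume x: "x \<in> S"
      obtain F where F: "finite F" "F \<subseteq> I" "\<forall>y\<in>extensional I. (\<forall>i\<in>F. y i = x i) \<longrightarrow> y \<in> S"
        using bspec[OF loc x] by (elim exE conjE)
      define p where "p = (F, {i \<in> F. x i})"
      have "cyl p \<subseteq> S"
      proof
        fix y assume "y \<in> cyl p"
        then have "y \<in> extensional I" "\<forall>i\<in>F. y i = x i" by (auto simp: cyl_def p_def space)
        then show "y \<in> S" using F(3) by blast
      qed
      then have "p \<in> J" using F(1,2) by (auto simp: J_def p_def)
      moreover have "x \<in> cyl p" using x ext_S by (auto simp: cyl_def p_def space)
      ultimately show "x \<in> (\<Union>p\<in>J. cyl p)" by blast
    qed
  qed (auto simp: J_def)
  moreover have "countable J"
  proof (rule countable_subset)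
    show "J \<subseteq> {F. finite F \<and> F \<subseteq> I} \<times> {F. finite F \<and> F \<subseteq> I}" by (auto simp: J_def)
    show "countable ({F. finite F \<and> F \<subseteq> I} \<times> {F. finite F \<and> F \<subseteq> I})"
      by (intro countable_SIGMA countable_Collect_finite_subset I)
  qed
  moreover have "cyl p \<in> sets ?M" if "p \<in> J" for p
    unfolding cyl_def
  proof (rule sets.sets_Collect_finite_All)
    show "finite (fst p)" using that by (auto simp: J_def)
    fix i assume "i \<in> fst p"
    then have "i \<in> I" using that by (auto simp: J_def)
    then have "(\<lambda>y. y i) \<in> measurable ?M (count_space UNIV)" by (rule measurable_component_singleton)
    then have "(\<lambda>y. y i) -` {i \<in> snd p} \<inter> space ?M \<in> sets ?M" by (rule measurable_sets) simp
    moreover have "{y \<in> space ?M. y i = (i \<in> snd p)} = (\<lambda>y. y i) -` {i \<in> snd p} \<inter> space ?M" by auto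
    ultimately show "{y \<in> space ?M. y i = (i \<in> snd p)} \<in> sets ?M" by simp
  qed
  ultimately show ?thesis by (simp only:) (rule sets.countable_UN'', auto)
qed

lemma crossing_subset: "crossing Q K \<Longrightarrow> K \<subseteq> quad_image Q"
  by (simp add: crossing_def)

lemma subset_open_region_cong:
  assumes K: "K \<subseteq> open_region H \<omega>" "K \<subseteq> A"
    and eq: "\<And>P. P \<in> H \<Longrightarrow> P \<inter> A \<noteq> {} \<Longrightarrow> \<omega>' P = \<omega> P"
  shows "K \<subseteq> open_region H \<omega>'"
proof
  fix x assume x: "x \<in> K"
  then obtain P where P: "P \<in> H" "\<omega> P" "x \<in> P" using K(1) by (auto simp: open_region_def)
  then have "\<omega>' P" using eq[of P] x K(2) by blast
  then show "x \<in> open_region H \<omega>'" using P by (auto simp: open_region_def)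
qed

text \<open>Whether a fixed quad is crossed depends only on the finitely many tiles that meet it.
  For a hit set one crossed quad of \<open>U\<close> is a witness that persists as long as these
  tiles keep their colors.\<close>

lemma continuous_map_crossed_quads:
  assumes E: "open E" "tiling E H" "D \<subseteq> E"
  shows "continuous_map (product_topology (\<lambda>_. discrete_topology UNIV) H) (config_topology D) (crossed_quads D H)"
  unfolding config_topology_subbase
proof (rule continuous_on_generated_topo)
  let ?T = "product_topology (\<lambda>_. discrete_topology (UNIV :: bool set)) H"
  have top: "topspace ?T = extensional H" by (auto simp: PiE_def)
  fix B assume "B \<in> config_subbase D"
  then consider "B = config_space D" | U where "openin (quad_topology D) U" "B = hit_set D U"
    | Q where "Q \<in> quads D" "B = miss_set D Q" unfolding config_subbase_def by blast
  then show "openin ?T (crossed_quads D H -` B \<inter> topspace ?T)"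
  proof cases
    case 1
    have "crossed_quads D H -` B \<inter> topspace ?T = topspace ?T" using crossed_quads_config_space[OF E] 1 by auto
    then show ?thesis by (simp only: openin_topspace)
  next
    case (2 U)
    have "\<exists>F. finite F \<and> F \<subseteq> H \<and> (\<forall>\<omega>'\<in>extensional H. (\<forall>P\<in>F. \<omega>' P = \<omega> P) \<longrightarrow> crossed_quads D H \<omega>' \<in> B)"
      if \<omega>: "crossed_quads D H \<omega> \<in> B" for \<omega>
    proof -
      obtain Q where Q: "Q \<in> quads D" "Q \<in> U" "crossed_by H \<omega> Q"
        using \<omega> by (auto simp: 2(2) hit_set_def crossed_quads_def)
      then obtain K where K: "crossing Q K" "K \<subseteq> open_region H \<omega>" using crossed_by_iff_crossing[OF E] by blast
      define F where "F = {P \<in> H. P \<inter> quad_image Q \<noteq> {}}"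
      have "finite F" unfolding F_def
        by (rule finite_tiles_meeting_compact[OF E(2) compact_quad_image[OF Q(1)]])
          (use quadsD(3)[OF Q(1)] E(3) in \<open>auto simp: quad_image_def\<close>)
      moreover have "crossed_quads D H \<omega>' \<in> B" if "\<forall>P\<in>F. \<omega>' P = \<omega> P" for \<omega>'
      proof -
        have "K \<subseteq> open_region H \<omega>'"
          by (rule subset_open_region_cong[OF K(2) crossing_subset[OF K(1)]]) (use that in \<open>simp add: F_def\<close>)
        then have "Q \<in> crossed_quads D H \<omega>'" using K(1) Q(1) crossed_by_iff_crossing[OF E Q(1)] by (auto simp: crossed_quads_def)
        then show ?thesis using Q(2) crossed_quads_config_space[OF E] by (auto simp: 2(2) hit_set_def)
      qed
      ultimately show ?thesis by (intro exI[of _ F]) (auto simp: F_def)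
    qed
    then show ?thesis unfolding openin_product_discrete_iff top by (auto simp: Int_def)
  next
    case (3 Q)
    define F where "F = {P \<in> H. P \<inter> quad_image Q \<noteq> {}}"
    have F: "finite F" "F \<subseteq> H" unfolding F_def
      using finite_tiles_meeting_compact[OF E(2) compact_quad_image[OF 3(1)]] quadsD(3)[OF 3(1)] E(3)
      by (auto simp: quad_image_def)
    have "crossed_quads D H \<omega>' \<in> B" if "crossed_quads D H \<omega> \<in> B" "\<forall>P\<in>F. \<omega>' P = \<omega> P" for \<omega> \<omega>'
    proof -
      have "\<not> crossed_by H \<omega>' Q"
      proof
        assume "crossed_by H \<omega>' Q"
        then obtain K where K: "crossing Q K" "K \<subseteq> open_region H \<omega>'" using crossed_by_iff_crossing[OF E 3(1)] by blast
        have "K \<subseteq> open_region H \<omega>"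
          by (rule subset_open_region_cong[OF K(2) crossing_subset[OF K(1)]]) (use that(2) in \<open>simp add: F_def\<close>)
        then have "crossed_by H \<omega> Q" using K(1) crossed_by_iff_crossing[OF E 3(1)] by blast
        then show False using that(1) 3(1) by (auto simp: 3(2) miss_set_def crossed_quads_def)
      qed
      then show ?thesis using crossed_quads_config_space[OF E] by (auto simp: 3(2) miss_set_def crossed_quads_def)
    qed
    then show ?thesis unfolding openin_product_discrete_iff top using F by (auto intro!: exI[of _ F])
  qed
next
  show "crossed_quads D H ` topspace (product_topology (\<lambda>_. discrete_topology UNIV) H) \<subseteq> \<Union> (config_subbase D)"
    using crossed_quads_config_space[OF E] by (auto simp: config_subbase_def)
qed

text \<open>Measurability of \<open>crossed_quads\<close> is what makes the \<open>distr\<close> a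
  probability measure; continuity gives it on open sets, which generate the Borel sets.\<close>

lemma discrete_measure_prob_measures:
  assumes E: "open E" "tiling E H" "D \<subseteq> E" and M: "random_coloring H M"
  shows "discrete_measure D H M \<in> prob_measures (config_topology D)"
proof -
  interpret prob_space M using M by (simp add: random_coloring_def)
  have sets: "sets M = sets (\<Pi>\<^sub>M P\<in>H. count_space (UNIV :: bool set))" using M by (simp add: random_coloring_def)
  have space: "space M = topspace (product_topology (\<lambda>_. discrete_topology UNIV) H)"
    using sets_eq_imp_space_eq[OF sets] by (simp add: space_PiM)
  have "crossed_quads D H \<in> measurable M (borel_of (config_topology D))"
    unfolding borel_of_def
  proof (rule measurable_measure_of)
    show "{U. openin (config_topology D) U} \<subseteq> Pow (topspace (config_topology D))" by (auto dest: openin_subset)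
    show "crossed_quads D H \<in> space M \<rightarrow> topspace (config_topology D)"
      using crossed_quads_config_space[OF E] by (simp add: topspace_config_topology)
    fix V assume "V \<in> {U. openin (config_topology D) U}"
    then have "openin (product_topology (\<lambda>_. discrete_topology UNIV) H)
        {\<omega> \<in> topspace (product_topology (\<lambda>_. discrete_topology UNIV) H). crossed_quads D H \<omega> \<in> V}"
      by (intro openin_continuous_map_preimage[OF continuous_map_crossed_quads[OF E]]) simp
    from sets_PiM_openin_product_discrete[OF countable_tiling[OF E(2)] this]
    show "crossed_quads D H -` V \<inter> space M \<in> sets M" unfolding sets space by (simp add: vimage_def Int_def conj_commute)
  qed
  then show ?thesis by (simp add: discrete_measure_def prob_measures_def prob_space_distr)
qed

theorem corollary1p16:
  fixes D :: "complex set"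
  assumes "plane_domain D"
  shows "precompact_in (weak_star_topology (config_topology D)) (discrete_measures D)"
  unfolding precompact_in_def
proof
  have D: "open D" using assms by (simp add: plane_domain_def)
  show "discrete_measures D \<subseteq> topspace (weak_star_topology (config_topology D))"
    using discrete_measure_prob_measures
    by (fastforce simp: topspace_weak_star_topology discrete_measures_def plane_domain_def trivalent_tiling_def)
  show "compactin (weak_star_topology (config_topology D)) (weak_star_topology (config_topology D) closure_of discrete_measures D)"
    by (intro closedin_compact_space[OF compact_space_weak_star_topology] closedin_closure_of
        compact_config_topology Hausdorff_config_topology[OF D] second_countable_config_topology[OF D])
qed

end
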